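(* Let $\nu$ be a cofinitely generated $\Sigma$-tensor norm on duals (on the class of Banach spaces) and let $\alpha$ be the finitely generated $\Sigma$-tensor norm on spaces defined by $\nu$. Then for every election $(n,X_1,\dots,X_n,Y,\beta)$ of Banach spaces, $\left(\mathcal{L}^\beta(X_1,\dots,X_n)\otimes Y,\nu_\beta\right)$ is isometrically contained in $\left(X_1\otimes\cdots\otimes X_n\otimes Y^*,\alpha^\beta\right)^*$; the inclusion is the linear map given by evaluation, $\langle\varphi\otimes y,\,x^1\otimes\cdots\otimes x^n\otimes y^*\rangle=\varphi(x^1,\dots,x^n)\,y^*(y)$.
   Context: **Basic notation.** $\mathbb{K}$ is the real or complex field. An election in the class of Banach spaces is a tuple $(n,X_1,\dots,X_n,Y,\beta)$ with $n$ a positive integer, $X_1,\dots,X_n,Y$ Banach spaces over $\mathbb{K}$ and $\beta$ a reasonable crossnorm on the algebraic tensor product $X_1\otimes\cdots\otimes X_n$, i.e. a norm with $\varepsilon\le\beta\le\pi$ ($\varepsilon$, $\pi$ the injective and projective tensor norms). If $E_i\subset X_i$ are closed subspaces, $\beta|$ is the restriction of $\beta$ to $E_1\otimes\cdots\otimes E_n$ (again a reasonable crossnorm). $\Sigma_{X_1,\dots,X_n}=\{x^1\otimes\cdots\otimes x^n: x^i\in X_i\}$. $\mathcal{L}^\beta(X_1,\dots,X_n)$ is the space of multilinear forms $\varphi$ on $X_1\times\cdots\times X_n$ whose linearization $\tilde\varphi$ is bounded on $(X_1\otimes\cdots\otimes X_n,\beta)$, with norm $\|\varphi\|_\beta=\|\tilde\varphi\|$;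 it is identified with $(X_1\otimes\cdots\otimes X_n,\beta)^*$. $f_\varphi=\tilde\varphi|_{\Sigma_{X_1,\dots,X_n}}$. $\mathcal{F}(X)$ is the set of finite dimensional subspaces of $X$, $\mathcal{CF}(Y)$ the set of closed finite codimensional subspaces of $Y$, and $Q_L:Y\to Y/L$ the quotient map. **$\Sigma$-tensor norm on duals.** A bounded linear operator $B:\mathcal{L}^\beta(X_1,\dots,X_n)\to\mathcal{L}^\theta(Z_1,\dots,Z_m)$ preserves $\Sigma$ if its adjoint $B^*:(Z_1\otimes\cdots\otimes Z_m,\theta)^{**}\to(X_1\otimes\cdots\otimes X_n,\beta)^{**}$ maps the canonical image of $\Sigma_{Z_1,\dots,Z_m}$ into the canonical image of $\Sigma_{X_1,\dots,X_n}$. A $\Sigma$-tensor norm on duals $\nu$ assigns to each election $(n,X_1,\dots,X_n,Y,\beta)$ a norm $\nu_\beta$ on $\mathcal{L}^\beta(X_1,\dots,X_n)\otimes Y$ such that: (D1) $\nu_\beta(\varphi\otimes y)\le\|\varphi\|_\beta\|y\|$; (D2) for $p,q\in\Sigma_{X_1,\dots,X_n}$, $y^*\in Y^*$, the functional $\varphi\otimes y\mapsto(f_\varphi(p)-f_\varphi(q))y^*(y)$ is bounded with norm $\le\beta(p-q)\|y^*\|$; (D3) if $B:\mathcal{L}^\beta(X_1,\dots,X_n)\to\mathcal{L}^\theta(Z_1,\dots,Z_m)$ is bounded linear and preserves $\Sigma$ and $C:Y\to W$ is bounded linear, then $B\otimes C:(\mathcal{L}^\beta(X_1,\dots,X_n)\otimes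 Y,\nu_\beta)\to(\mathcal{L}^\theta(Z_1,\dots,Z_m)\otimes W,\nu_\theta)$ is bounded with norm $\le\|B\|\|C\|$. **Cofinitely generated.** $\nu$ is cofinitely generated if for every election and every $v\in\mathcal{L}^\beta(X_1,\dots,X_n)\otimes Y$, $\nu_\beta(v)=\sup\nu_{\beta|}\big((R_{E_1,\dots,E_n}\otimes Q_L)(v);\mathcal{L}^{\beta|}(E_1,\dots,E_n),Y/L\big)$, the supremum over all $E_i\in\mathcal{F}(X_i)$ and $L\in\mathcal{CF}(Y)$, where $R_{E_1,\dots,E_n}:\mathcal{L}^\beta(X_1,\dots,X_n)\to\mathcal{L}^{\beta|}(E_1,\dots,E_n)$ is the restriction map. **The $\alpha$ defined by $\nu$.** For finite dimensional normed spaces, $\alpha^\beta$ is the norm on $E_1\otimes\cdots\otimes E_n\otimes F$ given by $(E_1\otimes\cdots\otimes E_n\otimes F,\alpha^\beta):=(\mathcal{L}^\beta(E_1,\dots,E_n)\otimes F^*,\nu_\beta)^*$, with the pairing $\langle x^1\otimes\cdots\otimes x^n\otimes y,\varphi\otimes y^*\rangle=\varphi(x^1,\dots,x^n)y^*(y)$. For an election of Banach spaces and $u\in X_1\otimes\cdots\otimes X_n\otimes Y$, $\alpha^\beta(u;X_1,\dots,X_n,Y):=\inf\alpha^{\beta|}(u;E_1,\dots,E_n,F)$, the infimum over all $E_i\in\mathcal{F}(X_i)$, $F\in\mathcal{F}(Y)$ with $u\in E_1\otimes\cdots\otimes E_n\otimes F$. *)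

theory Defs
  imports Complex_Main "HOL-Library.FuncSet" "HOL-Library.Function_Algebras"
begin

(* The scalar field is the real or the complex field: in an instance either i = 0, and then every
   scalar is real, or i is an imaginary unit and the norm is the usual modulus. *)
class real_or_complex = real_normed_field +
  assumes real_or_complex:
    "\<exists>i. (i = 0 \<or> i * i = - 1) \<and>
         (\<forall>z. \<exists>a b. z = a *\<^sub>R 1 + b *\<^sub>R i \<and> (norm z)\<^sup>2 = a\<^sup>2 + b\<^sup>2)"

instance real :: real_or_complex
proof
  show "\<exists>i::real. (i = 0 \<or> i * i = - 1) \<and>
         (\<forall>z. \<exists>a b. z = a *\<^sub>R 1 + b *\<^sub>R i \<and> (norm z)\<^sup>2 = a\<^sup>2 + b\<^sup>2)"
    by (rule exI[of _ 0]) (auto intro: exI[of _ 0])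
qed

instance complex :: real_or_complex
proof
  have "z = Re z *\<^sub>R 1 + Im z *\<^sub>R \<i> \<and> (norm z)\<^sup>2 = (Re z)\<^sup>2 + (Im z)\<^sup>2" for z :: complex
    by (simp add: cmod_power2 complex_eq_iff)
  then show "\<exists>i::complex. (i = 0 \<or> i * i = - 1) \<and>
         (\<forall>z. \<exists>a b. z = a *\<^sub>R 1 + b *\<^sub>R i \<and> (norm z)\<^sup>2 = a\<^sup>2 + b\<^sup>2)"
    by (intro exI[of _ \<i>]) (simp, blast)
qed


section \<open>Normed spaces in a universe of vectors\<close>

(* The universe is a type 'a of class ab_group_add. A normed space carries its own scalar
   multiplication and norm and lives on a linear subspace of 'a; only the values of the norm on
   that subspace matter. Since 'a is arbitrary (for instance a product of the spaces at hand), any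
   given Banach spaces occur in a suitable universe, up to isometric isomorphism. *)
record ('k, 'a) nspace =
  car :: "'a set"
  scl :: "'k \<Rightarrow> 'a \<Rightarrow> 'a"
  nrm :: "'a \<Rightarrow> real"

definition normed :: "('k::real_or_complex, 'a::ab_group_add) nspace \<Rightarrow> bool" where
  "normed V \<longleftrightarrow> vector_space (scl V) \<and> module.subspace (scl V) (car V) \<and>
     (\<forall>x\<in>car V. 0 \<le> nrm V x \<and> (nrm V x = 0 \<longleftrightarrow> x = 0)) \<and>
     (\<forall>c. \<forall>x\<in>car V. nrm V (scl V c x) = norm c * nrm V x) \<and>
     (\<forall>x\<in>car V. \<forall>y\<in>car V. nrm V (x + y) \<le> nrm V x + nrm V y)"

definition banach_space :: "('k::real_or_complex, 'a::ab_group_add) nspace \<Rightarrow> bool" where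
  "banach_space V \<longleftrightarrow> normed V \<and>
     (\<forall>s::nat \<Rightarrow> 'a. (\<forall>k. s k \<in> car V) \<and>
        (\<forall>e>0. \<exists>N. \<forall>j\<ge>N. \<forall>k\<ge>N. nrm V (s j - s k) < e) \<longrightarrow>
        (\<exists>l\<in>car V. (\<lambda>k. nrm V (s k - l)) \<longlonglongrightarrow> 0))"

definition scalars :: "('k::real_or_complex, 'k) nspace" where
  "scalars = \<lparr>car = UNIV, scl = (*), nrm = norm\<rparr>"

definition lin :: "('k::real_or_complex, 'a::ab_group_add) nspace \<Rightarrow>
    ('k, 'b::ab_group_add) nspace \<Rightarrow> ('a \<Rightarrow> 'b) \<Rightarrow> bool" where
  "lin V W f \<longleftrightarrow> (\<forall>x\<in>car V. f x \<in> car W) \<and>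
     (\<forall>x\<in>car V. \<forall>y\<in>car V. f (x + y) = f x + f y) \<and>
     (\<forall>c. \<forall>x\<in>car V. f (scl V c x) = scl W c (f x))"

definition bounded_by :: "('k::real_or_complex, 'a::ab_group_add) nspace \<Rightarrow>
    ('k, 'b::ab_group_add) nspace \<Rightarrow> ('a \<Rightarrow> 'b) \<Rightarrow> real \<Rightarrow> bool" where
  "bounded_by V W f C \<longleftrightarrow> lin V W f \<and> (\<forall>x\<in>car V. nrm W (f x) \<le> C * nrm V x)"

definition bounded_op :: "('k::real_or_complex, 'a::ab_group_add) nspace \<Rightarrow>
    ('k, 'b::ab_group_add) nspace \<Rightarrow> ('a \<Rightarrow> 'b) \<Rightarrow> bool" where
  "bounded_op V W f \<longleftrightarrow> (\<exists>C. bounded_by V W f C)"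

definition opnorm :: "('k::real_or_complex, 'a::ab_group_add) nspace \<Rightarrow>
    ('k, 'b::ab_group_add) nspace \<Rightarrow> ('a \<Rightarrow> 'b) \<Rightarrow> real" where
  "opnorm V W f = Sup {nrm W (f x) | x. x \<in> car V \<and> nrm V x \<le> 1}"

(* Spaces of K-valued functions carry the pointwise operations; a function that is only
   meaningful on some set is extended by 0, so that equality of functions is equality there. *)
definition pscale :: "'k::real_or_complex \<Rightarrow> ('a \<Rightarrow> 'k) \<Rightarrow> 'a \<Rightarrow> 'k" where
  "pscale c f = (\<lambda>x. c * f x)"

lemma vector_space_pscale: "vector_space pscale"
  by unfold_locales (auto simp: pscale_def fun_eq_iff algebra_simps)

definition dual :: "('k::real_or_complex, 'a::ab_group_add) nspace \<Rightarrow> ('k, 'a \<Rightarrow> 'k) nspace" where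
  "dual V = \<lparr>car = {f. bounded_op V scalars f \<and> (\<forall>x. x \<notin> car V \<longrightarrow> f x = 0)},
             scl = pscale, nrm = opnorm V scalars\<rparr>"

definition fin_dim_subspace :: "('k::real_or_complex, 'a::ab_group_add) nspace \<Rightarrow> 'a set \<Rightarrow> bool" where
  "fin_dim_subspace V E \<longleftrightarrow> E \<subseteq> car V \<and> (\<exists>B. finite B \<and> E = module.span (scl V) B)"

definition closed_fin_codim_subspace ::
    "('k::real_or_complex, 'a::ab_group_add) nspace \<Rightarrow> 'a set \<Rightarrow> bool" where
  "closed_fin_codim_subspace V L \<longleftrightarrow>
     L \<subseteq> car V \<and> module.subspace (scl V) L \<and>
     (\<forall>x\<in>car V. (\<forall>e>0. \<exists>l\<in>L. nrm V (x - l) < e) \<longrightarrow> x \<in> L) \<and>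
     (\<exists>B. finite B \<and> car V = module.span (scl V) (L \<union> B))"

(* The cosets of L are not elements of the universe. Instead, (W, Q) is a realisation of the
   quotient V/L with its quotient map: it is determined by V and L up to a unique isometric
   isomorphism compatible with the quotient maps. *)
definition quotient_map :: "('k::real_or_complex, 'a::ab_group_add) nspace \<Rightarrow> 'a set \<Rightarrow>
    ('k, 'b::ab_group_add) nspace \<Rightarrow> ('a \<Rightarrow> 'b) \<Rightarrow> bool" where
  "quotient_map V L W Q \<longleftrightarrow> banach_space W \<and> lin V W Q \<and> Q ` car V = car W \<and>
     {x \<in> car V. Q x = 0} = L \<and>
     (\<forall>x\<in>car V. nrm W (Q x) = Inf {nrm V (x + l) | l. l \<in> L})"

definition isometric_iso :: "('k::real_or_complex, 'a::ab_group_add) nspace \<Rightarrow>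
    ('k, 'b::ab_group_add) nspace \<Rightarrow> ('a \<Rightarrow> 'b) \<Rightarrow> bool" where
  "isometric_iso V W J \<longleftrightarrow> lin V W J \<and> bij_betw J (car V) (car W) \<and>
     (\<forall>x\<in>car V. nrm W (J x) = nrm V x)"


section \<open>Algebraic tensor products\<close>

(* For vector spaces over a field, the tensor product is the linear span, inside the algebraic
   dual of the space of multilinear forms, of the evaluations x1 (x) ... (x) xn at the families
   (x1,...,xn). Thus the linearization of a multilinear form \<phi> is u |-> u \<phi>.
   Only the spaces X i with i < n enter. *)
type_synonym ('k, 'a) mform = "(nat \<Rightarrow> 'a) \<Rightarrow> 'k"
type_synonym ('k, 'a) tensor = "('k, 'a) mform \<Rightarrow> 'k"

definition families :: "nat \<Rightarrow> (nat \<Rightarrow> ('k::real_or_complex, 'a::ab_group_add) nspace) \<Rightarrow>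
    (nat \<Rightarrow> 'a) set" where
  "families n X = (\<Pi>\<^sub>E i\<in>{..<n}. car (X i))"

definition mforms :: "nat \<Rightarrow> (nat \<Rightarrow> ('k::real_or_complex, 'a::ab_group_add) nspace) \<Rightarrow>
    ('k, 'a) mform set" where
  "mforms n X = {\<phi>. (\<forall>x. x \<notin> families n X \<longrightarrow> \<phi> x = 0) \<and>
     (\<forall>x\<in>families n X. \<forall>i<n.
        (\<forall>a\<in>car (X i). \<forall>b\<in>car (X i). \<phi> (x(i := a + b)) = \<phi> (x(i := a)) + \<phi> (x(i := b))) \<and>
        (\<forall>c. \<forall>a\<in>car (X i). \<phi> (x(i := scl (X i) c a)) = c * \<phi> (x(i := a))))}"

definition tprod :: "nat \<Rightarrow> (nat \<Rightarrow> ('k::real_or_complex, 'a::ab_group_add) nspace) \<Rightarrow>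
    (nat \<Rightarrow> 'a) \<Rightarrow> ('k, 'a) tensor" where
  "tprod n X x = (\<lambda>\<phi>. if \<phi> \<in> mforms n X then \<phi> x else 0)"

definition Sigma_set :: "nat \<Rightarrow> (nat \<Rightarrow> ('k::real_or_complex, 'a::ab_group_add) nspace) \<Rightarrow>
    ('k, 'a) tensor set" where
  "Sigma_set n X = tprod n X ` families n X"

definition tensors :: "nat \<Rightarrow> (nat \<Rightarrow> ('k::real_or_complex, 'a::ab_group_add) nspace) \<Rightarrow>
    ('k, 'a) tensor set" where
  "tensors n X = module.span pscale (Sigma_set n X)"

definition tensor_space :: "nat \<Rightarrow> (nat \<Rightarrow> ('k::real_or_complex, 'a::ab_group_add) nspace) \<Rightarrow>
    (('k, 'a) tensor \<Rightarrow> real) \<Rightarrow> ('k, ('k, 'a) tensor) nspace" where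
  "tensor_space n X \<beta> = \<lparr>car = tensors n X, scl = pscale, nrm = \<beta>\<rparr>"

type_synonym ('k, 'a, 'b) tensor2 = "('a \<Rightarrow> 'b \<Rightarrow> 'k) \<Rightarrow> 'k"

definition bforms :: "('k::real_or_complex, 'a::ab_group_add) nspace \<Rightarrow>
    ('k, 'b::ab_group_add) nspace \<Rightarrow> ('a \<Rightarrow> 'b \<Rightarrow> 'k) set" where
  "bforms V W = {b. (\<forall>x y. x \<notin> car V \<or> y \<notin> car W \<longrightarrow> b x y = 0) \<and>
     (\<forall>y\<in>car W. lin V scalars (\<lambda>x. b x y)) \<and> (\<forall>x\<in>car V. lin W scalars (b x))}"

definition tprod2 :: "('k::real_or_complex, 'a::ab_group_add) nspace \<Rightarrow>
    ('k, 'b::ab_group_add) nspace \<Rightarrow> 'a \<Rightarrow> 'b \<Rightarrow> ('k, 'a, 'b) tensor2" where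
  "tprod2 V W x y = (\<lambda>b. if b \<in> bforms V W then b x y else 0)"

definition tensors2 :: "('k::real_or_complex, 'a::ab_group_add) nspace \<Rightarrow>
    ('k, 'b::ab_group_add) nspace \<Rightarrow> ('k, 'a, 'b) tensor2 set" where
  "tensors2 V W = module.span pscale {tprod2 V W x y | x y. x \<in> car V \<and> y \<in> car W}"

definition tensor2_space :: "('k::real_or_complex, 'a::ab_group_add) nspace \<Rightarrow>
    ('k, 'b::ab_group_add) nspace \<Rightarrow> (('k, 'a, 'b) tensor2 \<Rightarrow> real) \<Rightarrow>
    ('k, ('k, 'a, 'b) tensor2) nspace" where
  "tensor2_space V W \<gamma> = \<lparr>car = tensors2 V W, scl = pscale, nrm = \<gamma>\<rparr>"

(* The value of a tensor v in V (x) W on a bilinear form that need not be extended by 0. *)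
definition tapply :: "('k::real_or_complex, 'a::ab_group_add) nspace \<Rightarrow>
    ('k, 'b::ab_group_add) nspace \<Rightarrow> ('k, 'a, 'b) tensor2 \<Rightarrow> ('a \<Rightarrow> 'b \<Rightarrow> 'k) \<Rightarrow> 'k" where
  "tapply V W v b = v (\<lambda>x y. if x \<in> car V \<and> y \<in> car W then b x y else 0)"

definition tmap :: "('k::real_or_complex, 'a::ab_group_add) nspace \<Rightarrow>
    ('k, 'b::ab_group_add) nspace \<Rightarrow> ('k, 'c::ab_group_add) nspace \<Rightarrow>
    ('k, 'd::ab_group_add) nspace \<Rightarrow> ('a \<Rightarrow> 'c) \<Rightarrow> ('b \<Rightarrow> 'd) \<Rightarrow>
    ('k, 'a, 'b) tensor2 \<Rightarrow> ('k, 'c, 'd) tensor2" where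
  "tmap V W V' W' B C v =
     (\<lambda>b. if b \<in> bforms V' W' then tapply V W v (\<lambda>x y. b (B x) (C y)) else 0)"

lemma tapply_tprod2:
  assumes "\<And>y. y \<in> car W \<Longrightarrow> lin V scalars (\<lambda>x. b x y)" "\<And>x. x \<in> car V \<Longrightarrow> lin W scalars (b x)"
    and "normed V" "normed W" "x \<in> car V" "y \<in> car W"
  shows "tapply V W (tprod2 V W x y) b = b x y"
proof -
  have V: "vector_space (scl V)" "module.subspace (scl V) (car V)"
    and W: "vector_space (scl W)" "module.subspace (scl W) (car W)"
    using assms(3,4) by (auto simp: normed_def)
  interpret V: vector_space "scl V" by (rule V)
  interpret W: vector_space "scl W" by (rule W)
  have "(\<lambda>x y. if x \<in> car V \<and> y \<in> car W then b x y else 0) \<in> bforms V W"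
    using assms(1,2) V.subspace_add[OF V(2)] V.subspace_scale[OF V(2)]
      W.subspace_add[OF W(2)] W.subspace_scale[OF W(2)]
    by (auto simp: bforms_def lin_def)
  then show ?thesis using assms(5,6) by (simp add: tapply_def tprod2_def)
qed

lemma tmap_tprod2:
  assumes "lin V V' B" "lin W W' C" "normed V" "normed W" "x \<in> car V" "y \<in> car W"
  shows "tmap V W V' W' B C (tprod2 V W x y) = tprod2 V' W' (B x) (C y)"
proof
  fix b
  have "tapply V W (tprod2 V W x y) (\<lambda>x y. b (B x) (C y)) = b (B x) (C y)" if "b \<in> bforms V' W'"
    using assms that by (intro tapply_tprod2) (auto simp: bforms_def lin_def)
  then show "tmap V W V' W' B C (tprod2 V W x y) b = tprod2 V' W' (B x) (C y) b"
    by (simp add: tmap_def tprod2_def)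
qed


section \<open>Elections\<close>

definition injective_norm :: "nat \<Rightarrow> (nat \<Rightarrow> ('k::real_or_complex, 'a::ab_group_add) nspace) \<Rightarrow>
    ('k, 'a) tensor \<Rightarrow> real" where
  "injective_norm n X u =
     Sup {norm (u (\<lambda>x. if x \<in> families n X then \<Prod>i<n. f i (x i) else 0)) | f.
            \<forall>i<n. f i \<in> car (dual (X i)) \<and> nrm (dual (X i)) (f i) \<le> 1}"

definition projective_norm :: "nat \<Rightarrow> (nat \<Rightarrow> ('k::real_or_complex, 'a::ab_group_add) nspace) \<Rightarrow>
    ('k, 'a) tensor \<Rightarrow> real" where
  "projective_norm n X u =
     Inf {(\<Sum>j<m. \<Prod>i<n. nrm (X i) (x j i)) | (m::nat) x.
            (\<forall>j<m. x j \<in> families n X) \<and> u = (\<Sum>j<m. tprod n X (x j))}"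

definition reasonable_crossnorm :: "nat \<Rightarrow>
    (nat \<Rightarrow> ('k::real_or_complex, 'a::ab_group_add) nspace) \<Rightarrow> (('k, 'a) tensor \<Rightarrow> real) \<Rightarrow> bool" where
  "reasonable_crossnorm n X \<beta> \<longleftrightarrow> normed (tensor_space n X \<beta>) \<and>
     (\<forall>u\<in>tensors n X. injective_norm n X u \<le> \<beta> u \<and> \<beta> u \<le> projective_norm n X u)"

definition election :: "nat \<Rightarrow> (nat \<Rightarrow> ('k::real_or_complex, 'a::ab_group_add) nspace) \<Rightarrow>
    ('k, 'b::ab_group_add) nspace \<Rightarrow> (('k, 'a) tensor \<Rightarrow> real) \<Rightarrow> bool" where
  "election n X Y \<beta> \<longleftrightarrow> n \<ge> 1 \<and> (\<forall>i<n. banach_space (X i)) \<and> banach_space Y \<and>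
     reasonable_crossnorm n X \<beta>"

definition linearization :: "nat \<Rightarrow> (nat \<Rightarrow> ('k::real_or_complex, 'a::ab_group_add) nspace) \<Rightarrow>
    ('k, 'a) mform \<Rightarrow> ('k, 'a) tensor \<Rightarrow> 'k" where
  "linearization n X \<phi> = (\<lambda>u. if u \<in> tensors n X then u \<phi> else 0)"

definition Lspace :: "nat \<Rightarrow> (nat \<Rightarrow> ('k::real_or_complex, 'a::ab_group_add) nspace) \<Rightarrow>
    (('k, 'a) tensor \<Rightarrow> real) \<Rightarrow> ('k, ('k, 'a) mform) nspace" where
  "Lspace n X \<beta> =
     \<lparr>car = {\<phi> \<in> mforms n X. linearization n X \<phi> \<in> car (dual (tensor_space n X \<beta>))},
      scl = pscale,
      nrm = (\<lambda>\<phi>. nrm (dual (tensor_space n X \<beta>)) (linearization n X \<phi>))\<rparr>"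

definition subs :: "(nat \<Rightarrow> ('k, 'a) nspace) \<Rightarrow> (nat \<Rightarrow> 'a set) \<Rightarrow> nat \<Rightarrow> ('k, 'a) nspace" where
  "subs X E = (\<lambda>i. (X i)\<lparr>car := E i\<rparr>)"

definition restr :: "nat \<Rightarrow> (nat \<Rightarrow> ('k::real_or_complex, 'a::ab_group_add) nspace) \<Rightarrow>
    (nat \<Rightarrow> 'a set) \<Rightarrow> ('k, 'a) mform \<Rightarrow> ('k, 'a) mform" where
  "restr n X E \<phi> = (\<lambda>x. if x \<in> families n (subs X E) then \<phi> x else 0)"

(* The canonical embedding of the tensor product of the subspaces E i into that of the X i. *)
definition incl :: "nat \<Rightarrow> (nat \<Rightarrow> ('k::real_or_complex, 'a::ab_group_add) nspace) \<Rightarrow>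
    (nat \<Rightarrow> 'a set) \<Rightarrow> ('k, 'a) tensor \<Rightarrow> ('k, 'a) tensor" where
  "incl n X E u = (\<lambda>\<phi>. if \<phi> \<in> mforms n X then u (restr n X E \<phi>) else 0)"

lemma incl_tprod:
  assumes "\<And>i. i < n \<Longrightarrow> E i \<subseteq> car (X i) \<and> module.subspace (scl (X i)) (E i) \<and> vector_space (scl (X i))"
    and "x \<in> families n (subs X E)"
  shows "incl n X E (tprod n (subs X E) x) = tprod n X x"
proof
  fix \<phi>
  have sub: "y \<in> families n X" if "y \<in> families n (subs X E)" for y
    using that assms(1) by (auto simp: families_def subs_def PiE_iff subset_eq)
  have upd: "y(i := a) \<in> families n (subs X E)"
    if "y \<in> families n (subs X E)" "i < n" "a \<in> E i" for y i a
    using that by (auto simp: families_def subs_def PiE_iff extensional_def)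
  have "restr n X E \<phi> \<in> mforms n (subs X E)" if "\<phi> \<in> mforms n X"
  proof -
    have add: "a + b \<in> E i" and scale: "scl (X i) c a \<in> E i"
      if "i < n" "a \<in> E i" "b \<in> E i" for i a b c
    proof -
      interpret vector_space "scl (X i)" using assms(1) that by blast
      show "a + b \<in> E i" "scl (X i) c a \<in> E i"
        using assms(1) that subspace_add subspace_scale by auto
    qed
    have "\<phi> (y(i := a + b)) = \<phi> (y(i := a)) + \<phi> (y(i := b))"
      "\<phi> (y(i := scl (X i) c a)) = c * \<phi> (y(i := a))"
      if "y \<in> families n (subs X E)" "i < n" "a \<in> E i" "b \<in> E i" for y i a b c
      using that assms(1) sub \<open>\<phi> \<in> mforms n X\<close> by (auto simp: mforms_def subset_eq)
    then show ?thesis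
      using add scale upd unfolding mforms_def restr_def
      by (auto simp: subs_def[of X E])
  qed
  then show "incl n X E (tprod n (subs X E) x) \<phi> = tprod n X x \<phi>"
    using assms(2) by (auto simp: incl_def tprod_def restr_def)
qed

definition norm_restr :: "nat \<Rightarrow> (nat \<Rightarrow> ('k::real_or_complex, 'a::ab_group_add) nspace) \<Rightarrow>
    (nat \<Rightarrow> 'a set) \<Rightarrow> (('k, 'a) tensor \<Rightarrow> real) \<Rightarrow> ('k, 'a) tensor \<Rightarrow> real" where
  "norm_restr n X E \<beta> = (\<lambda>u. \<beta> (incl n X E u))"


section \<open>Sigma-tensor norms on duals\<close>

definition canon :: "nat \<Rightarrow> (nat \<Rightarrow> ('k::real_or_complex, 'a::ab_group_add) nspace) \<Rightarrow>
    (('k, 'a) tensor \<Rightarrow> real) \<Rightarrow> ('k, 'a) tensor \<Rightarrow> ('k, 'a) mform \<Rightarrow> 'k" where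
  "canon n X \<beta> u = (\<lambda>\<phi>. if \<phi> \<in> car (Lspace n X \<beta>) then linearization n X \<phi> u else 0)"

definition adjoint :: "('k::real_or_complex, 'a::ab_group_add) nspace \<Rightarrow> ('a \<Rightarrow> 'b) \<Rightarrow>
    ('b \<Rightarrow> 'k) \<Rightarrow> 'a \<Rightarrow> 'k" where
  "adjoint V B \<eta> = (\<lambda>x. if x \<in> car V then \<eta> (B x) else 0)"

definition preserves_Sigma :: "nat \<Rightarrow> (nat \<Rightarrow> ('k::real_or_complex, 'a::ab_group_add) nspace) \<Rightarrow>
    (('k, 'a) tensor \<Rightarrow> real) \<Rightarrow> nat \<Rightarrow> (nat \<Rightarrow> ('k, 'a) nspace) \<Rightarrow> (('k, 'a) tensor \<Rightarrow> real) \<Rightarrow>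
    (('k, 'a) mform \<Rightarrow> ('k, 'a) mform) \<Rightarrow> bool" where
  "preserves_Sigma n X \<beta> m Z \<theta> B \<longleftrightarrow>
     adjoint (Lspace n X \<beta>) B ` (canon m Z \<theta> ` Sigma_set m Z) \<subseteq> canon n X \<beta> ` Sigma_set n X"

(* An assignment of a function on L^\<beta>(X 0,...,X (n-1)) (x) Y to each election (n, X, Y, \<beta>) in
   the universe 'a; its values elsewhere are irrelevant. *)
type_synonym ('k, 'a) assignment =
  "nat \<Rightarrow> (nat \<Rightarrow> ('k, 'a) nspace) \<Rightarrow> ('k, 'a) nspace \<Rightarrow> (('k, 'a) tensor \<Rightarrow> real) \<Rightarrow>
   ('k, ('k, 'a) mform, 'a) tensor2 \<Rightarrow> real"

definition nu_space :: "('k::real_or_complex, 'a::ab_group_add) assignment \<Rightarrow> nat \<Rightarrow>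
    (nat \<Rightarrow> ('k, 'a) nspace) \<Rightarrow> ('k, 'a) nspace \<Rightarrow> (('k, 'a) tensor \<Rightarrow> real) \<Rightarrow>
    ('k, ('k, ('k, 'a) mform, 'a) tensor2) nspace" where
  "nu_space \<nu> n X Y \<beta> = tensor2_space (Lspace n X \<beta>) Y (\<nu> n X Y \<beta>)"

definition sigma_tensor_norm_on_duals ::
    "('k::real_or_complex, 'a::ab_group_add) assignment \<Rightarrow> bool" where
  "sigma_tensor_norm_on_duals \<nu> \<longleftrightarrow>
     (\<forall>n X Y \<beta>. election n X Y \<beta> \<longrightarrow>
        normed (nu_space \<nu> n X Y \<beta>) \<and>
        (\<forall>\<phi>\<in>car (Lspace n X \<beta>). \<forall>y\<in>car Y.
           \<nu> n X Y \<beta> (tprod2 (Lspace n X \<beta>) Y \<phi> y) \<le> nrm (Lspace n X \<beta>) \<phi> * nrm Y y) \<and>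
        (\<forall>p\<in>Sigma_set n X. \<forall>q\<in>Sigma_set n X. \<forall>f\<in>car (dual Y).
           bounded_by (nu_space \<nu> n X Y \<beta>) scalars
             (\<lambda>v. tapply (Lspace n X \<beta>) Y v
                (\<lambda>\<phi> y. (linearization n X \<phi> p - linearization n X \<phi> q) * f y))
             (\<beta> (p - q) * nrm (dual Y) f))) \<and>
     (\<forall>n X Y \<beta> m Z W \<theta> B C.
        election n X Y \<beta> \<and> election m Z W \<theta> \<and>
        bounded_op (Lspace n X \<beta>) (Lspace m Z \<theta>) B \<and> preserves_Sigma n X \<beta> m Z \<theta> B \<and>
        bounded_op Y W C \<longrightarrow>
        bounded_by (nu_space \<nu> n X Y \<beta>) (nu_space \<nu> m Z W \<theta>)
          (tmap (Lspace n X \<beta>) Y (Lspace m Z \<theta>) W B C)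
          (opnorm (Lspace n X \<beta>) (Lspace m Z \<theta>) B * opnorm Y W C))"

(* Ranging over all realisations (W, Q) of Y/L adds nothing: for a Sigma-tensor norm on duals
   they all give the same value. *)
definition cofinitely_generated :: "('k::real_or_complex, 'a::ab_group_add) assignment \<Rightarrow> bool" where
  "cofinitely_generated \<nu> \<longleftrightarrow>
     (\<forall>n X Y \<beta>. election n X Y \<beta> \<longrightarrow> (\<forall>v\<in>car (nu_space \<nu> n X Y \<beta>).
        \<nu> n X Y \<beta> v =
        Sup {\<nu> n (subs X E) W (norm_restr n X E \<beta>)
               (tmap (Lspace n X \<beta>) Y (Lspace n (subs X E) (norm_restr n X E \<beta>)) W
                  (restr n X E) Q v) | E L W Q.
             (\<forall>i<n. fin_dim_subspace (X i) (E i)) \<and> closed_fin_codim_subspace Y L \<and>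
             quotient_map Y L W Q}))"


section \<open>The tensor norm on spaces defined by a tensor norm on duals\<close>

(* Here X1 (x) ... (x) Xn (x) G is (X1 (x) ... (x) Xn) (x) G. For a linear J : W -> G* this is the
   linear functional on L^\<beta>(X1,...,Xn) (x) W induced by a tensor u in X1 (x) ... (x) Xn (x) G
   through the pairing of \<phi> (x) w and x1 (x) ... (x) xn (x) g, which is \<phi>(x1,...,xn) (J w)(g). *)
definition pairing :: "nat \<Rightarrow> (nat \<Rightarrow> ('k::real_or_complex, 'a::ab_group_add) nspace) \<Rightarrow>
    (('k, 'a) tensor \<Rightarrow> real) \<Rightarrow> ('k, 'g::ab_group_add) nspace \<Rightarrow> ('k, 'a) nspace \<Rightarrow>
    ('a \<Rightarrow> 'g \<Rightarrow> 'k) \<Rightarrow> ('k, ('k, 'a) tensor, 'g) tensor2 \<Rightarrow>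
    ('k, ('k, 'a) mform, 'a) tensor2 \<Rightarrow> 'k" where
  "pairing n X \<beta> G W J u v =
     tapply (Lspace n X \<beta>) W v
       (\<lambda>\<phi> w. tapply (tensor_space n X \<beta>) G u (\<lambda>z g. linearization n X \<phi> z * J w g))"

lemma pairing_tprod2:
  fixes X :: "nat \<Rightarrow> ('k::real_or_complex, 'a::ab_group_add) nspace"
    and G :: "('k, 'g::ab_group_add) nspace" and W :: "('k, 'a) nspace"
  assumes "normed (tensor_space n X \<beta>)" "normed (Lspace n X \<beta>)" "normed G" "normed W"
    and "lin W (dual G) J" "x \<in> families n X" "g \<in> car G" "\<phi> \<in> car (Lspace n X \<beta>)" "w \<in> car W"
  shows "pairing n X \<beta> G W J (tprod2 (tensor_space n X \<beta>) G (tprod n X x) g)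
           (tprod2 (Lspace n X \<beta>) W \<phi> w) = \<phi> x * J w g"
proof -
  interpret P: vector_space "pscale :: 'k \<Rightarrow> ('k, 'a) tensor \<Rightarrow> _" by (rule vector_space_pscale)
  interpret P': vector_space "pscale :: 'k \<Rightarrow> ('k, 'a) mform \<Rightarrow> _" by (rule vector_space_pscale)
  have T: "P.subspace (tensors n X)" and t: "tprod n X x \<in> tensors n X"
    using assms(6) by (auto simp: tensors_def Sigma_set_def intro: P.subspace_span P.span_base)
  have L: "P'.subspace (car (Lspace n X \<beta>))"
    using assms(2) by (simp add: normed_def Lspace_def)
  have val: "tapply (tensor_space n X \<beta>) G (tprod2 (tensor_space n X \<beta>) G (tprod n X x) g)
      (\<lambda>z g. linearization n X \<psi> z * J w' g) = \<psi> x * J w' g"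
    if "\<psi> \<in> car (Lspace n X \<beta>)" "w' \<in> car W" for \<psi> w'
  proof -
    have "J w' \<in> car (dual G)" using assms(5) that(2) by (simp add: lin_def)
    then have "lin G scalars (J w')" by (auto simp: dual_def bounded_op_def bounded_by_def)
    then have "tapply (tensor_space n X \<beta>) G (tprod2 (tensor_space n X \<beta>) G (tprod n X x) g)
      (\<lambda>z g. linearization n X \<psi> z * J w' g) = linearization n X \<psi> (tprod n X x) * J w' g"
      using P.subspace_add[OF T] P.subspace_scale[OF T] assms(1,3,7) t
      by (intro tapply_tprod2)
         (auto simp: lin_def scalars_def tensor_space_def linearization_def pscale_def algebra_simps)
    moreover have "\<psi> \<in> mforms n X" using that(1) by (simp add: Lspace_def)
    ultimately show ?thesis using t by (simp add: linearization_def tprod_def)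
  qed
  have "pairing n X \<beta> G W J (tprod2 (tensor_space n X \<beta>) G (tprod n X x) g)
           (tprod2 (Lspace n X \<beta>) W \<phi> w) =
        tapply (Lspace n X \<beta>) W (tprod2 (Lspace n X \<beta>) W \<phi> w) (\<lambda>\<psi> w'. \<psi> x * J w' g)"
    using val unfolding pairing_def tapply_def
    by (intro arg_cong[where f = "tprod2 (Lspace n X \<beta>) W \<phi> w"]) (auto simp: fun_eq_iff)
  also have "\<dots> = \<phi> x * J w g"
    using assms P'.subspace_add[OF L] P'.subspace_scale[OF L]
    by (intro tapply_tprod2)
       (auto simp: lin_def scalars_def pscale_def algebra_simps Lspace_def dual_def)
  finally show ?thesis .
qed

(* A space W in the universe 'a together with an isometric isomorphism J from W onto G*. The
   choice does not affect alpha_fin, since a Sigma-tensor norm on duals is invariant under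
   isometric isomorphisms of the space Y. If G is a finite dimensional subspace of Y* with Y in
   the universe then such a W exists, since G* is isometric to the quotient of Y by the
   annihilator of G in Y. *)
definition dual_copy :: "('k::real_or_complex, 'g::ab_group_add) nspace \<Rightarrow>
    ('k, 'a::ab_group_add) nspace \<times> ('a \<Rightarrow> 'g \<Rightarrow> 'k)" where
  "dual_copy G = (SOME (W, J). banach_space W \<and> isometric_iso W (dual G) J)"

definition alpha_fin :: "('k::real_or_complex, 'a::ab_group_add) assignment \<Rightarrow> nat \<Rightarrow>
    (nat \<Rightarrow> ('k, 'a) nspace) \<Rightarrow> (('k, 'a) tensor \<Rightarrow> real) \<Rightarrow> ('k, 'g::ab_group_add) nspace \<Rightarrow>
    ('k, ('k, 'a) tensor, 'g) tensor2 \<Rightarrow> real" where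
  "alpha_fin \<nu> n X \<beta> G u =
     (case dual_copy G of (W, J) \<Rightarrow>
        nrm (dual (nu_space \<nu> n X W \<beta>)) (pairing n X \<beta> G W J u))"

definition alpha :: "('k::real_or_complex, 'a::ab_group_add) assignment \<Rightarrow> nat \<Rightarrow>
    (nat \<Rightarrow> ('k, 'a) nspace) \<Rightarrow> (('k, 'a) tensor \<Rightarrow> real) \<Rightarrow> ('k, 'g::ab_group_add) nspace \<Rightarrow>
    ('k, ('k, 'a) tensor, 'g) tensor2 \<Rightarrow> real" where
  "alpha \<nu> n X \<beta> G u =
     Inf {alpha_fin \<nu> n (subs X E) (norm_restr n X E \<beta>) (G\<lparr>car := F\<rparr>) u' | E F u'.
          (\<forall>i<n. fin_dim_subspace (X i) (E i)) \<and> fin_dim_subspace G F \<and>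
          u' \<in> tensors2 (tensor_space n (subs X E) (norm_restr n X E \<beta>)) (G\<lparr>car := F\<rparr>) \<and>
          tmap (tensor_space n (subs X E) (norm_restr n X E \<beta>)) (G\<lparr>car := F\<rparr>)
            (tensor_space n X \<beta>) G (incl n X E) id u' = u}"

definition alpha_space :: "('k::real_or_complex, 'a::ab_group_add) assignment \<Rightarrow> nat \<Rightarrow>
    (nat \<Rightarrow> ('k, 'a) nspace) \<Rightarrow> (('k, 'a) tensor \<Rightarrow> real) \<Rightarrow> ('k, 'g::ab_group_add) nspace \<Rightarrow>
    ('k, ('k, ('k, 'a) tensor, 'g) tensor2) nspace" where
  "alpha_space \<nu> n X \<beta> G = tensor2_space (tensor_space n X \<beta>) G (alpha \<nu> n X \<beta> G)"

end

theory Submission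
  imports Defs
begin

text \<open>
  Let \<open>v \<in> L\<^sup>\<beta>(X\<^sub>1,\<dots>,X\<^sub>n) \<otimes> Y\<close> and \<open>u \<in> X\<^sub>1 \<otimes> \<dots> \<otimes> X\<^sub>n \<otimes> Y\<^sup>*\<close>. If \<open>u\<close> comes from
  \<open>E\<^sub>1 \<otimes> \<dots> \<otimes> E\<^sub>n \<otimes> F\<close> with \<open>F \<subseteq> Y\<^sup>*\<close> finite dimensional, then \<open>\<langle>v, u\<rangle> = \<langle>(R \<otimes> C) v, u\<rangle>\<close> where \<open>R\<close> is the
  restriction to the \<open>E\<^sub>i\<close> and \<open>C : Y \<rightarrow> F\<^sup>*\<close> is evaluation. Both are contractions and \<open>R\<close> preserves
  \<open>\<Sigma>\<close>, so (D3) gives \<open>\<bar>\<langle>v, u\<rangle>\<bar> \<le> \<nu>(v) \<alpha>(u)\<close>. Conversely, for closed \<open>L\<close> of finite codimension let \<open>F\<close>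
  be the annihilator of \<open>L\<close>. By the Hahn--Banach theorem \<open>Q\<^sub>L = D \<circ> C\<close> with a contraction \<open>D\<close>, so
  \<open>\<nu>((R \<otimes> Q\<^sub>L) v) \<le> \<nu>((R \<otimes> C) v)\<close>, and a norming functional of \<open>(R \<otimes> C) v\<close> on the finite dimensional
  space \<open>L\<^sup>\<beta>(E\<^sub>1,\<dots>,E\<^sub>n) \<otimes> F\<^sup>*\<close> is the pairing with a tensor \<open>u\<close> such that \<open>\<alpha>(u) \<le> 1\<close>. Cofinite
  generation lets these lower bounds exhaust \<open>\<nu>(v)\<close>.
\<close>

section \<open>The scalar field\<close>

text \<open>\<nu> accepts only spaces of the universe \<open>'a\<close>, whereas the dual of a
  subspace \<open>F\<close> of the dual of \<open>Y\<close> consists of functionals on functionals.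
  It has to be copied into \<open>'a\<close> first (\<open>dual_copy\<close>); the copy is found on
  a complement of the annihilator of \<open>F\<close> in \<open>Y\<close>. To apply (D3) to
  subspaces at all, the restricted norm must be shown to be a reasonable crossnorm, and its lower
  estimate by the injective norm needs Hahn-Banach. Dual norms, \<open>alpha\<close> and cofinite
  generation are \<open>Sup\<close> or \<open>Inf\<close> of sets of reals, so comparing them also
  requires nonempty sets and bounds. For \<open>alpha_fin\<close> this is where (D2) enters: with q
  = 0 it makes the pairing with an elementary tensor \<nu>-continuous. The contraction D exists
  because a norming functional of Q y, pulled back to \<open>Y\<close>, vanishes on L and has norm
  at most 1. It lies in the unit ball of \<open>F\<close>, so evaluation at y on \<open>F\<close>
  has at least the norm of Q y. The finite dimensional arguments rest on
  \<open>finite_functionals_reproduce\<close>, which works with spanning families in place of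
  bases.\<close>

lemma real_or_complex_parts:
  obtains i :: "'k::real_or_complex" and re im :: "'k \<Rightarrow> real"
  where "i = 0 \<or> i * i = - 1"
    and "\<And>z. z = of_real (re z) + of_real (im z) * i"
    and "\<And>z. (norm z)\<^sup>2 = (re z)\<^sup>2 + (im z)\<^sup>2"
    and "\<And>z w. re (z + w) = re z + re w"
    and "\<And>r z. re (of_real r * z) = r * re z"
    and "\<And>z. re (i * z) = - im z"
    and "\<And>a b. i \<noteq> 0 \<or> b = 0 \<Longrightarrow> (norm (of_real a + of_real b * i))\<^sup>2 = a\<^sup>2 + b\<^sup>2"
proof -
  obtain i :: 'k where i: "i = 0 \<or> i * i = - 1"
    and rep: "\<And>z. \<exists>a b. z = a *\<^sub>R 1 + b *\<^sub>R i \<and> (norm z)\<^sup>2 = a\<^sup>2 + b\<^sup>2"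
    using real_or_complex by blast
  show ?thesis
  proof (cases "i = 0")
    \<comment> \<open>The real case: \<open>im\<close> is chosen as 0, so that
      \<open>re (i * z) = - im z\<close> reads 0 = 0. The guard
      \<open>i \<noteq> 0 \<or> b = 0\<close> of the last fact is due to this case, where
      \<open>b\<close> does not show in \<open>of_real a + of_real b * i\<close>.\<close>
    case True
    have "\<forall>z::'k. \<exists>a. z = of_real a" using rep True by (simp add: of_real_def) metis
    then obtain re where re: "\<And>z::'k. z = of_real (re z)" by metis
    have re': "re (of_real a) = a" for a by (metis of_real_eq_iff re)
    have nr: "(norm z)\<^sup>2 = (re z)\<^sup>2" for z by (metis re norm_of_real power2_abs)
    have add: "re (z + w) = re z + re w" for z w by (metis re re' of_real_add)
    have mul: "re (of_real r * z) = r * re z" for z r by (metis re re' of_real_mult)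
    show ?thesis
      by (rule that[of 0 re "\<lambda>_. 0"]) (use re nr add mul re'[of 0] in auto)
  next
    case False
    then have ii: "i * i = - 1" using i by simp
    \<comment> \<open>Squaring (a - c) = (d - b) i gives two real squares with sum 0. Uniqueness
      makes the parts \<open>re\<close> and \<open>im\<close>, chosen separately for each scalar,
      additive and real homogeneous.\<close>
    have uniq: "a = c \<and> b = d" if "of_real a + of_real b * i = of_real c + of_real d * i" for a b c d
    proof -
      have e: "(of_real (a - c) :: 'k) = of_real (d - b) * i" using that by (simp add: algebra_simps)
      have "of_real ((a - c)\<^sup>2) = of_real (d - b) * i * (of_real (d - b) * i)"
        by (simp only: power2_eq_square of_real_mult e)
      also have "\<dots> = of_real ((d - b)\<^sup>2) * (i * i)" by (simp add: power2_eq_square algebra_simps)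
      also have "\<dots> = of_real (- ((d - b)\<^sup>2))" by (simp add: ii)
      finally have "(a - c)\<^sup>2 = - ((d - b)\<^sup>2)" by (simp only: of_real_eq_iff)
      then have "(a - c)\<^sup>2 + (d - b)\<^sup>2 = 0" by simp
      then show ?thesis by (simp add: sum_power2_eq_zero_iff)
    qed
    have rep': "\<forall>z. \<exists>a b. z = of_real a + of_real b * i \<and> (norm z)\<^sup>2 = a\<^sup>2 + b\<^sup>2"
      using rep by (simp add: of_real_def)
    then obtain re im where ri: "\<And>z. z = of_real (re z) + of_real (im z) * i"
      "\<And>z. (norm z)\<^sup>2 = (re z)\<^sup>2 + (im z)\<^sup>2" by metis
    have u: "re z = a \<and> im z = b" if "z = of_real a + of_real b * i" for z a b
      using uniq ri(1)[of z] that by metis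
    have add: "re (z + w) = re z + re w" for z w
    proof -
      have "z + w = of_real (re z + re w) + of_real (im z + im w) * i"
        by (subst ri(1)[of z], subst ri(1)[of w]) (simp add: algebra_simps)
      then show ?thesis using u by blast
    qed
    have mul: "re (of_real r * z) = r * re z" for r z
    proof -
      have "of_real r * z = of_real (r * re z) + of_real (r * im z) * i"
        by (subst ri(1)[of z]) (simp add: algebra_simps)
      then show ?thesis using u by blast
    qed
    have muli: "re (i * z) = - im z" for z
    proof -
      have "i * z = of_real (re z) * i + of_real (im z) * (i * i)"
        by (subst ri(1)[of z]) (simp add: algebra_simps)
      then have "i * z = of_real (- im z) + of_real (re z) * i" by (simp add: ii)
      then show ?thesis using u by blast
    qed
    have nrm: "(norm (of_real a + of_real b * i))\<^sup>2 = a\<^sup>2 + b\<^sup>2" for a b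
      using ri(2) u by metis
    show ?thesis
      by (rule that[of i re im]) (use ii ri add mul muli nrm in auto)
  qed
qed

lemma Cauchy_real_or_complex_convergent:
  fixes s :: "nat \<Rightarrow> 'k::real_or_complex"
  assumes "\<And>e. e > 0 \<Longrightarrow> \<exists>N. \<forall>j\<ge>N. \<forall>k\<ge>N. norm (s j - s k) < e"
  shows "\<exists>l. s \<longlonglongrightarrow> l"
proof -
  obtain i :: 'k and re im where z: "\<And>z. z = of_real (re z) + of_real (im z) * i"
    and nz: "\<And>z. (norm z)\<^sup>2 = (re z)\<^sup>2 + (im z)\<^sup>2"
    and add: "\<And>z w. re (z + w) = re z + re w"
    and mul: "\<And>r z. re (of_real r * z) = r * re z"
    and muli: "\<And>z. re (i * z) = - im z"
    by (rule real_or_complex_parts) (rule that, assumption+)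
  have le: "\<bar>re z\<bar> \<le> norm z" "\<bar>im z\<bar> \<le> norm z" for z
    using nz[of z] by (auto intro!: abs_le_square_iff[THEN iffD2, of _ "norm z", simplified])
  have rm: "re (- z) = - re z" for z using mul[of "-1" z] by simp
  have rd: "re (z - w) = re z - re w" for z w using add[of z "-w"] rm by simp
  \<comment> \<open>Additivity is known for \<open>re\<close> only; it passes to \<open>im\<close>
    through \<open>re (i * z) = - im z\<close>.\<close>
  have id: "im (z - w) = im z - im w" for z w
    using muli[of "z - w"] muli[of z] muli[of w] rd[of "i * z" "i * w"] by (simp add: algebra_simps)
  have "Cauchy (\<lambda>k. re (s k))"
    unfolding Cauchy_def dist_real_def rd[symmetric] using assms le(1) by (meson order_le_less_trans)
  moreover have "Cauchy (\<lambda>k. im (s k))"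
    unfolding Cauchy_def dist_real_def id[symmetric] using assms le(2) by (meson order_le_less_trans)
  ultimately obtain a b where "(\<lambda>k. re (s k)) \<longlonglongrightarrow> a" "(\<lambda>k. im (s k)) \<longlonglongrightarrow> b"
    by (meson Cauchy_convergent_iff convergent_def)
  then have "(\<lambda>k. of_real (re (s k)) + of_real (im (s k)) * i) \<longlonglongrightarrow> of_real a + of_real b * i"
    by (intro tendsto_intros)
  then show ?thesis using z by (metis (no_types, lifting) ext)
qed

section \<open>The Hahn--Banach theorem\<close>

text \<open>The scalars are real even over the complex field, since the extension theorem is first
  proved for the real part of a functional.\<close>

definition sublinear_on :: "(real \<Rightarrow> 'a::ab_group_add \<Rightarrow> 'a) \<Rightarrow> 'a set \<Rightarrow> ('a \<Rightarrow> real) \<Rightarrow> bool" where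
  "sublinear_on rs S p \<longleftrightarrow> (\<forall>x\<in>S. \<forall>y\<in>S. p (x + y) \<le> p x + p y) \<and>
     (\<forall>r\<ge>0. \<forall>x\<in>S. p (rs r x) = r * p x)"

lemma sublinear_on_add: "sublinear_on rs S p \<Longrightarrow> x \<in> S \<Longrightarrow> y \<in> S \<Longrightarrow> p (x + y) \<le> p x + p y"
  by (simp add: sublinear_on_def)

lemma sublinear_on_scale: "sublinear_on rs S p \<Longrightarrow> r \<ge> 0 \<Longrightarrow> x \<in> S \<Longrightarrow> p (rs r x) = r * p x"
  by (simp add: sublinear_on_def)

lemma sublinear_on_cong:
  assumes "sublinear_on rs S p" "vector_space rs" "module.subspace rs S" "\<And>x. x \<in> S \<Longrightarrow> p x = q x"
  shows "sublinear_on rs S q"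
proof -
  interpret vector_space rs by fact
  have "x + y \<in> S" "rs r x \<in> S" if "x \<in> S" "y \<in> S" for x y r
    using that assms(3) subspace_add subspace_scale by auto
  then show ?thesis using assms(1,4) by (auto simp: sublinear_on_def)
qed

text \<open>
  A pair \<open>(m, c)\<close> of the cone \<open>K\<close> is the demand \<open>q m \<le> c\<close>. The graph of a functional dominated by
  \<open>p\<close> gives an extension step; the ray through \<open>(-x, -p x)\<close> makes \<open>q\<close> linear along \<open>x\<close>, so that a
  minimal sublinear function is linear.
\<close>

lemma sublinear_on_cone_inf:
  fixes rs :: "real \<Rightarrow> 'a::ab_group_add \<Rightarrow> 'a" and K :: "('a \<times> real) set"
  assumes "vector_space rs" "module.subspace rs S" and p: "sublinear_on rs S p"
    and KS: "\<And>m c. (m, c) \<in> K \<Longrightarrow> m \<in> S" and K0: "(0, 0) \<in> K"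
    and Kadd: "\<And>m c m' c'. (m, c) \<in> K \<Longrightarrow> (m', c') \<in> K \<Longrightarrow> (m + m', c + c') \<in> K"
    and Kscale: "\<And>r m c. r \<ge> 0 \<Longrightarrow> (m, c) \<in> K \<Longrightarrow> (rs r m, r * c) \<in> K"
    and Kp: "\<And>m c. (m, c) \<in> K \<Longrightarrow> - p (- m) \<le> c"
  obtains q where "sublinear_on rs S q" "\<And>x. x \<in> S \<Longrightarrow> q x \<le> p x" "\<And>m c. (m, c) \<in> K \<Longrightarrow> q m \<le> c"
proof -
  interpret vector_space rs by fact
  note S = subspace_add[OF assms(2)] subspace_diff[OF assms(2)] subspace_scale[OF assms(2)]
    subspace_neg[OF assms(2)] subspace_0[OF assms(2)]
  \<comment> \<open>The infimal convolution of \<open>p\<close> with the demands: any sublinear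
    function below \<open>p\<close> that meets them lies below this one. The hypothesis that - p (-
    m) \<le> c for all (m, c) in \<open>K\<close> is what keeps the infimum finite
    (\<open>low\<close>).\<close>
  define q where "q y = Inf {c + p (y - m) | m c. (m, c) \<in> K}" for y
  have low: "- p (- y) \<le> c + p (y - m)" if "y \<in> S" "(m, c) \<in> K" for y m c
    using sublinear_on_add[OF p, of "- y" "y - m"] Kp[OF that(2)] S KS[OF that(2)] that(1) by simp
  have bdd: "bdd_below {c + p (y - m) | m c. (m, c) \<in> K}" if "y \<in> S" for y
    using low[OF that] by (intro bdd_belowI[of _ "- p (- y)"]) auto
  have q_le: "q y \<le> c + p (y - m)" if "y \<in> S" "(m, c) \<in> K" for y m c
    unfolding q_def using that by (intro cInf_lower bdd) auto
  have le_q: "a \<le> q y" if "\<And>m c. (m, c) \<in> K \<Longrightarrow> a \<le> c + p (y - m)" for a y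
    unfolding q_def using that K0 by (intro cInf_greatest) auto
  have p0: "p 0 = 0" using sublinear_on_scale[OF p, of 0 0] S by simp
  have add: "q (x + y) \<le> q x + q y" if "x \<in> S" "y \<in> S" for x y
  proof -
    have "q (x + y) - (c + p (x - m)) \<le> c' + p (y - m')" if "(m, c) \<in> K" "(m', c') \<in> K" for m c m' c'
    proof -
      have "q (x + y) \<le> c + c' + p (x + y - (m + m'))"
        by (rule q_le[OF S(1)[OF \<open>x \<in> S\<close> \<open>y \<in> S\<close>] Kadd[OF that]])
      also have "x + y - (m + m') = (x - m) + (y - m')" by simp
      also have "p \<dots> \<le> p (x - m) + p (y - m')"
        by (rule sublinear_on_add[OF p S(2)[OF \<open>x \<in> S\<close> KS[OF that(1)]] S(2)[OF \<open>y \<in> S\<close> KS[OF that(2)]]])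
      finally show ?thesis by simp
    qed
    then have "q (x + y) - (c + p (x - m)) \<le> q y" if "(m, c) \<in> K" for m c
      using that by (intro le_q) blast
    then have "q (x + y) - q y \<le> c + p (x - m)" if "(m, c) \<in> K" for m c
      using that by (smt (verit))
    then have "q (x + y) - q y \<le> q x" by (intro le_q) blast
    then show ?thesis by simp
  qed
  \<comment> \<open>One inequality suffices: applied to \<open>1 / r\<close> and
    \<open>rs r x\<close>, it gives the reverse one.\<close>
  have scale1: "q (rs r x) \<le> r * q x" if "r > 0" "x \<in> S" for r x
  proof -
    have "q (rs r x) / r \<le> c + p (x - m)" if "(m, c) \<in> K" for m c
    proof -
      have "q (rs r x) \<le> r * c + p (rs r x - rs r m)"
        by (rule q_le[OF S(3)[OF \<open>x \<in> S\<close>] Kscale[OF less_imp_le[OF \<open>r > 0\<close>] that]])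
      also have "p (rs r x - rs r m) = r * p (x - m)"
        using sublinear_on_scale[OF p, of r "x - m"] S \<open>x \<in> S\<close> KS[OF that] \<open>r > 0\<close>
        by (simp add: scale_right_diff_distrib)
      finally show ?thesis using \<open>r > 0\<close> by (simp add: field_simps)
    qed
    then have "q (rs r x) / r \<le> q x" by (intro le_q) blast
    then show ?thesis using \<open>r > 0\<close> by (simp add: field_simps)
  qed
  have "0 \<le> c + p (0 - m)" if "(m, c) \<in> K" for m c using low[OF S(5) that] p0 by simp
  then have "0 \<le> q 0" by (rule le_q)
  then have q0: "q 0 = 0" using q_le[OF S(5) K0] p0 by simp
  have "q (rs r x) = r * q x" if "r \<ge> 0" "x \<in> S" for r x
  proof (cases "r = 0")
    case False
    then have "r > 0" using that by simp
    have "q x = q (rs (1 / r) (rs r x))" using False by simp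
    also have "\<dots> \<le> 1 / r * q (rs r x)" using \<open>r > 0\<close> that S by (intro scale1) auto
    finally show ?thesis using scale1[OF \<open>r > 0\<close> \<open>x \<in> S\<close>] \<open>r > 0\<close> by (simp add: field_simps)
  qed (simp add: q0)
  moreover have "q x \<le> p x" if "x \<in> S" for x using q_le[OF that K0] by simp
  moreover have "q m \<le> c" if "(m, c) \<in> K" for m c using q_le[OF KS[OF that] that] p0 by simp
  ultimately show ?thesis using add that unfolding sublinear_on_def by blast
qed

lemma linear_below_sublinear_on:
  fixes rs :: "real \<Rightarrow> 'a::ab_group_add \<Rightarrow> 'a"
  assumes "vector_space rs" "module.subspace rs S" and p: "sublinear_on rs S p"
  obtains g where "\<And>x y. x \<in> S \<Longrightarrow> y \<in> S \<Longrightarrow> g (x + y) = g x + g y"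
    "\<And>r x. x \<in> S \<Longrightarrow> g (rs r x) = r * g x" "\<And>x. x \<in> S \<Longrightarrow> g x \<le> p x"
proof -
  interpret vector_space rs by fact
  note S = subspace_add[OF assms(2)] subspace_diff[OF assms(2)] subspace_scale[OF assms(2)]
    subspace_neg[OF assms(2)] subspace_0[OF assms(2)]
  \<comment> \<open>Candidates vanish off \<open>S\<close>, so that the pointwise order is
    antisymmetric. \<open>P\<close> reverses this order, hence the maximal element of Zorn's lemma
    is a minimal sublinear function.\<close>
  define A where "A = {q. sublinear_on rs S q \<and> (\<forall>x. x \<notin> S \<longrightarrow> q x = 0) \<and> (\<forall>x\<in>S. q x \<le> p x)}"
  define P where "P = (\<lambda>q q'::'a \<Rightarrow> real. \<forall>x. q' x \<le> q x)"
  have zero: "q 0 = 0" if "sublinear_on rs S q" for q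
    using sublinear_on_scale[OF that, of 0 0] S by simp
  have neg: "0 \<le> q x + q (- x)" if "sublinear_on rs S q" "x \<in> S" for q x
    using sublinear_on_add[OF that(1), of x "- x"] zero[OF that(1)] S that by simp
  have "\<exists>m\<in>A. \<forall>a\<in>A. P m a \<longrightarrow> a = m"
  proof (rule predicate_Zorn)
    show "partial_order_on A (relation_of P A)"
      by (intro partial_order_on_relation_ofI) (auto simp: P_def fun_eq_iff intro: order_trans antisym)
  next
    fix C assume C: "C \<in> Chains (relation_of P A)"
    then have CA: "C \<subseteq> A" and tot: "\<And>q q'. q \<in> C \<Longrightarrow> q' \<in> C \<Longrightarrow> P q q' \<or> P q' q"
      by (auto simp: Chains_def relation_of_def)
    show "\<exists>u\<in>A. \<forall>a\<in>C. P a u"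
    proof (cases "C = {}")
      case True
      have "(\<lambda>x. if x \<in> S then p x else 0) \<in> A"
        using sublinear_on_cong[OF p assms(1,2)] by (auto simp: A_def)
      then show ?thesis using True by blast
    next
      case False
      define u where "u x = Inf ((\<lambda>q. q x) ` C)" for x
      have CS: "sublinear_on rs S q" "\<And>x. x \<in> S \<Longrightarrow> q x \<le> p x" if "q \<in> C" for q
        using that CA by (auto simp: A_def)
      have low: "- p (- x) \<le> q x" if "q \<in> C" "x \<in> S" for q x
        using neg[OF CS(1)[OF that(1)] that(2)] CS(2)[OF that(1)] S that by (smt (verit))
      have bdd: "bdd_below ((\<lambda>q. q x) ` C)" for x
      proof (cases "x \<in> S")
        case True then show ?thesis using low by (intro bdd_belowI[of _ "- p (- x)"]) auto
      next
        case False then show ?thesis using CA by (intro bdd_belowI[of _ 0]) (auto simp: A_def)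
      qed
      have u_le: "u x \<le> q x" if "q \<in> C" for q x unfolding u_def using that bdd by (intro cInf_lower) auto
      have le_u: "a \<le> u x" if "\<And>q. q \<in> C \<Longrightarrow> a \<le> q x" for a x
        unfolding u_def using that False by (intro cInf_greatest) auto
      have "u (x + y) \<le> u x + u y" if "x \<in> S" "y \<in> S" for x y
      proof -
        \<comment> \<open>Two members of a chain are comparable, so the smaller one bounds
          \<open>u (x + y)\<close> by its own values at \<open>x\<close> and \<open>y\<close>. The
          two infima can then be taken independently.\<close>
        have mixed: "u (x + y) \<le> q x + q' y" if q: "q \<in> C" "q' \<in> C" for q q'
        proof -
          have q2: "u (x + y) \<le> r x + r y" if "r \<in> C" for r
            using u_le[OF that] sublinear_on_add[OF CS(1)[OF that]] \<open>x \<in> S\<close> \<open>y \<in> S\<close> order_trans by blast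
          show ?thesis using tot[OF q] q2[OF q(1)] q2[OF q(2)] unfolding P_def by (smt (verit))
        qed
        then have "u (x + y) - q x \<le> q' y" if "q \<in> C" "q' \<in> C" for q q'
          using mixed[OF that] by linarith
        then have "u (x + y) - q x \<le> u y" if "q \<in> C" for q
          using that by (intro le_u)
        then have "u (x + y) - u y \<le> u x"
          by (intro le_u) (simp add: le_diff_eq diff_le_eq add.commute)
        then show ?thesis by simp
      qed
      moreover have "u (rs r x) = r * u x" if "r \<ge> 0" "x \<in> S" for r x
      proof (rule antisym)
        show "r * u x \<le> u (rs r x)"
        proof (rule le_u)
          fix q assume "q \<in> C"
          then show "r * u x \<le> q (rs r x)"
            using u_le[of q x] sublinear_on_scale[OF CS(1) that, of q] that(1) by (simp add: mult_left_mono)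
        qed
        show "u (rs r x) \<le> r * u x"
        proof (cases "r = 0")
          case True
          obtain q where "q \<in> C" using False by blast
          then show ?thesis using True u_le[of q 0] zero[OF CS(1), of q] by simp
        next
          case nz: False
          have "u (rs r x) / r \<le> u x"
          proof (rule le_u)
            fix q assume "q \<in> C"
            then show "u (rs r x) / r \<le> q x"
              using u_le[of q "rs r x"] sublinear_on_scale[OF CS(1) that, of q] that(1) nz
              by (simp add: field_simps)
          qed
          then show ?thesis using nz that by (simp add: field_simps)
        qed
      qed
      moreover have "u x = 0" if "x \<notin> S" for x
      proof -
        have "q x = 0" if "q \<in> C" for q using that \<open>x \<notin> S\<close> CA by (auto simp: A_def)
        then have "(\<lambda>q. q x) ` C = {0}" using False by force
        then show ?thesis by (simp add: u_def)
      qed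
      moreover have "u x \<le> p x" if "x \<in> S" for x
        using False u_le CS(2) that by (meson ex_in_conv order_trans)
      ultimately have "u \<in> A" by (auto simp: A_def sublinear_on_def)
      then show ?thesis using u_le by (auto simp: P_def)
    qed
  qed
  then obtain g where gA: "g \<in> A" and gmin: "\<And>q. q \<in> A \<Longrightarrow> P g q \<Longrightarrow> q = g" by blast
  have g: "sublinear_on rs S g" and gp: "\<And>x. x \<in> S \<Longrightarrow> g x \<le> p x" and goff: "\<And>x. x \<notin> S \<Longrightarrow> g x = 0"
    using gA by (auto simp: A_def)
  \<comment> \<open>Oddness turns subadditivity at (x, y) and (- x, - y) into additivity. It follows
    from minimality: the function that meets the demand on the ray equals \<open>g\<close>, so the
    demand at (- x, - g x) reads g (- x) \<le> - g x.\<close>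
  have odd: "g (- x) = - g x" if x: "x \<in> S" for x
  proof -
    define K where "K = (\<lambda>t. (- rs t x, - t * g x)) ` {0..}"
    obtain q where q: "sublinear_on rs S q" "\<And>y. y \<in> S \<Longrightarrow> q y \<le> g y" "\<And>m c. (m, c) \<in> K \<Longrightarrow> q m \<le> c"
    proof (rule sublinear_on_cone_inf[OF assms(1,2) g, of K])
      show "m \<in> S" if "(m, c) \<in> K" for m c using that x S by (auto simp: K_def)
      show "(0, 0) \<in> K" by (auto simp: K_def image_iff intro!: bexI[of _ 0])
      show "(m + m', c + c') \<in> K" if "(m, c) \<in> K" "(m', c') \<in> K" for m c m' c'
      proof -
        from that obtain s t where "s \<ge> 0" "t \<ge> 0" "m = - rs s x" "c = - s * g x" "m' = - rs t x" "c' = - t * g x"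
          by (auto simp: K_def)
        then show ?thesis
          by (auto simp: K_def image_iff scale_left_distrib algebra_simps intro!: bexI[of _ "s + t"])
      qed
      show "(rs r m, r * c) \<in> K" if "r \<ge> 0" "(m, c) \<in> K" for r m c
      proof -
        from that obtain t where "t \<ge> 0" "m = - rs t x" "c = - t * g x" by (auto simp: K_def)
        then show ?thesis using that(1) by (auto simp: K_def image_iff intro!: bexI[of _ "r * t"])
      qed
      show "- g (- m) \<le> c" if "(m, c) \<in> K" for m c
        using that sublinear_on_scale[OF g _ x] by (auto simp: K_def)
    qed blast
    define q' where "q' y = (if y \<in> S then q y else 0)" for y
    have "sublinear_on rs S q'" by (rule sublinear_on_cong[OF q(1) assms(1,2)]) (simp add: q'_def)
    then have "q' \<in> A" using q(2) gp by (auto simp: A_def q'_def intro: order_trans)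
    moreover have "P g q'" using q(2) goff by (auto simp: P_def q'_def)
    ultimately have "q' = g" by (rule gmin)
    moreover have "(- x, - g x) \<in> K" by (auto simp: K_def image_iff intro!: bexI[of _ 1])
    ultimately have "g (- x) \<le> - g x" using q(3) S x by (metis q'_def)
    then show ?thesis using neg[OF g x] by simp
  qed
  show ?thesis
  proof (rule that[of g])
    show "g (x + y) = g x + g y" if "x \<in> S" "y \<in> S" for x y
      using sublinear_on_add[OF g that] sublinear_on_add[OF g, of "- x" "- y"] odd[of x] odd[of y]
        odd[of "x + y"] S that by simp
    show "g (rs r x) = r * g x" if "x \<in> S" for r x
    proof (cases "r \<ge> 0")
      case False
      then have "g (rs (- r) x) = - r * g x" using sublinear_on_scale[OF g, of "- r" x] that by linarith
      then show ?thesis using odd[of "rs r x"] S(3)[OF that, of r] by simp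
    qed (use sublinear_on_scale[OF g] that in simp)
  qed (use gp in blast)
qed

section \<open>Normed spaces\<close>

lemma normed_vector_space: "normed V \<Longrightarrow> vector_space (scl V)"
  by (simp add: normed_def)

lemma normed_subspace_car: "normed V \<Longrightarrow> module.subspace (scl V) (car V)"
  by (simp add: normed_def)

lemma car_0: "normed V \<Longrightarrow> 0 \<in> car V"
  and car_add: "normed V \<Longrightarrow> x \<in> car V \<Longrightarrow> y \<in> car V \<Longrightarrow> x + y \<in> car V"
  and car_diff: "normed V \<Longrightarrow> x \<in> car V \<Longrightarrow> y \<in> car V \<Longrightarrow> x - y \<in> car V"
  and car_neg: "normed V \<Longrightarrow> x \<in> car V \<Longrightarrow> - x \<in> car V"
  and car_scale: "normed V \<Longrightarrow> x \<in> car V \<Longrightarrow> scl V c x \<in> car V"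
  and car_sum: "normed V \<Longrightarrow> (\<And>i. i \<in> A \<Longrightarrow> h i \<in> car V) \<Longrightarrow> sum h A \<in> car V"
proof -
  assume V: "normed V"
  interpret vector_space "scl V" by (rule normed_vector_space[OF V])
  note * = normed_subspace_car[OF V]
  show "0 \<in> car V" by (rule subspace_0[OF *])
  show "x \<in> car V \<Longrightarrow> y \<in> car V \<Longrightarrow> x + y \<in> car V" by (rule subspace_add[OF *])
  show "x \<in> car V \<Longrightarrow> y \<in> car V \<Longrightarrow> x - y \<in> car V" by (rule subspace_diff[OF *])
  show "x \<in> car V \<Longrightarrow> - x \<in> car V" by (rule subspace_neg[OF *])
  show "x \<in> car V \<Longrightarrow> scl V c x \<in> car V" by (rule subspace_scale[OF *])
  show "(\<And>i. i \<in> A \<Longrightarrow> h i \<in> car V) \<Longrightarrow> sum h A \<in> car V" by (rule subspace_sum[OF *])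
qed

lemma nrm_nonneg: "normed V \<Longrightarrow> x \<in> car V \<Longrightarrow> 0 \<le> nrm V x"
  and nrm_eq_0: "normed V \<Longrightarrow> x \<in> car V \<Longrightarrow> nrm V x = 0 \<longleftrightarrow> x = 0"
  and nrm_scale: "normed V \<Longrightarrow> x \<in> car V \<Longrightarrow> nrm V (scl V c x) = norm c * nrm V x"
  and nrm_triangle: "normed V \<Longrightarrow> x \<in> car V \<Longrightarrow> y \<in> car V \<Longrightarrow> nrm V (x + y) \<le> nrm V x + nrm V y"
  by (auto simp: normed_def)

lemma nrm_0: "normed V \<Longrightarrow> nrm V 0 = 0"
  using nrm_eq_0 car_0 by blast

lemma nrm_neg: "nrm V (- x) = nrm V x" if "normed V" "x \<in> car V"
proof -
  interpret vector_space "scl V" by (rule normed_vector_space[OF that(1)])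
  show ?thesis using nrm_scale[OF that, of "- 1"] by simp
qed

lemma nrm_sum:
  assumes "normed V" "\<And>i. i \<in> A \<Longrightarrow> h i \<in> car V"
  shows "nrm V (sum h A) \<le> (\<Sum>i\<in>A. nrm V (h i))"
  using assms(2)
proof (induction A rule: infinite_finite_induct)
  case (insert a A)
  have "nrm V (h a + sum h A) \<le> nrm V (h a) + nrm V (sum h A)"
    using insert.prems by (intro nrm_triangle car_sum assms(1)) auto
  then show ?case using insert by fastforce
qed (simp_all add: nrm_0[OF assms(1)])

lemma scalars_simps [simp]:
  "car scalars = UNIV" "scl scalars = (*)" "nrm scalars = norm"
  by (simp_all add: scalars_def)

lemma normed_scalars: "normed (scalars :: ('k::real_or_complex, 'k) nspace)"
proof -
  have "vector_space ((*) :: 'k \<Rightarrow> _)" by unfold_locales (auto simp: algebra_simps)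
  moreover from this have "module.subspace ((*) :: 'k \<Rightarrow> _) UNIV"
    by (intro module.subspace_UNIV) (simp add: module_iff_vector_space)
  ultimately show ?thesis by (auto simp: normed_def norm_mult norm_triangle_ineq)
qed

lemma normed_restrict_car:
  assumes "normed V" "M \<subseteq> car V" "module.subspace (scl V) M"
  shows "normed (V\<lparr>car := M\<rparr>)"
  using assms by (auto simp: normed_def subset_iff)

lemma lin_car: "lin V W f \<Longrightarrow> x \<in> car V \<Longrightarrow> f x \<in> car W"
  and lin_add: "lin V W f \<Longrightarrow> x \<in> car V \<Longrightarrow> y \<in> car V \<Longrightarrow> f (x + y) = f x + f y"
  and lin_scale: "lin V W f \<Longrightarrow> x \<in> car V \<Longrightarrow> f (scl V c x) = scl W c (f x)"
  by (auto simp: lin_def)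

lemma lin_scalars_iff:
  "lin V scalars f \<longleftrightarrow> (\<forall>x\<in>car V. \<forall>y\<in>car V. f (x + y) = f x + f y) \<and>
     (\<forall>c. \<forall>x\<in>car V. f (scl V c x) = c * f x)"
  by (auto simp: lin_def)

lemma lin_0: "lin V W f \<Longrightarrow> normed V \<Longrightarrow> f 0 = 0"
  using lin_add[of V W f 0 0] car_0[of V] by simp

lemma lin_neg: "lin V W f \<Longrightarrow> normed V \<Longrightarrow> x \<in> car V \<Longrightarrow> f (- x) = - f x"
  using lin_add[of V W f x "- x"] lin_0[of V W f] car_neg[of V x]
  by (simp add: eq_neg_iff_add_eq_0 add.commute)

lemma lin_diff: "lin V W f \<Longrightarrow> normed V \<Longrightarrow> x \<in> car V \<Longrightarrow> y \<in> car V \<Longrightarrow> f (x - y) = f x - f y"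
  using lin_add[of V W f x "- y"] lin_neg[of V W f y] car_neg[of V y] by simp

lemma lin_sum:
  assumes "lin V W f" "normed V" "\<And>i. i \<in> A \<Longrightarrow> h i \<in> car V"
  shows "f (sum h A) = (\<Sum>i\<in>A. f (h i))"
  using assms(3)
proof (induction A rule: infinite_finite_induct)
  case (insert a A)
  have "f (h a + sum h A) = f (h a) + f (sum h A)"
    using insert.prems by (intro lin_add[OF assms(1)] car_sum assms(2)) auto
  then show ?case using insert by simp
qed (simp_all add: lin_0[OF assms(1,2)])

lemma lin_compose: "lin U V f \<Longrightarrow> lin V W g \<Longrightarrow> lin U W (\<lambda>x. g (f x))"
  by (simp add: lin_def)

lemma lin_cong: "lin V W f \<Longrightarrow> normed V \<Longrightarrow> (\<And>x. x \<in> car V \<Longrightarrow> g x = f x) \<Longrightarrow> lin V W g"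
  by (simp add: lin_def car_add car_scale)

lemma lin_eq_on_span:
  assumes V: "normed V" and f: "lin V scalars f" "lin V scalars g" and S: "car V = module.span (scl V) S"
    and eq: "\<And>x. x \<in> S \<Longrightarrow> f x = g x" and x: "x \<in> car V"
  shows "f x = g x"
proof -
  interpret V: vector_space "scl V" by (rule normed_vector_space[OF V])
  have "x \<in> car V \<and> f x = g x" if "x \<in> V.span S" for x
    using that
  proof (induction rule: V.span_induct_alt)
    case base
    show ?case using lin_0[OF f(1) V] lin_0[OF f(2) V] car_0[OF V] by simp
  next
    case (step c s y)
    have "s \<in> car V" using S step.hyps V.span_base by blast
    then show ?case
      using step.IH lin_add[OF f(1)] lin_add[OF f(2)] lin_scale[OF f(1)] lin_scale[OF f(2)] eq[OF step.hyps]
      by (simp add: car_add[OF V] car_scale[OF V])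
  qed
  then show ?thesis using x S by blast
qed

text \<open>Serves the spaces whose norm is defined through another space: \<open>Lspace\<close> by
  linearization, the tensor product of subspaces by its inclusion, and the copy of a dual by
  evaluation. Injectivity is what makes the pulled back seminorm a norm.\<close>

lemma normed_pullback:
  assumes "vector_space (scl W)" "module.subspace (scl W) (car W)" "normed V" "lin W V J"
    and "inj_on J (car W)" "\<And>x. x \<in> car W \<Longrightarrow> nrm W x = nrm V (J x)"
  shows "normed W"
proof -
  interpret vector_space "scl W" by fact
  note W = subspace_0[OF assms(2)] subspace_add[OF assms(2)] subspace_scale[OF assms(2)]
  have J0: "J 0 = 0" using lin_add[OF assms(4) W(1) W(1)] by simp
  show ?thesis
    unfolding normed_def
  proof (intro conjI allI ballI assms(1,2))
    fix x assume x: "x \<in> car W"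
    show "0 \<le> nrm W x" using nrm_nonneg[OF assms(3) lin_car[OF assms(4) x]] assms(6)[OF x] by simp
    show "nrm W x = 0 \<longleftrightarrow> x = 0"
      using nrm_eq_0[OF assms(3) lin_car[OF assms(4) x]] assms(6)[OF x] J0 inj_onD[OF assms(5) _ x W(1)] by auto
    show "nrm W (scl W c x) = norm c * nrm W x" for c
      using nrm_scale[OF assms(3) lin_car[OF assms(4) x]] assms(6)[OF W(3)[OF x]] assms(6)[OF x]
        lin_scale[OF assms(4) x] by simp
    show "nrm W (x + y) \<le> nrm W x + nrm W y" if y: "y \<in> car W" for y
      using nrm_triangle[OF assms(3) lin_car[OF assms(4) x] lin_car[OF assms(4) y]] assms(6)[OF W(2)[OF x y]]
        assms(6)[OF x] assms(6)[OF y] lin_add[OF assms(4) x y] by simp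
  qed
qed

text \<open>The real part of \<open>f\<close> is extended to a real linear \<open>h\<close> below
  \<open>C * nrm V\<close>, and \<open>g\<close> is recovered from its real part by g x = h x - i h
  (i x). The norm of \<open>g\<close> is then controlled by turning \<open>x\<close> by a suitable
  scalar.\<close>

theorem hahn_banach:
  fixes V :: "('k::real_or_complex, 'a::ab_group_add) nspace"
  assumes V: "normed V" and MV: "M \<subseteq> car V" and M: "module.subspace (scl V) M"
    and f: "lin (V\<lparr>car := M\<rparr>) scalars f" and fC: "\<And>x. x \<in> M \<Longrightarrow> norm (f x) \<le> C * nrm V x"
    and C: "0 \<le> C"
  obtains g where "lin V scalars g" "\<And>x. x \<in> M \<Longrightarrow> g x = f x"
    "\<And>x. x \<in> car V \<Longrightarrow> norm (g x) \<le> C * nrm V x"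
proof -
  interpret V: vector_space "scl V" by (rule normed_vector_space[OF V])
  obtain i :: 'k and re im where i: "i = 0 \<or> i * i = - 1"
    and z: "\<And>z. z = of_real (re z) + of_real (im z) * i"
    and nz: "\<And>z. (norm z)\<^sup>2 = (re z)\<^sup>2 + (im z)\<^sup>2"
    and re_add: "\<And>z w. re (z + w) = re z + re w"
    and re_mul: "\<And>r z. re (of_real r * z) = r * re z"
    and re_i: "\<And>z. re (i * z) = - im z"
    and nri: "\<And>a b. i \<noteq> 0 \<or> b = 0 \<Longrightarrow> (norm (of_real a + of_real b * i))\<^sup>2 = a\<^sup>2 + b\<^sup>2"
    by (rule real_or_complex_parts) (rule that, assumption+)
  have re_le: "re z \<le> norm z" for z
    using nz[of z] power2_le_imp_le[of "re z" "norm z"] by simp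
  define rs where "rs r x = scl V (of_real r) x" for r :: real and x
  have rs: "vector_space rs"
    by unfold_locales (simp_all add: rs_def V.scale_right_distrib V.scale_left_distrib)
  interpret R: vector_space rs by (rule rs)
  have S: "R.subspace (car V)"
    using V by (auto simp: R.subspace_def rs_def car_0 car_add car_scale)
  have fM: "f (x + y) = f x + f y" "f (scl V c x) = c * f x" if "x \<in> M" "y \<in> M" for x y c
    using f that by (auto simp: lin_scalars_iff)
  define p where "p x = C * nrm V x" for x
  have p: "sublinear_on rs (car V) p"
    using nrm_triangle[OF V] C
    by (auto simp: sublinear_on_def p_def rs_def nrm_scale[OF V] distrib_left[symmetric] intro: mult_left_mono)
  \<comment> \<open>The demands are q m \<le> re (f m) on \<open>M\<close>; that they are admissible
    is the domination of \<open>f\<close>, used at - m.\<close>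
  define K where "K = (\<lambda>m. (m, re (f m))) ` M"
  have MM: "x + y \<in> M" "scl V c x \<in> M" "- x \<in> M" "0 \<in> M" if "x \<in> M" "y \<in> M" for x y c
    using that M V.subspace_add V.subspace_scale V.subspace_neg V.subspace_0 by blast+
  have M0: "0 \<in> M" using M by (rule V.subspace_0)
  obtain q where q: "sublinear_on rs (car V) q" "\<And>x. x \<in> car V \<Longrightarrow> q x \<le> p x"
    "\<And>m c. (m, c) \<in> K \<Longrightarrow> q m \<le> c"
  proof (rule sublinear_on_cone_inf[OF rs S p, of K])
    have "f 0 = 0" using fM(2)[OF M0 M0, of 0] by simp
    moreover have "re 0 = 0" using re_mul[of 0 0] by simp
    ultimately show "(0, 0) \<in> K" using M0 by (auto simp: K_def image_iff intro!: bexI[of _ 0])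
    show "- p (- m) \<le> c" if "(m, c) \<in> K" for m c
    proof -
      have m: "m \<in> M" "c = re (f m)" using that by (auto simp: K_def)
      have "re (- f m) \<le> norm (f m)" using re_le[of "- f m"] by simp
      then have "re (- f m) \<le> p (- m)" using fC[OF m(1)] MV m by (auto simp: p_def nrm_neg[OF V])
      moreover have "re (- f m) = - re (f m)" using re_mul[of "- 1" "f m"] by simp
      ultimately show ?thesis using m by simp
    qed
    show "m \<in> car V" if "(m, c) \<in> K" for m c using that MV by (auto simp: K_def)
    show "(m + m', c + c') \<in> K" if "(m, c) \<in> K" "(m', c') \<in> K" for m c m' c'
      using that MM by (auto simp: K_def fM re_add)
    show "(rs r m, r * c) \<in> K" if "r \<ge> 0" "(m, c) \<in> K" for r m c
      using that MM by (auto simp: K_def fM re_mul rs_def image_iff intro!: bexI[of _ "rs r m"])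
  qed blast
  obtain h where h_add: "\<And>x y. x \<in> car V \<Longrightarrow> y \<in> car V \<Longrightarrow> h (x + y) = h x + h y"
    and h_rs: "\<And>r x. x \<in> car V \<Longrightarrow> h (rs r x) = r * h x" and h_le: "\<And>x. x \<in> car V \<Longrightarrow> h x \<le> q x"
    using linear_below_sublinear_on[OF rs S q(1)] by blast
  note h_scale = h_rs[unfolded rs_def]
  have hq: "h x \<le> re (f x)" if "x \<in> M" for x
    using h_le[of x] q(3)[of x "re (f x)"] MV that by (fastforce simp: K_def)
  have h_neg: "h (- x) = - h x" if "x \<in> car V" for x using h_scale[OF that, of "- 1"] by simp
  \<comment> \<open>\<open>M\<close> is symmetric, so the inequality \<open>hq\<close> at x and at -
    x gives equality.\<close>
  have hM: "h x = re (f x)" if "x \<in> M" for x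
  proof -
    have "h (- x) \<le> re (- 1 * f x)" using hq[of "- x"] fM(2)[OF that that, of "- 1"] MM[OF that that] by simp
    also have "re (- 1 * f x) = - re (f x)" using re_mul[of "- 1" "f x"] by simp
    finally have "re (f x) \<le> h x" using h_neg MV that by auto
    then show ?thesis using hq[OF that] by simp
  qed
  define g where "g x = of_real (h x) - i * of_real (h (scl V i x))" for x \<comment> \<open>equals \<open>h\<close> in the real case, where \<open>i = 0\<close>\<close>
  have g_add: "g (x + y) = g x + g y" if "x \<in> car V" "y \<in> car V" for x y
    using that by (simp add: g_def h_add car_scale[OF V] V.scale_right_distrib algebra_simps)
  have g_real: "g (scl V (of_real r) x) = of_real r * g x" if "x \<in> car V" for r x
  proof -
    have "scl V i (scl V (of_real r) x) = scl V (of_real r) (scl V i x)" by (simp add: mult.commute)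
    then show ?thesis using that by (simp only: g_def h_scale car_scale[OF V]) (simp add: algebra_simps)
  qed
  have g_i: "g (scl V i x) = i * g x" if "x \<in> car V" for x
  proof (cases "i = 0")
    case True
    have "h 0 = 0" using h_scale[OF that, of 0] by simp
    then show ?thesis using True by (simp add: g_def)
  next
    case False
    then have ii: "i * i = - 1" using i by simp
    have "i * (i * w) = - w" for w using ii by (simp add: mult.assoc[symmetric])
    then show ?thesis using that by (simp add: g_def ii h_neg right_diff_distrib)
  qed
  have g_scale: "g (scl V c x) = c * g x" if "x \<in> car V" for c x
  proof -
    have "scl V c x = scl V (of_real (re c)) x + scl V (of_real (im c)) (scl V i x)"
      by (subst z[of c]) (simp add: V.scale_left_distrib)
    then have "g (scl V c x) = (of_real (re c) + of_real (im c) * i) * g x"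
      using that by (simp only: g_add g_real g_i car_scale[OF V]) (simp add: algebra_simps)
    then show ?thesis using z[of c] by simp
  qed
  show ?thesis
  proof (rule that[of g])
    show "lin V scalars g" using g_add g_scale by (simp add: lin_scalars_iff)
    show "g x = f x" if "x \<in> M" for x
    proof -
      have "g x = of_real (re (f x)) - i * of_real (re (i * f x))"
        using hM[OF that] hM[of "scl V i x"] MM[OF that that] fM(2)[OF that that] by (simp add: g_def)
      also have "\<dots> = of_real (re (f x)) + of_real (im (f x)) * i" by (simp add: re_i mult.commute)
      finally show ?thesis using z[of "f x"] by simp
    qed
    show "norm (g x) \<le> C * nrm V x" if "x \<in> car V" for x
    proof -
      define a where "a = h x"
      define b where "b = - h (scl V i x)"
      have gx: "g x = of_real a + of_real b * i" by (simp add: g_def a_def b_def)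
      \<comment> \<open>In the real case \<open>scl V i x\<close> is the zero vector, where
        \<open>h\<close> vanishes.\<close>
      have "i \<noteq> 0 \<or> b = 0" using h_scale[OF that, of 0] by (auto simp: b_def)
      then have ib: "i \<noteq> 0 \<or> b = 0" "i \<noteq> 0 \<or> - b = 0" by auto
      have N: "(norm (g x))\<^sup>2 = a\<^sup>2 + b\<^sup>2" unfolding gx by (rule nri[OF ib(1)])
      \<comment> \<open>The conjugate of \<open>g x\<close>: then h (c x) is the square of the norm
        of \<open>g x\<close>, while \<open>h\<close> is dominated at c x, and one factor norm (g x)
        cancels.\<close>
      define c where "c = of_real a + of_real (- b) * i"
      have "(norm c)\<^sup>2 = (norm (g x))\<^sup>2" unfolding N c_def using nri[OF ib(2), of a] by simp
      then have Nc: "norm c = norm (g x)" by simp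
      have "scl V c x = scl V (of_real a) x + scl V (of_real (- b)) (scl V i x)"
        by (simp only: c_def V.scale_left_distrib V.scale_scale)
      then have "h (scl V c x) = a * h x + (- b) * h (scl V i x)"
        using that by (simp only: h_add h_scale car_scale[OF V])
      then have "h (scl V c x) = (norm (g x))\<^sup>2" using N by (simp add: a_def b_def power2_eq_square)
      moreover have "h (scl V c x) \<le> C * (norm (g x) * nrm V x)"
        using h_le[of "scl V c x"] q(2)[of "scl V c x"] that
        by (simp add: p_def car_scale[OF V] nrm_scale[OF V] Nc)
      ultimately have "norm (g x) * norm (g x) \<le> norm (g x) * (C * nrm V x)"
        by (simp add: power2_eq_square algebra_simps)
      then show ?thesis
        using C nrm_nonneg[OF V that] by (cases "norm (g x) = 0") (auto simp: mult_le_cancel_left)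
    qed
  qed
qed

lemma norming_functional:
  fixes V :: "('k::real_or_complex, 'a::ab_group_add) nspace"
  assumes V: "normed V" and a: "a \<in> car V"
  obtains g where "lin V scalars g" "g a = of_real (nrm V a)" "\<And>x. x \<in> car V \<Longrightarrow> norm (g x) \<le> nrm V x"
proof (cases "a = 0")
  case True
  show ?thesis
    by (rule that[of "\<lambda>_. 0"]) (use True nrm_nonneg[OF V] nrm_0[OF V] in \<open>auto simp: lin_def\<close>)
next
  case False
  interpret V: vector_space "scl V" by (rule normed_vector_space[OF V])
  define M where "M = range (\<lambda>c. scl V c a)"
  define f where "f x = (THE c. x = scl V c a) * of_real (nrm V a)" for x
  have f: "f (scl V c a) = c * of_real (nrm V a)" for c
    using False by (simp add: f_def V.scale_right_imp_eq)
  have M: "V.subspace M"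
    unfolding V.subspace_def M_def using V.scale_left_distrib[of _ _ a, symmetric] V.scale_zero_left[of a]
    by (auto simp: image_iff)
  have "lin (V\<lparr>car := M\<rparr>) scalars f"
    by (auto simp: lin_scalars_iff M_def f V.scale_left_distrib[symmetric] distrib_right)
  moreover have "norm (f x) \<le> 1 * nrm V x" if "x \<in> M" for x
    using that nrm_nonneg[OF V a] by (auto simp: M_def f nrm_scale[OF V a] norm_mult)
  moreover have "M \<subseteq> car V" using a by (auto simp: M_def car_scale[OF V])
  ultimately obtain g where "lin V scalars g" and gM: "\<And>x. x \<in> M \<Longrightarrow> g x = f x"
    and "\<And>x. x \<in> car V \<Longrightarrow> norm (g x) \<le> 1 * nrm V x"
    using hahn_banach[OF V _ M, of f 1] by auto
  moreover have "a \<in> M" "f a = of_real (nrm V a)"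
    using f[of 1] by (auto simp: M_def image_iff intro!: exI[of _ 1])
  ultimately show ?thesis using that[of g] by simp
qed

section \<open>Operator norms and duals\<close>

text \<open>\<open>opnorm\<close> is a \<open>Sup\<close> of reals, whose value is meaningful only
  for bounded sets; this licenses its use for bounded operators.\<close>

lemma opnorm_set_bdd:
  assumes "bounded_op V W f" "normed V"
  shows "bdd_above {nrm W (f x) | x. x \<in> car V \<and> nrm V x \<le> 1}"
proof -
  obtain C where C: "\<And>x. x \<in> car V \<Longrightarrow> nrm W (f x) \<le> C * nrm V x"
    using assms by (auto simp: bounded_op_def bounded_by_def)
  have "nrm W (f x) \<le> \<bar>C\<bar>" if "x \<in> car V" "nrm V x \<le> 1" for x
  proof -
    have "C * nrm V x \<le> \<bar>C\<bar> * 1" using nrm_nonneg[OF assms(2) that(1)] that(2) by (intro mult_mono) auto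
    then show ?thesis using C[OF that(1)] by simp
  qed
  then show ?thesis by (intro bdd_aboveI) blast
qed

lemma opnorm_le:
  assumes "normed V" "0 \<le> C" "\<And>x. x \<in> car V \<Longrightarrow> nrm W (f x) \<le> C * nrm V x"
  shows "opnorm V W f \<le> C"
  unfolding opnorm_def
proof (rule cSup_least)
  show "{nrm W (f x) |x. x \<in> car V \<and> nrm V x \<le> 1} \<noteq> {}"
    using car_0[OF assms(1)] nrm_0[OF assms(1)] by force
  fix y assume "y \<in> {nrm W (f x) |x. x \<in> car V \<and> nrm V x \<le> 1}"
  then obtain x where x: "x \<in> car V" "nrm V x \<le> 1" "y = nrm W (f x)" by auto
  have "C * nrm V x \<le> C * 1" using x(2) assms(2) by (intro mult_left_mono)
  then show "y \<le> C" using assms(3)[OF x(1)] x(3) by simp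
qed

lemma opnorm_nonneg:
  assumes "normed V" "normed W" "bounded_op V W f"
  shows "0 \<le> opnorm V W f"
proof -
  have "lin V W f" using assms(3) by (auto simp: bounded_op_def bounded_by_def)
  then have "nrm W (f 0) = 0" using assms by (simp add: lin_0 nrm_0)
  then have "0 \<in> {nrm W (f x) | x. x \<in> car V \<and> nrm V x \<le> 1}"
    using car_0[OF assms(1)] nrm_0[OF assms(1)] by force
  then show ?thesis unfolding opnorm_def using opnorm_set_bdd[OF assms(3,1)] by (intro cSup_upper)
qed

lemma opnorm_bound:
  assumes "normed V" "normed W" "bounded_op V W f" "x \<in> car V"
  shows "nrm W (f x) \<le> opnorm V W f * nrm V x"
proof (cases "x = 0")
  case True
  have "lin V W f" using assms(3) by (auto simp: bounded_op_def bounded_by_def)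
  then show ?thesis using True assms by (simp add: lin_0 nrm_0)
next
  case False
  have l: "lin V W f" using assms(3) by (auto simp: bounded_op_def bounded_by_def)
  have pos: "nrm V x > 0" using False nrm_eq_0[OF assms(1,4)] nrm_nonneg[OF assms(1,4)] by linarith
  define y where "y = scl V (of_real (1 / nrm V x)) x"
  have y: "y \<in> car V" "nrm V y = 1"
    using assms(1,4) pos by (simp_all add: y_def car_scale nrm_scale norm_divide)
  have "nrm W (f y) \<le> opnorm V W f"
    unfolding opnorm_def using y by (intro cSup_upper opnorm_set_bdd assms) auto
  moreover have "nrm W (f y) = nrm W (f x) / nrm V x"
    using pos lin_car[OF l assms(4)] lin_scale[OF l assms(4)] assms(2)
    by (simp add: y_def nrm_scale norm_divide)
  ultimately show ?thesis using pos by (simp add: field_simps)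
qed

lemma bounded_op_lin: "bounded_op V W f \<Longrightarrow> lin V W f"
  by (auto simp: bounded_op_def bounded_by_def)

lemma bounded_opI: "lin V W f \<Longrightarrow> (\<And>x. x \<in> car V \<Longrightarrow> nrm W (f x) \<le> C * nrm V x) \<Longrightarrow> bounded_op V W f"
  by (auto simp: bounded_op_def bounded_by_def)

interpretation pscale: vector_space "pscale :: 'k::real_or_complex \<Rightarrow> ('a \<Rightarrow> 'k) \<Rightarrow> _"
  by (rule vector_space_pscale)

lemma dual_simps [simp]: "scl (dual V) = pscale" "nrm (dual V) = opnorm V scalars"
  by (simp_all add: dual_def)

lemma in_dual_iff: "f \<in> car (dual V) \<longleftrightarrow> bounded_op V scalars f \<and> (\<forall>x. x \<notin> car V \<longrightarrow> f x = 0)"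
  by (simp add: dual_def)

lemma dual_lin: "f \<in> car (dual V) \<Longrightarrow> lin V scalars f"
  by (simp add: in_dual_iff bounded_op_lin)

lemma dual_bound: "f \<in> car (dual V) \<Longrightarrow> normed V \<Longrightarrow> x \<in> car V \<Longrightarrow> norm (f x) \<le> opnorm V scalars f * nrm V x"
  using opnorm_bound[of V scalars f x] normed_scalars by (auto simp: in_dual_iff)

lemma dual_extendI:
  assumes "lin V scalars g" "normed V" "\<And>x. x \<in> car V \<Longrightarrow> norm (g x) \<le> C * nrm V x"
  shows "(\<lambda>x. if x \<in> car V then g x else 0) \<in> car (dual V)"
  unfolding in_dual_iff
  using assms by (auto intro!: bounded_opI[of _ _ _ C] lin_cong[OF assms(1)])

lemma normed_dual:
  fixes V :: "('k::real_or_complex, 'a::ab_group_add) nspace"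
  assumes V: "normed V"
  shows "normed (dual V)"
proof -
  have add: "f + g \<in> car (dual V)" "opnorm V scalars (f + g) \<le> opnorm V scalars f + opnorm V scalars g"
    if "f \<in> car (dual V)" "g \<in> car (dual V)" for f g
  proof -
    have b: "nrm scalars ((f + g) x) \<le> (opnorm V scalars f + opnorm V scalars g) * nrm V x" if "x \<in> car V" for x
      using dual_bound[OF \<open>f \<in> _\<close> V that] dual_bound[OF \<open>g \<in> _\<close> V that] norm_triangle_ineq[of "f x" "g x"]
      by (simp add: distrib_right)
    have "lin V scalars (f + g)" using dual_lin[OF that(1)] dual_lin[OF that(2)]
      by (simp add: lin_scalars_iff algebra_simps)
    then have "bounded_op V scalars (f + g)" using b by (rule bounded_opI)
    then show "f + g \<in> car (dual V)" using that by (simp add: in_dual_iff)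
    show "opnorm V scalars (f + g) \<le> opnorm V scalars f + opnorm V scalars g"
      using that by (intro opnorm_le V b add_nonneg_nonneg opnorm_nonneg normed_scalars) (auto simp: in_dual_iff)
  qed
  have scale: "pscale c f \<in> car (dual V)" "opnorm V scalars (pscale c f) \<le> norm c * opnorm V scalars f"
    if "f \<in> car (dual V)" for c f
  proof -
    have b: "nrm scalars (pscale c f x) \<le> (norm c * opnorm V scalars f) * nrm V x" if "x \<in> car V" for x
      using dual_bound[OF \<open>f \<in> _\<close> V that] by (simp add: pscale_def norm_mult mult.assoc mult_left_mono)
    have "lin V scalars (pscale c f)" using dual_lin[OF that]
      by (simp add: lin_scalars_iff pscale_def algebra_simps)
    then have "bounded_op V scalars (pscale c f)" using b by (rule bounded_opI)
    then show "pscale c f \<in> car (dual V)" using that by (simp add: in_dual_iff pscale_def)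
    show "opnorm V scalars (pscale c f) \<le> norm c * opnorm V scalars f"
      using that by (intro opnorm_le V b mult_nonneg_nonneg opnorm_nonneg normed_scalars) (auto simp: in_dual_iff)
  qed
  have zero: "0 \<in> car (dual V)" using V
    by (auto simp: in_dual_iff lin_scalars_iff intro!: bounded_opI[of _ _ _ 0])
  have z0: "opnorm V scalars (0 :: 'a \<Rightarrow> 'k) = 0"
    using opnorm_le[OF V, of 0 scalars "0 :: 'a \<Rightarrow> 'k"] opnorm_nonneg[OF V normed_scalars, of 0] zero
    by (simp add: in_dual_iff)
  have "opnorm V scalars (pscale c f) = norm c * opnorm V scalars f" if "f \<in> car (dual V)" for c f
  proof (cases "c = 0")
    case False
    have "opnorm V scalars f = opnorm V scalars (pscale (1 / c) (pscale c f))" using False by simp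
    also have "\<dots> \<le> norm (1 / c) * opnorm V scalars (pscale c f)" by (intro scale) (use that scale in auto)
    finally have "norm c * opnorm V scalars f \<le> opnorm V scalars (pscale c f)"
      using False by (simp add: norm_divide field_simps)
    then show ?thesis using scale(2)[OF that, of c] by simp
  qed (simp add: z0)
  moreover have "f = 0" if "f \<in> car (dual V)" "opnorm V scalars f = 0" for f
  proof
    fix x show "f x = 0 x" using dual_bound[OF that(1) V, of x] that by (cases "x \<in> car V") (auto simp: in_dual_iff)
  qed
  moreover have "pscale.subspace (car (dual V))"
    using zero add scale by (simp add: pscale.subspace_def)
  moreover have "0 \<le> opnorm V scalars f" if "f \<in> car (dual V)" for f
    using that by (intro opnorm_nonneg V normed_scalars) (simp add: in_dual_iff)
  ultimately show ?thesis
    using add z0 vector_space_pscale by (auto simp: normed_def)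
qed

text \<open>Completeness of the dual passes to its copy in the universe, which has to be a Banach
  space in order to occur in an election.\<close>

lemma banach_dual:
  fixes V :: "('k::real_or_complex, 'a::ab_group_add) nspace"
  assumes V: "normed V"
  shows "banach_space (dual V)"
  unfolding banach_space_def
proof (intro conjI allI impI)
  note D = normed_dual[OF V]
  show "normed (dual V)" by (rule D)
  fix s :: "nat \<Rightarrow> 'a \<Rightarrow> 'k"
  assume "(\<forall>k. s k \<in> car (dual V)) \<and> (\<forall>e>0. \<exists>N. \<forall>j\<ge>N. \<forall>k\<ge>N. nrm (dual V) (s j - s k) < e)"
  then have s: "\<And>k. s k \<in> car (dual V)"
    and cau: "\<And>e. e > 0 \<Longrightarrow> \<exists>N. \<forall>j\<ge>N. \<forall>k\<ge>N. opnorm V scalars (s j - s k) < e" by auto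
  have diff: "norm (s j x - s k x) \<le> opnorm V scalars (s j - s k) * nrm V x" if "x \<in> car V" for j k x
    using dual_bound[OF car_diff[OF D s s] V that, of j k] by simp
  have "\<exists>l. (\<lambda>k. s k x) \<longlonglongrightarrow> l" for x
  proof (cases "x \<in> car V")
    case True
    show ?thesis
    proof (rule Cauchy_real_or_complex_convergent)
      fix e :: real assume "e > 0"
      have nn: "nrm V x \<ge> 0" by (rule nrm_nonneg[OF V True])
      obtain N where N: "\<And>j k. j \<ge> N \<Longrightarrow> k \<ge> N \<Longrightarrow> opnorm V scalars (s j - s k) < e / (nrm V x + 1)"
        using cau[of "e / (nrm V x + 1)"] \<open>e > 0\<close> nn by auto
      have "norm (s j x - s k x) < e" if "j \<ge> N" "k \<ge> N" for j k
      proof -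
        have "norm (s j x - s k x) \<le> e / (nrm V x + 1) * nrm V x"
          using diff[OF True, of j k] N[OF that] nn by (meson less_imp_le mult_right_mono order_trans)
        also have "\<dots> < e" using nn \<open>e > 0\<close> by (simp add: field_simps)
        finally show ?thesis .
      qed
      then show "\<exists>N. \<forall>j\<ge>N. \<forall>k\<ge>N. norm (s j x - s k x) < e" by blast
    qed
  next
    case False
    then have "(\<lambda>k. s k x) = (\<lambda>k. 0)" using s by (auto simp: in_dual_iff)
    then show ?thesis by auto
  qed
  then obtain l where l: "\<And>x. (\<lambda>k. s k x) \<longlonglongrightarrow> l x" by metis
  have lin: "lin V scalars l"
    unfolding lin_scalars_iff
  proof (intro conjI ballI allI)
    fix x y assume "x \<in> car V" "y \<in> car V"
    then have "(\<lambda>k. s k (x + y)) = (\<lambda>k. s k x + s k y)" by (simp add: lin_add[OF dual_lin[OF s]])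
    then show "l (x + y) = l x + l y"
      using l[of "x + y"] tendsto_add[OF l[of x] l[of y]] LIMSEQ_unique by metis
  next
    fix c x assume "x \<in> car V"
    then have "(\<lambda>k. s k (scl V c x)) = (\<lambda>k. c * s k x)"
      by (simp add: lin_scale[OF dual_lin[OF s]])
    then show "l (scl V c x) = c * l x"
      using l[of "scl V c x"] tendsto_mult_left[OF l[of x], of c] LIMSEQ_unique by metis
  qed
  have est: "\<exists>N. \<forall>j\<ge>N. \<forall>x\<in>car V. norm (s j x - l x) \<le> e * nrm V x" if "e > 0" for e
  proof -
    obtain N where N: "\<And>j k. j \<ge> N \<Longrightarrow> k \<ge> N \<Longrightarrow> opnorm V scalars (s j - s k) < e"
      using cau[OF \<open>e > 0\<close>] by auto
    have "norm (s j x - l x) \<le> e * nrm V x" if "j \<ge> N" "x \<in> car V" for j x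
    proof (rule LIMSEQ_le_const2)
      show "(\<lambda>k. norm (s j x - s k x)) \<longlonglongrightarrow> norm (s j x - l x)" by (intro tendsto_intros l)
      have "norm (s j x - s k x) \<le> e * nrm V x" if "k \<ge> N" for k
        using diff[OF \<open>x \<in> car V\<close>, of j k] N[OF \<open>j \<ge> N\<close> that] nrm_nonneg[OF V \<open>x \<in> car V\<close>]
        by (meson less_imp_le mult_right_mono order_trans)
      then show "\<exists>N. \<forall>k\<ge>N. norm (s j x - s k x) \<le> e * nrm V x" by blast
    qed
    then show ?thesis by blast
  qed
  have "l \<in> car (dual V)"
    unfolding in_dual_iff
  proof
    obtain N where N: "\<forall>j\<ge>N. \<forall>x\<in>car V. norm (s j x - l x) \<le> 1 * nrm V x" using est[of 1] by auto
    show "bounded_op V scalars l"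
    proof (rule bounded_opI[OF lin])
      fix x assume x: "x \<in> car V"
      have "norm (l x) \<le> norm (s N x) + norm (s N x - l x)"
        using norm_triangle_ineq4[of "s N x" "s N x - l x"] by simp
      also have "\<dots> \<le> (opnorm V scalars (s N) + 1) * nrm V x"
        using dual_bound[OF s V x, of N] N x by (fastforce simp: distrib_right)
      finally show "nrm scalars (l x) \<le> (opnorm V scalars (s N) + 1) * nrm V x" by simp
    qed
    show "\<forall>x. x \<notin> car V \<longrightarrow> l x = 0"
    proof (intro allI impI)
      fix x assume "x \<notin> car V"
      then have "(\<lambda>k. s k x) = (\<lambda>k. 0)" using s by (auto simp: in_dual_iff)
      then show "l x = 0" using l[of x] by (simp add: LIMSEQ_const_iff)
    qed
  qed
  moreover have "(\<lambda>k. nrm (dual V) (s k - l)) \<longlonglongrightarrow> 0"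
  proof (rule LIMSEQ_I)
    fix e :: real assume "e > 0"
    obtain N where N: "\<forall>j\<ge>N. \<forall>x\<in>car V. norm (s j x - l x) \<le> e / 2 * nrm V x"
      using est[of "e / 2"] \<open>e > 0\<close> by auto
    have "norm (nrm (dual V) (s j - l) - 0) < e" if "j \<ge> N" for j
    proof -
      have "opnorm V scalars (s j - l) \<le> e / 2"
        using N that \<open>e > 0\<close> by (intro opnorm_le V) auto
      moreover have "0 \<le> opnorm V scalars (s j - l)"
        using nrm_nonneg[OF D car_diff[OF D s \<open>l \<in> _\<close>]] by simp
      ultimately show ?thesis using \<open>e > 0\<close> by simp
    qed
    then show "\<exists>N. \<forall>j\<ge>N. norm (nrm (dual V) (s j - l) - 0) < e" by blast
  qed
  ultimately show "\<exists>l\<in>car (dual V). (\<lambda>k. nrm (dual V) (s k - l)) \<longlonglongrightarrow> 0" by blast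
qed

section \<open>Finite dimensional spaces\<close>

lemma pscale_apply: "pscale c f x = c * f x"
  by (simp add: pscale_def)

lemma sum_apply: "(\<Sum>i\<in>A. h i) x = (\<Sum>i\<in>A. h i x)"
  using sum_comp_morphism[of "\<lambda>f. f x" h A] by (simp add: o_def)

text \<open>Modulo the common kernel of the functionals, every x of V equals the sum of the vectors
  v k with coefficients lam k x. The functionals may be dependent, so any finite spanning family can
  be used; the \<open>v k\<close> take the place of a dual basis. The roles of points and
  functionals are interchangeable, and the lemma is applied both ways.\<close>

lemma (in vector_space) finite_functionals_reproduce:
  fixes lam :: "'i \<Rightarrow> 'b \<Rightarrow> 'a"
  assumes "finite K" "subspace V"
    and "\<And>k x y. k \<in> K \<Longrightarrow> x \<in> V \<Longrightarrow> y \<in> V \<Longrightarrow> lam k (x + y) = lam k x + lam k y"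
    and "\<And>k c x. k \<in> K \<Longrightarrow> x \<in> V \<Longrightarrow> lam k (scale c x) = c * lam k x"
  shows "\<exists>v. (\<forall>k\<in>K. v k \<in> V) \<and> (\<forall>x\<in>V. \<forall>j\<in>K. lam j x = (\<Sum>k\<in>K. lam k x * lam j (v k)))"
  using assms
proof (induction K arbitrary: V rule: finite_induct)
  case empty
  then show ?case by auto
next
  case (insert a K V)
  note V = \<open>subspace V\<close>
  have add: "lam k (x + y) = lam k x + lam k y" if "k = a \<or> k \<in> K" "x \<in> V" "y \<in> V" for k x y
    using insert.prems(2)[of k x y] that by blast
  have scale: "lam k (scale c x) = c * lam k x" if "k = a \<or> k \<in> K" "x \<in> V" for k c x
    using insert.prems(3)[of k x c] that by blast
  have zero: "lam k 0 = 0" if "k = a \<or> k \<in> K" for k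
    using scale[OF that subspace_0[OF V], of 0] by simp
  have diff: "lam k (x - y) = lam k x - lam k y" if "k = a \<or> k \<in> K" "x \<in> V" "y \<in> V" for k x y
    using add[OF that(1) that(2) subspace_neg[OF V that(3)]] scale[OF that(1,3), of "- 1"] by simp
  have sum: "lam k (sum h A) = (\<Sum>i\<in>A. lam k (h i))" if "k = a \<or> k \<in> K" "\<And>i. i \<in> A \<Longrightarrow> h i \<in> V"
    for k and h :: "'i \<Rightarrow> 'b" and A
    using that(2)
  proof (induction A rule: infinite_finite_induct)
    case (insert b A)
    have "sum h A \<in> V" using insert.prems by (intro subspace_sum[OF V]) auto
    then show ?case using insert add[OF that(1), of "h b" "sum h A"] by simp
  qed (simp_all add: zero[OF that(1)])
  \<comment> \<open>The induction hypothesis is used on the kernel of the new functional; this is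
    why V is arbitrary in the induction.\<close>
  define V' where "V' = {x\<in>V. lam a x = 0}"
  have V': "subspace V'"
  proof (rule subspaceI)
    show "0 \<in> V'" using subspace_0[OF V] zero[of a] by (simp add: V'_def)
    show "x + y \<in> V'" if "x \<in> V'" "y \<in> V'" for x y
      using that subspace_add[OF V, of x y] add[of a x y] by (simp add: V'_def)
    show "scale c x \<in> V'" if "x \<in> V'" for c x
      using that subspace_scale[OF V, of x c] scale[of a x c] by (simp add: V'_def)
  qed
  have "\<exists>v. (\<forall>k\<in>K. v k \<in> V') \<and> (\<forall>x\<in>V'. \<forall>j\<in>K. lam j x = (\<Sum>k\<in>K. lam k x * lam j (v k)))"
    by (rule insert.IH[OF V']) (simp_all add: V'_def add scale)
  then obtain v where v: "\<And>k. k \<in> K \<Longrightarrow> v k \<in> V'"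
    and rep: "\<And>x j. x \<in> V' \<Longrightarrow> j \<in> K \<Longrightarrow> lam j x = (\<Sum>k\<in>K. lam k x * lam j (v k))" by blast
  have vV: "\<And>k. k \<in> K \<Longrightarrow> v k \<in> V" "\<And>k. k \<in> K \<Longrightarrow> lam a (v k) = 0" using v by (auto simp: V'_def)
  have upd: "(\<Sum>k\<in>insert a K. lam k x * lam j ((v(a := w)) k)) =
      lam a x * lam j w + (\<Sum>k\<in>K. lam k x * lam j (v k))" for x j w
  proof -
    have "(\<Sum>k\<in>K. lam k x * lam j ((v(a := w)) k)) = (\<Sum>k\<in>K. lam k x * lam j (v k))"
      using insert.hyps by (intro sum.cong) auto
    then show ?thesis using insert.hyps by simp
  qed
  show ?case
  proof (cases "\<forall>x\<in>V. lam a x = 0")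
    case True
    then have "V' = V" by (auto simp: V'_def)
    have "lam j x = (\<Sum>k\<in>insert a K. lam k x * lam j ((v(a := 0)) k))" if "x \<in> V" "j \<in> insert a K" for x j
    proof (cases "j \<in> K")
      case True
      have "lam j x = (\<Sum>k\<in>K. lam k x * lam j (v k))" by (rule rep) (use \<open>V' = V\<close> that True in auto)
      then show ?thesis unfolding upd using zero[of j] True by simp
    next
      case False
      then have "j = a" using that by simp
      then show ?thesis unfolding upd using \<open>\<forall>x\<in>V. lam a x = 0\<close> that(1) vV zero[of a] by simp
    qed
    moreover have "(v(a := 0)) k \<in> V" if "k \<in> insert a K" for k
      using that vV subspace_0[OF V] by auto
    ultimately show ?thesis by blast
  next
    case False
    then obtain y where y: "y \<in> V" "lam a y \<noteq> 0" by blast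
    define z where "z = scale (1 / lam a y) y"
    have z: "z \<in> V" "lam a z = 1" using y V by (auto simp: z_def subspace_scale scale)
    \<comment> \<open>\<open>z\<close> corrected by what the old vectors already reproduce:
      \<open>lam a w\<close> is still 1, because the \<open>v k\<close> lie in the kernel of
      \<open>lam a\<close>, and \<open>lam j w\<close> is exactly the defect of the old formula at
      \<open>z\<close>. Every x is an element of the kernel plus a multiple of
      \<open>z\<close>.\<close>
    define w where "w = z - (\<Sum>k\<in>K. scale (lam k z) (v k))"
    have sV: "(\<Sum>k\<in>K. scale (lam k z) (v k)) \<in> V" using vV V by (intro subspace_sum) (auto simp: subspace_scale)
    have wV: "w \<in> V" using z sV V by (auto simp: w_def subspace_diff)
    have lw: "lam j w = lam j z - (\<Sum>k\<in>K. lam k z * lam j (v k))" if "j = a \<or> j \<in> K" for j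
      unfolding w_def using that z(1) sV vV V by (simp add: diff sum subspace_scale scale)
    have lj: "lam j x = lam a x * lam j w + (\<Sum>k\<in>K. lam k x * lam j (v k))"
      if "x \<in> V" "j = a \<or> j \<in> K" for x j
    proof (cases "j = a")
      case True
      then show ?thesis using vV(2) lw[of a] z(2) by simp
    next
      case False
      define x' where "x' = x - scale (lam a x) z"
      have lx': "lam k x' = lam k x - lam a x * lam k z" if "k = a \<or> k \<in> K" for k
        unfolding x'_def using that \<open>x \<in> V\<close> z V by (simp add: diff scale subspace_scale)
      have "x' \<in> V'" using that z V lx'[of a] by (auto simp: V'_def x'_def subspace_diff subspace_scale)
      then have "lam j x' = (\<Sum>k\<in>K. lam k x' * lam j (v k))" using rep that False by blast
      also have "\<dots> = (\<Sum>k\<in>K. lam k x * lam j (v k)) - lam a x * (\<Sum>k\<in>K. lam k z * lam j (v k))"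
        by (simp add: lx' sum_subtractf sum_distrib_left left_diff_distrib mult.assoc)
      finally show ?thesis
        using lx'[OF that(2)] by (simp add: lw[OF that(2)] algebra_simps)
    qed
    have "lam j x = (\<Sum>k\<in>insert a K. lam k x * lam j ((v(a := w)) k))" if "x \<in> V" "j \<in> insert a K" for x j
      unfolding upd using that by (intro lj) auto
    moreover have "(v(a := w)) k \<in> V" if "k \<in> insert a K" for k
      using that vV wV by auto
    ultimately show ?thesis by blast
  qed
qed

text \<open>
  Evaluations at \<open>B\<close> separate the points of the dual of \<open>V\<close>, which is therefore spanned by bounded functionals
  that act as coordinates; this makes finite dimensional spaces complete without an equivalence of norms.
\<close>

lemma fin_dim_bounded_coordinates:
  fixes V :: "('k::real_or_complex, 'a::ab_group_add) nspace"
  assumes V: "normed V" and B: "finite B" "car V = module.span (scl V) B"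
  obtains f where "\<And>b. b \<in> B \<Longrightarrow> f b \<in> car (dual V)" "\<And>x. x \<in> car V \<Longrightarrow> x = (\<Sum>b\<in>B. scl V (f b x) b)"
proof -
  interpret V: vector_space "scl V" by (rule normed_vector_space[OF V])
  note D = normed_dual[OF V]
  have BV: "b \<in> car V" if "b \<in> B" for b using that B V.span_base by blast
  obtain v where v: "\<And>b. b \<in> B \<Longrightarrow> v b \<in> car (dual V)"
    and rep: "\<And>f j. f \<in> car (dual V) \<Longrightarrow> j \<in> B \<Longrightarrow> f j = (\<Sum>b\<in>B. f b * v b j)"
    using pscale.finite_functionals_reproduce[OF B(1), of "car (dual V)" "\<lambda>b f. f b"]
      normed_subspace_car[OF D] by (auto simp: pscale_def)
  have "x = (\<Sum>b\<in>B. scl V (v b x) b)" if x: "x \<in> car V" for x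
  proof -
    define y where "y = x - (\<Sum>b\<in>B. scl V (v b x) b)"
    have sV: "(\<Sum>b\<in>B. scl V (v b x) b) \<in> car V" using BV by (intro car_sum car_scale V)
    then have y: "y \<in> car V" using x V by (simp add: y_def car_diff)
    \<comment> \<open>The expansion need only be tested by bounded functionals, since a norming
      functional detects a nonzero remainder \<open>y\<close>. For these, both sides are linear in x
      and agree on \<open>B\<close> by \<open>rep\<close>.\<close>
    have fy: "f y = 0" if f: "f \<in> car (dual V)" for f
    proof -
      have "lin V scalars (\<lambda>x. \<Sum>b\<in>B. f b * v b x)"
        using lin_add[OF dual_lin[OF v]] lin_scale[OF dual_lin[OF v]]
        by (simp add: lin_scalars_iff distrib_left sum.distrib sum_distrib_left mult.left_commute)
      then have "f x = (\<Sum>b\<in>B. f b * v b x)"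
        using lin_eq_on_span[OF V dual_lin[OF f] _ B(2) _ x] rep[OF f] by blast
      also have "\<dots> = f (\<Sum>b\<in>B. scl V (v b x) b)"
        using lin_sum[OF dual_lin[OF f] V, of B] lin_scale[OF dual_lin[OF f]] BV by (simp add: car_scale V mult.commute)
      finally show ?thesis using lin_diff[OF dual_lin[OF f] V x sV] by (simp add: y_def)
    qed
    obtain g where g: "lin V scalars g" "g y = of_real (nrm V y)" "\<And>x. x \<in> car V \<Longrightarrow> norm (g x) \<le> nrm V x"
      using norming_functional[OF V y] by blast
    have "(\<lambda>x. if x \<in> car V then g x else 0) \<in> car (dual V)"
      using g by (intro dual_extendI[of _ _ 1] V) auto
    from fy[OF this] have "nrm V y = 0" using y g(2) by simp
    then show ?thesis using nrm_eq_0[OF V y] by (simp add: y_def)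
  qed
  then show ?thesis using that v by blast
qed

lemma fin_dim_banach:
  fixes V :: "('k::real_or_complex, 'a::ab_group_add) nspace"
  assumes V: "normed V" and B: "finite B" "car V = module.span (scl V) B"
  shows "banach_space V"
  unfolding banach_space_def
proof (intro conjI allI impI V)
  interpret V: vector_space "scl V" by (rule normed_vector_space[OF V])
  have BV: "b \<in> car V" if "b \<in> B" for b using that B V.span_base by blast
  obtain f where f: "\<And>b. b \<in> B \<Longrightarrow> f b \<in> car (dual V)"
    and fx: "\<And>x. x \<in> car V \<Longrightarrow> x = (\<Sum>b\<in>B. scl V (f b x) b)"
    using fin_dim_bounded_coordinates[OF V B] by blast
  fix s :: "nat \<Rightarrow> 'a"
  assume "(\<forall>k. s k \<in> car V) \<and> (\<forall>e>0. \<exists>N. \<forall>j\<ge>N. \<forall>k\<ge>N. nrm V (s j - s k) < e)"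
  then have s: "\<And>k. s k \<in> car V"
    and cau: "\<And>e. e > 0 \<Longrightarrow> \<exists>N. \<forall>j\<ge>N. \<forall>k\<ge>N. nrm V (s j - s k) < e" by auto
  have "\<exists>l. (\<lambda>k. f b (s k)) \<longlonglongrightarrow> l" if "b \<in> B" for b
  proof (rule Cauchy_real_or_complex_convergent)
    fix e :: real assume "e > 0"
    \<comment> \<open>The summand 1 keeps the divisor positive when \<open>f b\<close> is the zero
      functional.\<close>
    define M where "M = opnorm V scalars (f b) + 1"
    have M: "M \<ge> 1" using opnorm_nonneg[OF V normed_scalars] f[OF that] by (simp add: M_def in_dual_iff)
    obtain N where N: "\<And>j k. j \<ge> N \<Longrightarrow> k \<ge> N \<Longrightarrow> nrm V (s j - s k) < e / M"
      using cau[of "e / M"] M \<open>e > 0\<close> by auto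
    have "norm (f b (s j) - f b (s k)) < e" if jk: "j \<ge> N" "k \<ge> N" for j k
    proof -
      have c: "s j - s k \<in> car V" by (intro car_diff V s)
      have "norm (f b (s j) - f b (s k)) = norm (f b (s j - s k))"
        using lin_diff[OF dual_lin[OF f[OF \<open>b \<in> B\<close>]] V s s] by simp
      also have "\<dots> \<le> opnorm V scalars (f b) * nrm V (s j - s k)"
        by (rule dual_bound[OF f[OF \<open>b \<in> B\<close>] V c])
      also have "\<dots> \<le> M * nrm V (s j - s k)"
        by (intro mult_right_mono nrm_nonneg[OF V c]) (simp add: M_def)
      also have "\<dots> < e" using N[OF jk] M by (simp add: field_simps)
      finally show ?thesis .
    qed
    then show "\<exists>N. \<forall>j\<ge>N. \<forall>k\<ge>N. norm (f b (s j) - f b (s k)) < e" by blast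
  qed
  then obtain a where a: "\<And>b. b \<in> B \<Longrightarrow> (\<lambda>k. f b (s k)) \<longlonglongrightarrow> a b" by metis
  define l where "l = (\<Sum>b\<in>B. scl V (a b) b)"
  have l: "l \<in> car V" unfolding l_def using BV by (intro car_sum car_scale V)
  have bound: "nrm V (s k - l) \<le> (\<Sum>b\<in>B. norm (f b (s k) - a b) * nrm V b)" for k
  proof -
    have "s k - l = (\<Sum>b\<in>B. scl V (f b (s k) - a b) b)"
      by (subst fx[OF s]) (simp add: l_def V.scale_left_diff_distrib sum_subtractf)
    also have "nrm V \<dots> \<le> (\<Sum>b\<in>B. nrm V (scl V (f b (s k) - a b) b))"
      using BV by (intro nrm_sum V car_scale)
    finally show ?thesis using BV by (simp add: nrm_scale[OF V])
  qed
  have "(\<lambda>k. nrm V (s k - l)) \<longlonglongrightarrow> 0"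
  proof (rule tendsto_sandwich[OF _ _ tendsto_const])
    show "\<forall>\<^sub>F k in sequentially. 0 \<le> nrm V (s k - l)"
      using nrm_nonneg[OF V car_diff[OF V s l]] by simp
    show "\<forall>\<^sub>F k in sequentially. nrm V (s k - l) \<le> (\<Sum>b\<in>B. norm (f b (s k) - a b) * nrm V b)"
      using bound by simp
    have "(\<lambda>k. \<Sum>b\<in>B. norm (f b (s k) - a b) * nrm V b) \<longlonglongrightarrow> (\<Sum>b\<in>B. norm (a b - a b) * nrm V b)"
      using a by (intro tendsto_intros)
    then show "(\<lambda>k. \<Sum>b\<in>B. norm (f b (s k) - a b) * nrm V b) \<longlonglongrightarrow> 0" by simp
  qed
  then show "\<exists>l\<in>car V. (\<lambda>k. nrm V (s k - l)) \<longlonglongrightarrow> 0" using l by blast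
qed

lemma fin_dim_subspaceD:
  assumes "normed V" "fin_dim_subspace V E"
  shows "E \<subseteq> car V" "module.subspace (scl V) E" "normed (V\<lparr>car := E\<rparr>)" "banach_space (V\<lparr>car := E\<rparr>)"
proof -
  interpret V: vector_space "scl V" by (rule normed_vector_space[OF assms(1)])
  obtain B where B: "finite B" "E = V.span B" and E: "E \<subseteq> car V"
    using assms(2) by (auto simp: fin_dim_subspace_def)
  show "E \<subseteq> car V" "V.subspace E" using B E by simp_all
  then show "normed (V\<lparr>car := E\<rparr>)" using assms(1) by (intro normed_restrict_car)
  then show "banach_space (V\<lparr>car := E\<rparr>)" using B by (intro fin_dim_banach[of _ B]) simp_all
qed

lemma fin_dim_subspaceI:
  assumes "normed V" "finite B" "B \<subseteq> car V"
  shows "fin_dim_subspace V (module.span (scl V) B)"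
proof -
  interpret V: vector_space "scl V" by (rule normed_vector_space[OF assms(1)])
  show ?thesis
    using assms V.span_minimal[OF assms(3) normed_subspace_car[OF assms(1)]]
    by (auto simp: fin_dim_subspace_def)
qed

text \<open>Coordinate functionals of \<open>E\<close>, extended to the whole space by Hahn-Banach.
  Such projections extend multilinear forms from subspaces, which gives injectivity of the inclusion
  of tensor products.\<close>

lemma fin_dim_projection:
  fixes V :: "('k::real_or_complex, 'a::ab_group_add) nspace"
  assumes V: "normed V" and E: "fin_dim_subspace V E"
  obtains P where "lin V (V\<lparr>car := E\<rparr>) P" "\<And>x. x \<in> E \<Longrightarrow> P x = x"
proof -
  interpret V: vector_space "scl V" by (rule normed_vector_space[OF V])
  note EV = fin_dim_subspaceD[OF V E]
  obtain B where B: "finite B" "E = V.span B" using E by (auto simp: fin_dim_subspace_def)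
  have "\<exists>f. (\<forall>b\<in>B. f b \<in> car (dual (V\<lparr>car := E\<rparr>))) \<and> (\<forall>x\<in>E. x = (\<Sum>b\<in>B. scl V (f b x) b))"
    using fin_dim_bounded_coordinates[OF EV(3), of B] B by simp metis
  then obtain f where f: "\<And>b. b \<in> B \<Longrightarrow> f b \<in> car (dual (V\<lparr>car := E\<rparr>))"
    and fx: "\<And>x. x \<in> E \<Longrightarrow> x = (\<Sum>b\<in>B. scl V (f b x) b)" by blast
  have "\<exists>g. lin V scalars g \<and> (\<forall>x\<in>E. g x = f b x)" if "b \<in> B" for b
  proof -
    note fb = f[OF that]
    have "norm (f b x) \<le> opnorm (V\<lparr>car := E\<rparr>) scalars (f b) * nrm V x" if "x \<in> E" for x
      using dual_bound[OF fb EV(3)] that by simp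
    moreover have "0 \<le> opnorm (V\<lparr>car := E\<rparr>) scalars (f b)"
      using fb by (intro opnorm_nonneg EV normed_scalars) (simp add: in_dual_iff)
    ultimately show ?thesis using hahn_banach[OF V EV(1,2) dual_lin[OF fb]] by metis
  qed
  then obtain g where g: "\<And>b. b \<in> B \<Longrightarrow> lin V scalars (g b)" "\<And>b x. b \<in> B \<Longrightarrow> x \<in> E \<Longrightarrow> g b x = f b x"
    by metis
  define P where "P x = (\<Sum>b\<in>B. scl V (g b x) b)" for x
  have "P x \<in> E" for x unfolding P_def B by (intro V.span_sum V.span_scale V.span_base)
  moreover have "P (x + y) = P x + P y" if "x \<in> car V" "y \<in> car V" for x y
    using lin_add[OF g(1) that] by (simp add: P_def V.scale_left_distrib sum.distrib)
  moreover have "P (scl V c x) = scl V c (P x)" if "x \<in> car V" for c x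
    using lin_scale[OF g(1) that] by (simp add: P_def V.scale_sum_right)
  ultimately have "lin V (V\<lparr>car := E\<rparr>) P" by (simp add: lin_def)
  moreover have "P x = x" if "x \<in> E" for x
    using fx[OF that] g(2) that by (simp add: P_def)
  ultimately show ?thesis using that by blast
qed

section \<open>Tensor products\<close>

text \<open>Coefficients are absorbed into the summands; elementary tensors are closed under
  scaling, so every tensor is a plain sum of them.\<close>

lemma (in vector_space) span_eq_sums:
  assumes "\<And>c x. x \<in> S \<Longrightarrow> scale c x \<in> S" "u \<in> span S"
  obtains m :: nat and h where "\<And>j. j < m \<Longrightarrow> h j \<in> S" "u = (\<Sum>j<m. h j)"
proof -
  have "\<exists>(m::nat) h. (\<forall>j<m. h j \<in> S) \<and> u = (\<Sum>j<m. h j)"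
    using assms(2)
  proof (induction rule: span_induct_alt)
    case base
    then show ?case by (intro exI[of _ 0]) simp
  next
    case (step c x y)
    then obtain m :: nat and h where h: "\<forall>j<m. h j \<in> S" "y = (\<Sum>j<m. h j)" by blast
    have "(\<Sum>j<m. (h(m := scale c x)) j) = (\<Sum>j<m. h j)" by (intro sum.cong) auto
    then have "scale c x + y = (\<Sum>j<Suc m. (h(m := scale c x)) j)" using h by (simp add: add.commute)
    moreover have "\<forall>j<Suc m. (h(m := scale c x)) j \<in> S"
      using h assms(1)[OF step.hyps(1)] by (auto simp: less_Suc_eq)
    ultimately show ?case by blast
  qed
  then show ?thesis using that by blast
qed

text \<open>\<open>bforms\<close> without the demand that the form vanish off the carriers. Natural
  expressions, such as products of functionals, need not vanish there; \<open>tapply\<close>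
  performs the cut-off.\<close>

definition bilinear_on :: "('k::real_or_complex, 'a::ab_group_add) nspace \<Rightarrow>
    ('k, 'b::ab_group_add) nspace \<Rightarrow> ('a \<Rightarrow> 'b \<Rightarrow> 'k) \<Rightarrow> bool" where
  "bilinear_on V W b \<longleftrightarrow>
     (\<forall>y\<in>car W. lin V scalars (\<lambda>x. b x y)) \<and> (\<forall>x\<in>car V. lin W scalars (b x))"

lemma bilinear_onI:
  assumes "\<And>x x' y. x \<in> car V \<Longrightarrow> x' \<in> car V \<Longrightarrow> y \<in> car W \<Longrightarrow> b (x + x') y = b x y + b x' y"
    and "\<And>c x y. x \<in> car V \<Longrightarrow> y \<in> car W \<Longrightarrow> b (scl V c x) y = c * b x y"
    and "\<And>x y y'. x \<in> car V \<Longrightarrow> y \<in> car W \<Longrightarrow> y' \<in> car W \<Longrightarrow> b x (y + y') = b x y + b x y'"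
    and "\<And>c x y. x \<in> car V \<Longrightarrow> y \<in> car W \<Longrightarrow> b x (scl W c y) = c * b x y"
  shows "bilinear_on V W b"
  using assms by (auto simp: bilinear_on_def lin_scalars_iff)

lemma bilinear_on_mult: "lin V scalars f \<Longrightarrow> lin W scalars g \<Longrightarrow> bilinear_on V W (\<lambda>x y. f x * g y)"
  by (auto simp: bilinear_on_def lin_scalars_iff algebra_simps)

lemma bilinear_on_compose:
  "bilinear_on V' W' b \<Longrightarrow> lin V V' B \<Longrightarrow> lin W W' C \<Longrightarrow> bilinear_on V W (\<lambda>x y. b (B x) (C y))"
  by (auto simp: bilinear_on_def lin_def)

lemma bforms_bilinear_on: "b \<in> bforms V W \<Longrightarrow> bilinear_on V W b"
  by (simp add: bforms_def bilinear_on_def)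

lemma bilinear_on_extend:
  assumes "normed V" "normed W" "bilinear_on V W b"
  shows "(\<lambda>x y. if x \<in> car V \<and> y \<in> car W then b x y else 0) \<in> bforms V W"
  using assms(3) car_add[OF assms(1)] car_scale[OF assms(1)] car_add[OF assms(2)] car_scale[OF assms(2)]
  by (auto simp: bforms_def bilinear_on_def lin_def)

text \<open>A tensor is just a function on functions of two variables. That it is linear on bilinear
  forms and 0 elsewhere holds for elementary tensors and is inherited by their span.\<close>

lemma tensors2_linear:
  assumes "v \<in> tensors2 V W"
  shows "\<And>b c. b \<in> bforms V W \<Longrightarrow> c \<in> bforms V W \<Longrightarrow> v (\<lambda>x y. b x y + c x y) = v b + v c"
    and "\<And>b k. b \<in> bforms V W \<Longrightarrow> v (\<lambda>x y. k * b x y) = k * v b"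
    and "\<And>b. b \<notin> bforms V W \<Longrightarrow> v b = 0"
proof -
  have add: "(\<lambda>x y. b x y + c x y) \<in> bforms V W" if "b \<in> bforms V W" "c \<in> bforms V W" for b c
    using that by (auto simp: bforms_def lin_scalars_iff algebra_simps)
  have scale: "(\<lambda>x y. k * b x y) \<in> bforms V W" if "b \<in> bforms V W" for b k
    using that by (auto simp: bforms_def lin_scalars_iff algebra_simps)
  let ?P = "\<lambda>v. (\<forall>b\<in>bforms V W. \<forall>c\<in>bforms V W. v (\<lambda>x y. b x y + c x y) = v b + v c) \<and>
    (\<forall>b\<in>bforms V W. \<forall>k. v (\<lambda>x y. k * b x y) = k * v b) \<and> (\<forall>b. b \<notin> bforms V W \<longrightarrow> v b = 0)"
  have "?P v"
    using assms unfolding tensors2_def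
  proof (induction rule: pscale.span_induct_alt)
    case base
    then show ?case by simp
  next
    case (step c x y)
    obtain x1 x2 where x: "x = tprod2 V W x1 x2" using step.hyps by blast
    have "?P x" using add scale by (auto simp: x tprod2_def)
    then show ?case using step.IH by (auto simp: pscale_def algebra_simps)
  qed
  then show "\<And>b c. b \<in> bforms V W \<Longrightarrow> c \<in> bforms V W \<Longrightarrow> v (\<lambda>x y. b x y + c x y) = v b + v c"
    "\<And>b k. b \<in> bforms V W \<Longrightarrow> v (\<lambda>x y. k * b x y) = k * v b"
    "\<And>b. b \<notin> bforms V W \<Longrightarrow> v b = 0" by blast+
qed

lemma tapply_add_left: "tapply V W (u + v) b = tapply V W u b + tapply V W v b"
  and tapply_pscale_left: "tapply V W (pscale c u) b = c * tapply V W u b"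
  by (simp_all add: tapply_def pscale_def)

lemma tapply_cong:
  "(\<And>x y. x \<in> car V \<Longrightarrow> y \<in> car W \<Longrightarrow> b x y = c x y) \<Longrightarrow> tapply V W v b = tapply V W v c"
  unfolding tapply_def by (intro arg_cong[where f = v] ext) auto

lemma tapply_add_right:
  assumes "normed V" "normed W" "v \<in> tensors2 V W" "bilinear_on V W b" "bilinear_on V W c"
  shows "tapply V W v (\<lambda>x y. b x y + c x y) = tapply V W v b + tapply V W v c"
proof -
  have "(\<lambda>x y. if x \<in> car V \<and> y \<in> car W then b x y + c x y else 0) =
    (\<lambda>x y. (if x \<in> car V \<and> y \<in> car W then b x y else 0) + (if x \<in> car V \<and> y \<in> car W then c x y else 0))"
    by (intro ext) auto
  then show ?thesis
    unfolding tapply_def using tensors2_linear(1)[OF assms(3)] bilinear_on_extend[OF assms(1,2)] assms(4,5)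
    by simp
qed

lemma tapply_scale_right:
  assumes "normed V" "normed W" "v \<in> tensors2 V W" "bilinear_on V W b"
  shows "tapply V W v (\<lambda>x y. k * b x y) = k * tapply V W v b"
proof -
  have "(\<lambda>x y. if x \<in> car V \<and> y \<in> car W then k * b x y else 0) =
    (\<lambda>x y. k * (if x \<in> car V \<and> y \<in> car W then b x y else 0))"
    by (intro ext) auto
  then show ?thesis
    unfolding tapply_def using tensors2_linear(2)[OF assms(3)] bilinear_on_extend[OF assms(1,2,4)]
    by simp
qed

lemma tapply_tprod2_bilinear:
  assumes "bilinear_on V W b" "normed V" "normed W" "x \<in> car V" "y \<in> car W"
  shows "tapply V W (tprod2 V W x y) b = b x y"
  using assms by (intro tapply_tprod2) (auto simp: bilinear_on_def)

lemma tprod2_add_left: "x \<in> car V \<Longrightarrow> x' \<in> car V \<Longrightarrow> y \<in> car W \<Longrightarrow>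
    tprod2 V W (x + x') y = tprod2 V W x y + tprod2 V W x' y"
  and tprod2_scale_left: "x \<in> car V \<Longrightarrow> y \<in> car W \<Longrightarrow> tprod2 V W (scl V c x) y = pscale c (tprod2 V W x y)"
  and tprod2_add_right: "x \<in> car V \<Longrightarrow> y \<in> car W \<Longrightarrow> y' \<in> car W \<Longrightarrow>
    tprod2 V W x (y + y') = tprod2 V W x y + tprod2 V W x y'"
  and tprod2_scale_right: "x \<in> car V \<Longrightarrow> y \<in> car W \<Longrightarrow> tprod2 V W x (scl W c y) = pscale c (tprod2 V W x y)"
  by (auto simp: tprod2_def pscale_def fun_eq_iff bforms_def lin_scalars_iff)

lemma tprod2_sum_left:
  assumes "normed V" "\<And>i. i \<in> A \<Longrightarrow> h i \<in> car V" "y \<in> car W"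
  shows "tprod2 V W (sum h A) y = (\<Sum>i\<in>A. tprod2 V W (h i) y)"
proof -
  have "tprod2 V W 0 y = 0"
    using tprod2_add_left[of 0 V 0 y W] car_0[OF assms(1)] assms(3) by simp
  then show ?thesis
    using assms(2)
    by (induction A rule: infinite_finite_induct)
       (simp_all add: tprod2_add_left[OF _ car_sum[OF assms(1)] assms(3)])
qed

lemma tprod2_sum_right:
  assumes "normed W" "\<And>i. i \<in> A \<Longrightarrow> h i \<in> car W" "x \<in> car V"
  shows "tprod2 V W x (sum h A) = (\<Sum>i\<in>A. tprod2 V W x (h i))"
proof -
  have "tprod2 V W x 0 = 0"
    using tprod2_add_right[of x V 0 W 0] car_0[OF assms(1)] assms(3) by simp
  then show ?thesis
    using assms(2)
    by (induction A rule: infinite_finite_induct)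
       (simp_all add: tprod2_add_right[OF assms(3) _ car_sum[OF assms(1)]])
qed

lemma tprod2_in_tensors2: "x \<in> car V \<Longrightarrow> y \<in> car W \<Longrightarrow> tprod2 V W x y \<in> tensors2 V W"
  unfolding tensors2_def by (intro pscale.span_base) blast

lemma tmap_add: "tmap V W V' W' B C (u + v) = tmap V W V' W' B C u + tmap V W V' W' B C v"
  and tmap_pscale: "tmap V W V' W' B C (pscale c u) = pscale c (tmap V W V' W' B C u)"
  and tmap_0: "tmap V W V' W' B C 0 = 0"
  by (auto simp: tmap_def fun_eq_iff tapply_def pscale_def)

lemma tmap_sum: "tmap V W V' W' B C (sum h A) = (\<Sum>i\<in>A. tmap V W V' W' B C (h i))"
  using sum_comp_morphism[of "tmap V W V' W' B C" h A] by (simp add: tmap_0 tmap_add o_def)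

lemma tmap_in_tensors2:
  assumes "lin V V' B" "lin W W' C" "normed V" "normed W" "v \<in> tensors2 V W"
  shows "tmap V W V' W' B C v \<in> tensors2 V' W'"
  using assms(5) unfolding tensors2_def[of V W]
proof (induction rule: pscale.span_induct_alt)
  case base
  have "tmap V W V' W' B C 0 \<in> tensors2 V' W'" by (simp add: tmap_0 tensors2_def pscale.span_zero)
  then show ?case .
next
  case (step c x y)
  obtain a b where "x = tprod2 V W a b" "a \<in> car V" "b \<in> car W" using step.hyps by blast
  then have "tmap V W V' W' B C x \<in> tensors2 V' W'"
    using assms by (simp add: tmap_tprod2 tprod2_in_tensors2 lin_car)
  moreover have "tmap V W V' W' B C y \<in> tensors2 V' W'" using step.IH .
  ultimately have "tmap V W V' W' B C (pscale c x + y) \<in> tensors2 V' W'"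
    by (simp add: tmap_add tmap_pscale tensors2_def pscale.span_add pscale.span_scale)
  then show ?case .
qed

text \<open>The adjointness that moves a pair of maps from the tensor to the form; compatibility of
  the pairing with restriction rests on it.\<close>

lemma tapply_tmap:
  assumes "normed V'" "normed W'" "bilinear_on V' W' b" "lin V V' B" "lin W W' C"
  shows "tapply V' W' (tmap V W V' W' B C v) b = tapply V W v (\<lambda>x y. b (B x) (C y))"
  using bilinear_on_extend[OF assms(1-3)] assms(4,5)
  by (auto simp: tapply_def[of V' W'] tmap_def lin_car intro!: tapply_cong)

lemma tmap_compose:
  assumes "normed V'" "normed W'" "lin V V' B" "lin W W' C" "lin V' V'' B'" "lin W' W'' C'"
  shows "tmap V' W' V'' W'' B' C' (tmap V W V' W' B C v) = tmap V W V'' W'' (\<lambda>x. B' (B x)) (\<lambda>x. C' (C x)) v"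
proof
  fix b
  show "tmap V' W' V'' W'' B' C' (tmap V W V' W' B C v) b = tmap V W V'' W'' (\<lambda>x. B' (B x)) (\<lambda>x. C' (C x)) v b"
  proof (cases "b \<in> bforms V'' W''")
    case True
    have "bilinear_on V' W' (\<lambda>x y. b (B' x) (C' y))"
      using bilinear_on_compose[OF bforms_bilinear_on[OF True] assms(5,6)] .
    then show ?thesis using tapply_tmap[OF assms(1,2) _ assms(3,4)] True by (simp add: tmap_def[of V' W'] tmap_def[of V W V'' W''])
  qed (simp add: tmap_def)
qed

lemma tmap_cong:
  assumes "\<And>x. x \<in> car V \<Longrightarrow> B x = B' x" "\<And>y. y \<in> car W \<Longrightarrow> C y = C' y"
  shows "tmap V W V' W' B C v = tmap V W V' W' B' C' v"
  unfolding tmap_def by (intro ext if_cong refl tapply_cong) (simp add: assms)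

section \<open>Multilinear forms, their linearizations and elementary tensors\<close>

lemma tensor_space_simps [simp]:
  "car (tensor_space n X \<beta>) = tensors n X" "scl (tensor_space n X \<beta>) = pscale" "nrm (tensor_space n X \<beta>) = \<beta>"
  by (simp_all add: tensor_space_def)

lemma nu_space_simps [simp]:
  "car (nu_space \<nu> n X Y \<beta>) = tensors2 (Lspace n X \<beta>) Y" "scl (nu_space \<nu> n X Y \<beta>) = pscale"
  "nrm (nu_space \<nu> n X Y \<beta>) = \<nu> n X Y \<beta>"
  by (simp_all add: nu_space_def tensor2_space_def)

lemma alpha_space_simps [simp]:
  "car (alpha_space \<nu> n X \<beta> G) = tensors2 (tensor_space n X \<beta>) G" "scl (alpha_space \<nu> n X \<beta> G) = pscale"
  "nrm (alpha_space \<nu> n X \<beta> G) = alpha \<nu> n X \<beta> G"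
  by (simp_all add: alpha_space_def tensor2_space_def)

lemma subs_simps [simp]:
  "car (subs X E i) = E i" "scl (subs X E i) = scl (X i)" "nrm (subs X E i) = nrm (X i)"
  by (simp_all add: subs_def)

lemma Lspace_simps [simp]:
  "scl (Lspace n X \<beta>) = pscale"
  "nrm (Lspace n X \<beta>) \<phi> = opnorm (tensor_space n X \<beta>) scalars (linearization n X \<phi>)"
  by (simp_all add: Lspace_def)

lemma in_Lspace_iff: "\<phi> \<in> car (Lspace n X \<beta>) \<longleftrightarrow>
    \<phi> \<in> mforms n X \<and> linearization n X \<phi> \<in> car (dual (tensor_space n X \<beta>))"
  by (simp add: Lspace_def)

lemma tprod_in_tensors: "x \<in> families n X \<Longrightarrow> tprod n X x \<in> tensors n X"
  by (auto simp: tensors_def Sigma_set_def intro: pscale.span_base)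

lemma mforms_closed:
  shows "\<phi> \<in> mforms n X \<Longrightarrow> \<psi> \<in> mforms n X \<Longrightarrow> \<phi> + \<psi> \<in> mforms n X"
    and "\<phi> \<in> mforms n X \<Longrightarrow> pscale c \<phi> \<in> mforms n X"
  by (auto simp: mforms_def pscale_def algebra_simps)

lemma zero_in_mforms: "0 \<in> mforms n X"
  by (simp add: mforms_def)

lemma tensors_linear:
  assumes "u \<in> tensors n X"
  shows "\<And>\<phi> \<psi>. \<phi> \<in> mforms n X \<Longrightarrow> \<psi> \<in> mforms n X \<Longrightarrow> u (\<phi> + \<psi>) = u \<phi> + u \<psi>"
    and "\<And>\<phi> c. \<phi> \<in> mforms n X \<Longrightarrow> u (pscale c \<phi>) = c * u \<phi>"
    and "\<And>\<phi>. \<phi> \<notin> mforms n X \<Longrightarrow> u \<phi> = 0"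
proof -
  let ?P = "\<lambda>u. (\<forall>\<phi>\<in>mforms n X. \<forall>\<psi>\<in>mforms n X. u (\<phi> + \<psi>) = u \<phi> + u \<psi>) \<and>
    (\<forall>\<phi>\<in>mforms n X. \<forall>c. u (pscale c \<phi>) = c * u \<phi>) \<and> (\<forall>\<phi>. \<phi> \<notin> mforms n X \<longrightarrow> u \<phi> = 0)"
  have "?P u"
    using assms unfolding tensors_def
  proof (induction rule: pscale.span_induct_alt)
    case base
    then show ?case by simp
  next
    case (step c x y)
    obtain z where x: "x = tprod n X z" using step.hyps by (auto simp: Sigma_set_def)
    have "?P x" using mforms_closed[of _ n X] by (simp add: x tprod_def pscale_apply)
    moreover have "?P y" using step.IH .
    ultimately have "?P (pscale c x + y)" by (simp add: pscale_apply algebra_simps)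
    then show ?case .
  qed
  then show "\<And>\<phi> \<psi>. \<phi> \<in> mforms n X \<Longrightarrow> \<psi> \<in> mforms n X \<Longrightarrow> u (\<phi> + \<psi>) = u \<phi> + u \<psi>"
    "\<And>\<phi> c. \<phi> \<in> mforms n X \<Longrightarrow> u (pscale c \<phi>) = c * u \<phi>"
    "\<And>\<phi>. \<phi> \<notin> mforms n X \<Longrightarrow> u \<phi> = 0" by blast+
qed

lemma lin_linearization: "lin (tensor_space n X \<beta>) scalars (linearization n X \<phi>)"
  by (simp add: lin_scalars_iff linearization_def tensors_def pscale.span_add pscale.span_scale pscale_apply)

lemma linearization_tprod: "x \<in> families n X \<Longrightarrow> \<phi> \<in> mforms n X \<Longrightarrow> linearization n X \<phi> (tprod n X x) = \<phi> x"
  by (simp add: linearization_def tprod_in_tensors) (simp add: tprod_def)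

lemma linearization_linear:
  shows "\<phi> \<in> mforms n X \<Longrightarrow> \<psi> \<in> mforms n X \<Longrightarrow>
      linearization n X (\<phi> + \<psi>) = linearization n X \<phi> + linearization n X \<psi>"
    and "\<phi> \<in> mforms n X \<Longrightarrow> linearization n X (pscale c \<phi>) = pscale c (linearization n X \<phi>)"
  by (simp_all add: linearization_def fun_eq_iff tensors_linear pscale_apply)

lemma in_LspaceI:
  assumes "\<phi> \<in> mforms n X" "\<And>u. u \<in> tensors n X \<Longrightarrow> norm (u \<phi>) \<le> C * \<beta> u"
  shows "\<phi> \<in> car (Lspace n X \<beta>)"
proof -
  have "bounded_op (tensor_space n X \<beta>) scalars (linearization n X \<phi>)"
    by (rule bounded_opI[OF lin_linearization, where C = C]) (simp add: assms(2) linearization_def)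
  then show ?thesis using assms(1) by (simp add: in_Lspace_iff in_dual_iff linearization_def)
qed

lemma normed_Lspace:
  fixes X :: "nat \<Rightarrow> ('k::real_or_complex, 'a::ab_group_add) nspace"
  assumes T: "normed (tensor_space n X \<beta>)"
  shows "normed (Lspace n X \<beta>)"
proof (rule normed_pullback)
  note D = normed_dual[OF T]
  show "vector_space (scl (Lspace n X \<beta>))" using vector_space_pscale by simp
  have "pscale.subspace (car (Lspace n X \<beta>))"
  proof (rule pscale.subspaceI)
    have "linearization n X 0 = 0"
      using linearization_linear(2)[of 0 n X 0] by (simp add: zero_in_mforms)
    then show "0 \<in> car (Lspace n X \<beta>)"
      using car_0[OF D] by (simp add: in_Lspace_iff zero_in_mforms)
    show "\<phi> + \<psi> \<in> car (Lspace n X \<beta>)" if "\<phi> \<in> car (Lspace n X \<beta>)" "\<psi> \<in> car (Lspace n X \<beta>)" for \<phi> \<psi>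
      using that car_add[OF D] by (simp add: in_Lspace_iff linearization_linear mforms_closed)
    show "pscale c \<phi> \<in> car (Lspace n X \<beta>)" if "\<phi> \<in> car (Lspace n X \<beta>)" for c \<phi>
      using that car_scale[OF D, of _ c] by (simp add: in_Lspace_iff linearization_linear mforms_closed)
  qed
  then show "module.subspace (scl (Lspace n X \<beta>)) (car (Lspace n X \<beta>))" by simp
  show "normed (dual (tensor_space n X \<beta>))" by (rule D)
  show "lin (Lspace n X \<beta>) (dual (tensor_space n X \<beta>)) (linearization n X)"
    by (simp add: lin_def in_Lspace_iff linearization_linear)
  show "inj_on (linearization n X) (car (Lspace n X \<beta>))"
  proof (rule inj_onI)
    fix \<phi> \<psi> assume "\<phi> \<in> car (Lspace n X \<beta>)" "\<psi> \<in> car (Lspace n X \<beta>)"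
      and eq: "linearization n X \<phi> = linearization n X \<psi>"
    then have m: "\<phi> \<in> mforms n X" "\<psi> \<in> mforms n X" by (simp_all add: in_Lspace_iff)
    show "\<phi> = \<psi>"
    proof
      fix x
      show "\<phi> x = \<psi> x"
      proof (cases "x \<in> families n X")
        case True
        show ?thesis using linearization_tprod[OF True m(1)] linearization_tprod[OF True m(2)] eq by simp
      next
        case False
        then show ?thesis using m by (simp add: mforms_def)
      qed
    qed
  qed
qed simp

lemma families_upd: "x \<in> families n X \<Longrightarrow> i < n \<Longrightarrow> a \<in> car (X i) \<Longrightarrow> x(i := a) \<in> families n X"
  by (auto simp: families_def PiE_iff extensional_def)

lemma families_component: "x \<in> families n X \<Longrightarrow> i < n \<Longrightarrow> x i \<in> car (X i)"
  by (auto simp: families_def)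

lemma mforms_add: "\<phi> \<in> mforms n X \<Longrightarrow> x \<in> families n X \<Longrightarrow> i < n \<Longrightarrow> a \<in> car (X i) \<Longrightarrow> b \<in> car (X i) \<Longrightarrow>
    \<phi> (x(i := a + b)) = \<phi> (x(i := a)) + \<phi> (x(i := b))"
  and mforms_scale: "\<phi> \<in> mforms n X \<Longrightarrow> x \<in> families n X \<Longrightarrow> i < n \<Longrightarrow> a \<in> car (X i) \<Longrightarrow>
    \<phi> (x(i := scl (X i) c a)) = c * \<phi> (x(i := a))"
  and mforms_off: "\<phi> \<in> mforms n X \<Longrightarrow> x \<notin> families n X \<Longrightarrow> \<phi> x = 0"
  by (auto simp: mforms_def)

lemma mforms_component_zero:
  assumes "\<phi> \<in> mforms n X" "x \<in> families n X" "i < n" "normed (X i)" "x i = 0"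
  shows "\<phi> x = 0"
  using mforms_add[OF assms(1-3) car_0[OF assms(4)] car_0[OF assms(4)]] assms(5) fun_upd_triv[of x i] by simp

text \<open>The scalar is absorbed by the first factor, hence \<open>1 \<le> n\<close>.\<close>

lemma Sigma_set_scale:
  assumes "1 \<le> n" "normed (X 0)" "p \<in> Sigma_set n X"
  shows "pscale c p \<in> Sigma_set n X"
proof -
  obtain x where x: "x \<in> families n X" "p = tprod n X x" using assms(3) by (auto simp: Sigma_set_def)
  have x0: "x 0 \<in> car (X 0)" using families_component[OF x(1), of 0] assms(1) by simp
  define y where "y = x(0 := scl (X 0) c (x 0))"
  have "y \<in> families n X"
    unfolding y_def using families_upd[OF x(1), of 0] assms(1) car_scale[OF assms(2) x0] by simp
  moreover have "pscale c p = tprod n X y"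
    using mforms_scale[OF _ x(1), of _ 0 "x 0" c] assms(1) x0
    by (auto simp: x(2) y_def pscale_def tprod_def fun_eq_iff)
  ultimately show ?thesis by (auto simp: Sigma_set_def)
qed

lemma tensors_eq_sums:
  assumes "1 \<le> n" "normed (X 0)" "u \<in> tensors n X"
  obtains m :: nat and x where "\<And>j. j < m \<Longrightarrow> x j \<in> families n X" "u = (\<Sum>j<m. tprod n X (x j))"
proof -
  have "pscale c p \<in> Sigma_set n X" if "p \<in> Sigma_set n X" for c p
    using assms(1,2) that by (rule Sigma_set_scale)
  then obtain m :: nat and h where h: "\<And>j. j < m \<Longrightarrow> h j \<in> Sigma_set n X" "u = (\<Sum>j<m. h j)"
    using pscale.span_eq_sums[of "Sigma_set n X" u] assms(3) unfolding tensors_def by blast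
  have "\<forall>j. \<exists>x. j < m \<longrightarrow> x \<in> families n X \<and> h j = tprod n X x"
    using h(1) by (auto simp: Sigma_set_def)
  then obtain x where "\<And>j. j < m \<Longrightarrow> x j \<in> families n X \<and> h j = tprod n X (x j)" by metis
  then show ?thesis using that[of m x] h(2) by simp
qed

text \<open>Allows q = 0 in (D2), which turns a bound on differences of evaluations into one on a
  single evaluation.\<close>

lemma zero_in_Sigma_set:
  assumes "1 \<le> n" "\<And>i. i < n \<Longrightarrow> normed (X i)"
  shows "0 \<in> Sigma_set n X"
proof -
  define x where "x = (\<lambda>i\<in>{..<n}. 0 :: 'b)"
  have x: "x \<in> families n X" using car_0[OF assms(2)] by (auto simp: x_def families_def)
  have "tprod n X x = 0"
    using mforms_component_zero[OF _ x, of _ 0] assms by (auto simp: tprod_def x_def fun_eq_iff)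
  then show ?thesis using x by (force simp: Sigma_set_def)
qed

text \<open>Both levels of the nested tensor product are resolved at once; the coefficients are
  absorbed by the factor in \<open>G\<close>.\<close>

lemma tensors2_tensor_space_eq_sums:
  assumes "normed (tensor_space n X \<beta>)" "normed G" "u \<in> tensors2 (tensor_space n X \<beta>) G"
  obtains m :: nat and x g where "\<And>j. j < m \<Longrightarrow> x j \<in> families n X" "\<And>j. j < m \<Longrightarrow> g j \<in> car G"
    "u = (\<Sum>j<m. tprod2 (tensor_space n X \<beta>) G (tprod n X (x j)) (g j))"
proof -
  let ?T = "tensor_space n X \<beta>"
  define S where "S = {tprod2 ?T G (tprod n X x) g | x g. x \<in> families n X \<and> g \<in> car G}"
  have S_scale: "pscale c s \<in> S" if sS: "s \<in> S" for c s
  proof -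
    obtain x g where s: "s = tprod2 ?T G (tprod n X x) g" "x \<in> families n X" "g \<in> car G"
      using sS unfolding S_def by blast
    then have "pscale c s = tprod2 ?T G (tprod n X x) (scl G c g)"
      by (simp add: tprod2_scale_right tprod_in_tensors)
    then show ?thesis using s car_scale[OF assms(2)] by (auto simp: S_def)
  qed
  have el: "tprod2 ?T G z g \<in> pscale.span S" if g: "g \<in> car G" and z: "z \<in> tensors n X" for z g
  proof -
    have "z \<in> tensors n X \<and> tprod2 ?T G z g \<in> pscale.span S" using z unfolding tensors_def
    proof (induction rule: pscale.span_induct_alt)
      case base
      have "tprod2 ?T G 0 g = 0" using tprod2_sum_left[OF assms(1), of "{}" _ g G] g by simp
      then have "0 \<in> pscale.span (Sigma_set n X) \<and> tprod2 ?T G 0 g \<in> pscale.span S"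
        by (simp add: pscale.span_zero)
      then show ?case .
    next
      case (step c x y)
      then have x: "x \<in> tensors n X" and y: "y \<in> tensors n X" and yS: "tprod2 ?T G y g \<in> pscale.span S"
        by (simp_all add: tensors_def pscale.span_base)
      have "tprod2 ?T G (pscale c x + y) g = pscale c (tprod2 ?T G x g) + tprod2 ?T G y g"
        using tprod2_add_left[of "pscale c x" ?T y g G] tprod2_scale_left[of x ?T g G c] x y g
          pscale.span_scale[of x "Sigma_set n X" c] by (simp add: tensors_def)
      moreover have "tprod2 ?T G x g \<in> S" using step.hyps g by (auto simp: S_def Sigma_set_def)
      ultimately have "pscale c x + y \<in> pscale.span (Sigma_set n X) \<and>
          tprod2 ?T G (pscale c x + y) g \<in> pscale.span S"
        using yS x y by (simp add: pscale.span_add pscale.span_scale pscale.span_base tensors_def)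
      then show ?case .
    qed
    then show ?thesis by blast
  qed
  have "{tprod2 ?T G z g | z g. z \<in> car ?T \<and> g \<in> car G} \<subseteq> pscale.span S" using el by auto
  then have "u \<in> pscale.span S"
    using pscale.span_minimal[OF _ pscale.subspace_span] assms(3) unfolding tensors2_def by blast
  then obtain m :: nat and h where h: "\<And>j. j < m \<Longrightarrow> h j \<in> S" "u = (\<Sum>j<m. h j)"
    using pscale.span_eq_sums[of S u] S_scale by blast
  have "\<forall>j. \<exists>x g. j < m \<longrightarrow> x \<in> families n X \<and> g \<in> car G \<and> h j = tprod2 ?T G (tprod n X x) g"
    using h(1) unfolding S_def by blast
  then obtain x g where "\<And>j. j < m \<Longrightarrow> x j \<in> families n X \<and> g j \<in> car G \<and> h j = tprod2 ?T G (tprod n X (x j)) (g j)"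
    by metis
  then show ?thesis using that[of m x g] h(2) by simp
qed

section \<open>Restriction to finite dimensional subspaces\<close>

text \<open>These are the forms over which the injective norm takes its supremum.\<close>

lemma prod_form_in_mforms:
  assumes "\<And>i. i < n \<Longrightarrow> lin (X i) scalars (f i)" "\<And>i. i < n \<Longrightarrow> normed (X i)"
  shows "(\<lambda>x. if x \<in> families n X then \<Prod>i<n. f i (x i) else 0) \<in> mforms n X"
proof -
  have upd: "(\<Prod>k<n. f k ((x(i := a)) k)) = f i a * (\<Prod>k\<in>{..<n} - {i}. f k (x k))" if "i < n" for x i a
  proof -
    have "(\<Prod>k<n. f k ((x(i := a)) k)) = f i a * (\<Prod>k\<in>{..<n} - {i}. f k ((x(i := a)) k))"
      using that by (subst prod.remove[of _ i]) auto
    also have "(\<Prod>k\<in>{..<n} - {i}. f k ((x(i := a)) k)) = (\<Prod>k\<in>{..<n} - {i}. f k (x k))"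
      by (intro prod.cong) auto
    finally show ?thesis .
  qed
  show ?thesis
    unfolding mforms_def
  proof (intro CollectI conjI allI impI ballI)
    fix x i a b assume x: "x \<in> families n X" and i: "i < n" and a: "a \<in> car (X i)" and b: "b \<in> car (X i)"
    show "(if x(i := a + b) \<in> families n X then \<Prod>k<n. f k ((x(i := a + b)) k) else 0) =
      (if x(i := a) \<in> families n X then \<Prod>k<n. f k ((x(i := a)) k) else 0) +
      (if x(i := b) \<in> families n X then \<Prod>k<n. f k ((x(i := b)) k) else 0)"
      using families_upd[OF x i] a b car_add[OF assms(2)[OF i] a b] lin_add[OF assms(1)[OF i] a b]
      by (simp only: upd[OF i] if_True) (simp add: distrib_right)
  next
    fix x i c a assume x: "x \<in> families n X" and i: "i < n" and a: "a \<in> car (X i)"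
    show "(if x(i := scl (X i) c a) \<in> families n X then \<Prod>k<n. f k ((x(i := scl (X i) c a)) k) else 0) =
      c * (if x(i := a) \<in> families n X then \<Prod>k<n. f k ((x(i := a)) k) else 0)"
      using families_upd[OF x i] a car_scale[OF assms(2)[OF i] a] lin_scale[OF assms(1)[OF i] a]
      by (simp only: upd[OF i] if_True) simp
  qed simp
qed

lemma mforms_zero_if_zero_on_spanning:
  assumes \<phi>: "\<phi> \<in> mforms n X" and X: "\<And>i. i < n \<Longrightarrow> normed (X i)"
    and B: "\<And>i. i < n \<Longrightarrow> car (X i) = module.span (scl (X i)) (B i)"
    and zero: "\<And>x. x \<in> (\<Pi>\<^sub>E i\<in>{..<n}. B i) \<Longrightarrow> \<phi> x = 0"
  shows "\<phi> = 0"
proof -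
  \<comment> \<open>Induction on the number \<open>j\<close> of leading components that are already
    arbitrary; the remaining ones are still confined to the spanning sets. Each step frees component
    \<open>j\<close> by linearity in it.\<close>
  have "\<forall>x\<in>families n X. (\<forall>i. j \<le> i \<and> i < n \<longrightarrow> x i \<in> B i) \<longrightarrow> \<phi> x = 0" if "j \<le> n" for j
    using that
  proof (induction j)
    case 0
    show ?case using zero by (auto simp: families_def PiE_iff)
  next
    case (Suc j)
    have j: "j < n" using Suc.prems by simp
    interpret V: vector_space "scl (X j)" by (rule normed_vector_space[OF X[OF j]])
    have IH: "\<phi> x = 0" if "x \<in> families n X" "\<And>i. j \<le> i \<Longrightarrow> i < n \<Longrightarrow> x i \<in> B i" for x
      using Suc.IH j that by (meson less_imp_le)
    show ?case
    proof (intro ballI impI)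
      fix x assume x: "x \<in> families n X" and xB: "\<forall>i. Suc j \<le> i \<and> i < n \<longrightarrow> x i \<in> B i"
      have "a \<in> car (X j) \<and> \<phi> (x(j := a)) = 0" if "a \<in> V.span (B j)" for a
        using that
      proof (induction rule: V.span_induct_alt)
        case base
        have "0 \<in> car (X j) \<and> \<phi> (x(j := 0)) = 0"
          using car_0[OF X[OF j]] mforms_component_zero[OF \<phi> families_upd[OF x j] j X[OF j], of 0] by simp
        then show ?case .
      next
        case (step c b y)
        have b: "b \<in> car (X j)" using step.hyps B[OF j] V.span_base by blast
        have "\<phi> (x(j := b)) = 0"
          using step.hyps xB by (intro IH families_upd[OF x j b]) (auto simp: Suc_le_eq)
        moreover have "y \<in> car (X j) \<and> \<phi> (x(j := y)) = 0" using step.IH .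
        ultimately have "scl (X j) c b + y \<in> car (X j) \<and> \<phi> (x(j := scl (X j) c b + y)) = 0"
          using b mforms_add[OF \<phi> x j car_scale[OF X[OF j] b], of y c] mforms_scale[OF \<phi> x j b, of c]
          by (simp add: car_add[OF X[OF j]] car_scale[OF X[OF j]])
        then show ?case .
      qed
      from this[of "x j"] show "\<phi> x = 0"
        using families_component[OF x j] B[OF j] by simp
    qed
  qed
  from this[of n] show ?thesis using mforms_off[OF \<phi>] by fastforce
qed

text \<open>Two facts are sought here: the subspaces with the restricted norm form an election
  (\<open>election_restr\<close>), so that the axioms of \<nu> apply to them, and their space of
  forms is finite dimensional (\<open>Lspace_restr_reproduce\<close>).\<close>

locale tensor_restriction =
  fixes n :: nat and X :: "nat \<Rightarrow> ('k::real_or_complex, 'a::ab_group_add) nspace"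
    and \<beta> :: "('k, 'a) tensor \<Rightarrow> real" and E :: "nat \<Rightarrow> 'a set"
  assumes n: "1 \<le> n" and X: "\<And>i. i < n \<Longrightarrow> normed (X i)" and rc: "reasonable_crossnorm n X \<beta>"
    and E: "\<And>i. i < n \<Longrightarrow> fin_dim_subspace (X i) (E i)"
begin

abbreviation "XE \<equiv> subs X E"
abbreviation "\<beta>E \<equiv> norm_restr n X E \<beta>"
abbreviation "TXE \<equiv> tensor_space n XE \<beta>E"
abbreviation "LXE \<equiv> Lspace n XE \<beta>E"
abbreviation "resE \<equiv> restr n X E"
abbreviation "incE \<equiv> incl n X E"

lemma T: "normed (tensor_space n X \<beta>)"
  using rc by (simp add: reasonable_crossnorm_def)

lemma E_props: "E i \<subseteq> car (X i)" "module.subspace (scl (X i)) (E i)" "normed (XE i)" "banach_space (XE i)"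
  if "i < n"
  using fin_dim_subspaceD[OF X E, of i] that by (auto simp: subs_def)

lemma families_sub: "x \<in> families n XE \<Longrightarrow> x \<in> families n X"
  using E_props(1) by (auto simp: families_def PiE_iff)

lemma restr_in_mforms: "\<phi> \<in> mforms n X \<Longrightarrow> resE \<phi> \<in> mforms n XE"
proof -
  assume \<phi>: "\<phi> \<in> mforms n X"
  have "resE \<phi> (x(i := a + b)) = resE \<phi> (x(i := a)) + resE \<phi> (x(i := b))"
    "resE \<phi> (x(i := scl (X i) c a)) = c * resE \<phi> (x(i := a))"
    if "x \<in> families n XE" "i < n" "a \<in> E i" "b \<in> E i" for x i a b c
  proof -
    have "a + b \<in> E i" "scl (X i) c a \<in> E i"
      using car_add[OF E_props(3)[OF that(2)]] car_scale[OF E_props(3)[OF that(2)]] that(3,4) by simp_all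
    then show "resE \<phi> (x(i := a + b)) = resE \<phi> (x(i := a)) + resE \<phi> (x(i := b))"
      "resE \<phi> (x(i := scl (X i) c a)) = c * resE \<phi> (x(i := a))"
      using that families_upd[OF that(1,2)] mforms_add[OF \<phi> families_sub[OF that(1)] that(2)]
        mforms_scale[OF \<phi> families_sub[OF that(1)] that(2)] E_props(1)[OF that(2)]
      by (auto simp: restr_def subset_iff)
  qed
  then show ?thesis unfolding mforms_def[of n XE] by (auto simp: restr_def[of n X E \<phi>])
qed

lemma incl_add: "incE (u + v) = incE u + incE v"
  and incl_pscale: "incE (pscale c u) = pscale c (incE u)"
  and incl_0: "incE 0 = 0"
  by (simp_all add: incl_def fun_eq_iff pscale_apply)

lemma incl_sum: "incE (sum h A) = (\<Sum>i\<in>A. incE (h i))"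
  using sum_comp_morphism[of "incE" h A] by (simp add: incl_add incl_0 o_def)

lemma incl_tprod': "x \<in> families n XE \<Longrightarrow> incE (tprod n XE x) = tprod n X x"
  using E_props normed_vector_space[OF X] by (intro incl_tprod) auto

lemma incl_in_tensors:
  assumes "u \<in> tensors n XE"
  shows "incE u \<in> tensors n X"
proof -
  obtain m :: nat and x where "\<And>j. j < m \<Longrightarrow> x j \<in> families n XE" "u = (\<Sum>j<m. tprod n XE (x j))"
    using tensors_eq_sums[OF n, of XE u] E_props(3)[of 0] n assms by auto
  then show ?thesis
    by (simp add: incl_sum incl_tprod' tensors_def)
       (intro pscale.span_sum pscale.span_base, simp add: Sigma_set_def families_sub)
qed

lemma lin_incl: "lin (TXE) (tensor_space n X \<beta>) (incE)"
  by (simp add: lin_def incl_in_tensors incl_add incl_pscale)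

text \<open>The form is composed with projections of the \<open>X i\<close> onto the
  \<open>E i\<close>. Since tensors are functions on forms, surjectivity of restriction is dual to
  injectivity of \<open>incE\<close>.\<close>

lemma restr_onto:
  assumes \<psi>: "\<psi> \<in> mforms n XE"
  obtains \<phi> where "\<phi> \<in> mforms n X" "resE \<phi> = \<psi>"
proof -
  have "\<exists>P. lin (X i) (XE i) P \<and> (\<forall>x\<in>E i. P x = x)" if "i < n" for i
    using fin_dim_projection[OF X[OF that] E[OF that]] unfolding subs_def by metis
  then obtain P where P: "\<And>i. i < n \<Longrightarrow> lin (X i) (XE i) (P i)" "\<And>i x. i < n \<Longrightarrow> x \<in> E i \<Longrightarrow> P i x = x"
    by metis
  define R where "R x = (\<lambda>i\<in>{..<n}. P i (x i))" for x
  have R: "R x \<in> families n XE" if "x \<in> families n X" for x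
    using lin_car[OF P(1)] families_component[OF that] by (auto simp: R_def families_def)
  have R_upd: "R (x(i := a)) = (R x)(i := P i a)" if "i < n" for x i a
    using that by (auto simp: R_def fun_eq_iff)
  have R_id: "R x = x" if "x \<in> families n XE" for x
    using that P(2) by (auto simp: R_def families_def PiE_iff extensional_def fun_eq_iff)
  define \<phi> where "\<phi> x = (if x \<in> families n X then \<psi> (R x) else 0)" for x
  have "\<phi> \<in> mforms n X"
    unfolding mforms_def
  proof (intro CollectI conjI allI impI ballI)
    fix x i a b assume x: "x \<in> families n X" and i: "i < n" and a: "a \<in> car (X i)" and b: "b \<in> car (X i)"
    show "\<phi> (x(i := a + b)) = \<phi> (x(i := a)) + \<phi> (x(i := b))"
      using families_upd[OF x i] a b car_add[OF X[OF i] a b] mforms_add[OF \<psi> R[OF x] i]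
        lin_car[OF P(1)[OF i]] lin_add[OF P(1)[OF i] a b]
      by (simp add: \<phi>_def R_upd[OF i])
    show "\<phi> (x(i := scl (X i) c a)) = c * \<phi> (x(i := a))" for c
      using families_upd[OF x i] a car_scale[OF X[OF i] a] mforms_scale[OF \<psi> R[OF x] i]
        lin_car[OF P(1)[OF i]] lin_scale[OF P(1)[OF i] a]
      by (simp add: \<phi>_def R_upd[OF i])
  qed (simp add: \<phi>_def)
  moreover have "resE \<phi> = \<psi>"
  proof
    fix x
    show "resE \<phi> x = \<psi> x"
      using R_id[of x] families_sub[of x] mforms_off[OF \<psi>, of x] by (simp add: restr_def \<phi>_def)
  qed
  ultimately show ?thesis using that by blast
qed

text \<open>Needed for the restriction of \<beta> to be a norm and not merely a seminorm.\<close>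

lemma inj_on_incl: "inj_on (incE) (tensors n XE)"
proof (rule inj_onI)
  fix u v assume u: "u \<in> tensors n XE" and v: "v \<in> tensors n XE" and eq: "incE u = incE v"
  show "u = v"
  proof
    fix \<psi>
    show "u \<psi> = v \<psi>"
    proof (cases "\<psi> \<in> mforms n XE")
      case True
      obtain \<phi> where "\<phi> \<in> mforms n X" "resE \<phi> = \<psi>" by (rule restr_onto[OF True])
      then have "u \<psi> = incE u \<phi>" "v \<psi> = incE v \<phi>" by (simp_all add: incl_def)
      then show ?thesis using eq by simp
    qed (simp add: tensors_linear(3)[OF u] tensors_linear(3)[OF v])
  qed
qed

lemma TE: "normed (TXE)"
  using vector_space_pscale inj_on_incl
  by (intro normed_pullback[OF _ _ T lin_incl]) (simp_all add: tensors_def norm_restr_def)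

text \<open>By Hahn-Banach, functionals in the unit balls of the duals of the \<open>E i\<close>
  extend to the \<open>X i\<close> without leaving the unit balls, and the product of the extensions
  restricts to the product of the given functionals.\<close>

lemma injective_norm_restr_le:
  assumes u: "u \<in> tensors n XE"
  shows "injective_norm n XE u \<le> injective_norm n X (incE u)"
proof -
  define F where "F = (\<lambda>(Z :: nat \<Rightarrow> ('k, 'a) nspace) f x. if x \<in> families n Z then \<Prod>i<n. f i (x i) else (0::'k))"
  define A where "A = {norm (u (F XE f)) | f. \<forall>i<n. f i \<in> car (dual (XE i)) \<and> nrm (dual (XE i)) (f i) \<le> 1}"
  define B where "B = {norm (incE u (F X f)) | f. \<forall>i<n. f i \<in> car (dual (X i)) \<and> nrm (dual (X i)) (f i) \<le> 1}"
  have F: "F X f \<in> mforms n X" if "\<forall>i<n. f i \<in> car (dual (X i)) \<and> nrm (dual (X i)) (f i) \<le> 1" for f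
    unfolding F_def using dual_lin X that by (intro prod_form_in_mforms) blast+
  have A_ne: "A \<noteq> {}"
  proof -
    have "0 \<in> car (dual (XE i)) \<and> nrm (dual (XE i)) 0 \<le> 1" if "i < n" for i
      using car_0[OF normed_dual[OF E_props(3)[OF that]]] nrm_0[OF normed_dual[OF E_props(3)[OF that]]] by simp
    then have "norm (u (F XE (\<lambda>_. 0))) \<in> A" unfolding A_def by (intro CollectI exI[of _ "\<lambda>_. 0"]) simp
    then show ?thesis by blast
  qed
  have A_le: "\<exists>b\<in>B. a \<le> b" if aA: "a \<in> A" for a
  proof -
    obtain f where f: "\<And>i. i < n \<Longrightarrow> f i \<in> car (dual (XE i))" "\<And>i. i < n \<Longrightarrow> opnorm (XE i) scalars (f i) \<le> 1"
      and a: "a = norm (u (F XE f))"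
      using aA unfolding A_def by auto
    have "\<exists>g. g \<in> car (dual (X i)) \<and> opnorm (X i) scalars g \<le> 1 \<and> (\<forall>x\<in>E i. g x = f i x)" if i: "i < n" for i
    proof -
      have "norm (f i x) \<le> 1 * nrm (X i) x" if "x \<in> E i" for x
      proof -
        have "norm (f i x) \<le> opnorm (XE i) scalars (f i) * nrm (X i) x"
          using dual_bound[OF f(1)[OF i] E_props(3)[OF i], of x] that by simp
        also have "\<dots> \<le> 1 * nrm (X i) x"
          using f(2)[OF i] nrm_nonneg[OF E_props(3)[OF i], of x] that by (intro mult_right_mono) auto
        finally show ?thesis .
      qed
      moreover have "lin ((X i)\<lparr>car := E i\<rparr>) scalars (f i)" using dual_lin[OF f(1)[OF i]] by (simp add: subs_def)
      ultimately obtain g where g: "lin (X i) scalars g" "\<And>x. x \<in> E i \<Longrightarrow> g x = f i x"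
        "\<And>x. x \<in> car (X i) \<Longrightarrow> norm (g x) \<le> 1 * nrm (X i) x"
        using hahn_banach[OF X[OF i] E_props(1,2)[OF i], of "f i" 1] by auto
      let ?g = "\<lambda>x. if x \<in> car (X i) then g x else 0"
      have "?g \<in> car (dual (X i))" using dual_extendI[OF g(1) X[OF i] g(3)] .
      moreover have "opnorm (X i) scalars ?g \<le> 1" using g(3) by (intro opnorm_le X[OF i]) auto
      moreover have "\<forall>x\<in>E i. ?g x = f i x" using g(2) E_props(1)[OF i] by auto
      ultimately show ?thesis by blast
    qed
    then obtain g where g: "\<And>i. i < n \<Longrightarrow> g i \<in> car (dual (X i)) \<and> opnorm (X i) scalars (g i) \<le> 1"
      "\<And>i x. i < n \<Longrightarrow> x \<in> E i \<Longrightarrow> g i x = f i x"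
      by metis
    have "resE (F X g) = F XE f"
    proof
      fix x
      show "resE (F X g) x = F XE f x"
      proof (cases "x \<in> families n XE")
        case True
        have "(\<Prod>i<n. g i (x i)) = (\<Prod>i<n. f i (x i))"
          using families_component[OF True] g(2) by (intro prod.cong) auto
        then show ?thesis using True families_sub[OF True] by (simp add: restr_def F_def)
      qed (simp add: restr_def F_def)
    qed
    then have "incE u (F X g) = u (F XE f)" using F[of g] g(1) by (simp add: incl_def)
    moreover have "norm (incE u (F X g)) \<in> B" unfolding B_def using g(1) by auto
    ultimately show ?thesis using a by auto
  qed
  \<comment> \<open>A single representation of the tensor bounds all members of \<open>B\<close>, so
    that \<open>Sup B\<close> is a genuine supremum.\<close>
  have B_bdd: "bdd_above B"
  proof -
    obtain m :: nat and x where x: "\<And>j. j < m \<Longrightarrow> x j \<in> families n X" "incE u = (\<Sum>j<m. tprod n X (x j))"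
      using tensors_eq_sums[OF n X incl_in_tensors[OF u]] n by auto
    have "norm (incE u (F X f)) \<le> (\<Sum>j<m. \<Prod>i<n. nrm (X i) (x j i))"
      if f: "\<forall>i<n. f i \<in> car (dual (X i)) \<and> nrm (dual (X i)) (f i) \<le> 1" for f
    proof -
      have "incE u (F X f) = (\<Sum>j<m. \<Prod>i<n. f i (x j i))"
        using F[OF f] x(1) by (simp add: x(2) sum_apply tprod_def) (simp add: F_def)
      then have "norm (incE u (F X f)) \<le> (\<Sum>j<m. norm (\<Prod>i<n. f i (x j i)))"
        by (simp add: norm_sum)
      also have "\<dots> \<le> (\<Sum>j<m. \<Prod>i<n. nrm (X i) (x j i))"
      proof (rule sum_mono)
        fix j assume "j \<in> {..<m}"
        then have j: "x j \<in> families n X" using x(1) by simp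
        have "norm (f i (x j i)) \<le> nrm (X i) (x j i)" if i: "i < n" for i
        proof -
          have c: "x j i \<in> car (X i)" by (rule families_component[OF j i])
          have "norm (f i (x j i)) \<le> opnorm (X i) scalars (f i) * nrm (X i) (x j i)"
            using f i by (intro dual_bound X c) auto
          also have "\<dots> \<le> 1 * nrm (X i) (x j i)"
            using f i by (intro mult_right_mono nrm_nonneg[OF X c]) auto
          finally show ?thesis by simp
        qed
        then show "norm (\<Prod>i<n. f i (x j i)) \<le> (\<Prod>i<n. nrm (X i) (x j i))"
          unfolding prod_norm[symmetric] by (intro prod_mono) auto
      qed
      finally show ?thesis .
    qed
    then show ?thesis unfolding B_def by (intro bdd_aboveI) blast
  qed
  have "Sup A \<le> Sup B"
    using A_ne A_le B_bdd by (intro cSup_mono) auto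
  then show ?thesis by (simp add: injective_norm_def A_def B_def F_def)
qed

text \<open>A representation with factors in the \<open>E i\<close> is also one in the
  \<open>X i\<close>, at the same cost, so the infimum over the \<open>X i\<close> runs through more
  representations.\<close>

lemma projective_norm_restr_ge:
  assumes u: "u \<in> tensors n XE"
  shows "projective_norm n X (incE u) \<le> projective_norm n XE u"
proof -
  define S where "S Z w = {\<Sum>j<m. \<Prod>i<n. nrm (Z i) (x j i) | (m::nat) x.
    (\<forall>j<m. x j \<in> families n Z) \<and> w = (\<Sum>j<m. tprod n Z (x j))}" for Z :: "nat \<Rightarrow> ('k, 'a) nspace" and w
  have "Inf (S X (incE u)) \<le> Inf (S XE u)"
  proof (rule cInf_superset_mono)
    obtain m :: nat and x where "\<And>j. j < m \<Longrightarrow> x j \<in> families n XE" "u = (\<Sum>j<m. tprod n XE (x j))"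
      using tensors_eq_sums[OF n, of XE u] u E_props(3)[of 0] n by auto
    then show "S XE u \<noteq> {}" unfolding S_def by blast
    show "bdd_below (S X (incE u))"
      unfolding S_def
      by (intro bdd_belowI[of _ 0])
         (auto intro!: sum_nonneg prod_nonneg nrm_nonneg[OF X] families_component)
    show "S XE u \<subseteq> S X (incE u)"
    proof
      fix s assume "s \<in> S XE u"
      then obtain m :: nat and x where s: "s = (\<Sum>j<m. \<Prod>i<n. nrm (XE i) (x j i))"
        and x: "\<forall>j<m. x j \<in> families n XE" and u: "u = (\<Sum>j<m. tprod n XE (x j))"
        unfolding S_def by blast
      have "incE u = (\<Sum>j<m. tprod n X (x j))"
        using x by (simp add: u incl_sum incl_tprod')
      moreover have "s = (\<Sum>j<m. \<Prod>i<n. nrm (X i) (x j i))" by (simp add: s)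
      ultimately show "s \<in> S X (incE u)" unfolding S_def using x families_sub by blast
    qed
  qed
  then show ?thesis by (simp add: projective_norm_def S_def)
qed

lemma reasonable_crossnorm_restr: "reasonable_crossnorm n XE \<beta>E"
  unfolding reasonable_crossnorm_def
proof (intro conjI ballI TE)
  fix u assume u: "u \<in> tensors n XE"
  have "injective_norm n X (incE u) \<le> \<beta> (incE u)"
    "\<beta> (incE u) \<le> projective_norm n X (incE u)"
    using rc incl_in_tensors[OF u] by (auto simp: reasonable_crossnorm_def)
  then show "injective_norm n XE u \<le> \<beta>E u" "\<beta>E u \<le> projective_norm n XE u"
    using injective_norm_restr_le[OF u] projective_norm_restr_ge[OF u] by (simp_all add: norm_restr_def)
qed

lemma election_restr: "banach_space W \<Longrightarrow> election n XE W \<beta>E"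
  using n E_props(4) reasonable_crossnorm_restr by (simp add: election_def)

lemma linearization_restr:
  assumes "\<phi> \<in> mforms n X" "z \<in> tensors n XE"
  shows "linearization n XE (resE \<phi>) z = linearization n X \<phi> (incE z)"
  using assms incl_in_tensors by (simp add: linearization_def incl_def)

lemma restr_in_Lspace:
  assumes "\<phi> \<in> car (Lspace n X \<beta>)"
  shows "resE \<phi> \<in> car (LXE)" "nrm (LXE) (resE \<phi>) \<le> nrm (Lspace n X \<beta>) \<phi>"
proof -
  let ?c = "opnorm (tensor_space n X \<beta>) scalars (linearization n X \<phi>)"
  have \<phi>: "\<phi> \<in> mforms n X" "linearization n X \<phi> \<in> car (dual (tensor_space n X \<beta>))"
    using assms by (auto simp: in_Lspace_iff)
  have b: "norm (linearization n XE (resE \<phi>) u) \<le> ?c * \<beta>E u" if "u \<in> tensors n XE" for u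
    using dual_bound[OF \<phi>(2) T, of "incE u"] incl_in_tensors[OF that] linearization_restr[OF \<phi>(1) that]
    by (simp add: norm_restr_def)
  show "resE \<phi> \<in> car (LXE)"
    using b by (intro in_LspaceI[where C = ?c] restr_in_mforms \<phi>) (auto simp: linearization_def)
  have "0 \<le> ?c" using nrm_nonneg[OF normed_dual[OF T] \<phi>(2)] by simp
  then show "nrm (LXE) (resE \<phi>) \<le> nrm (Lspace n X \<beta>) \<phi>"
    using opnorm_le[OF TE, of ?c scalars "linearization n XE (resE \<phi>)"] b by simp
qed

lemma lin_restr: "lin (Lspace n X \<beta>) (LXE) (resE)"
  unfolding lin_def using restr_in_Lspace by (simp add: restr_def fun_eq_iff pscale_apply)

text \<open>The adjoint of restriction acts on tensors as the inclusion \<open>incE\<close>, which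
  sends elementary tensors to elementary tensors.\<close>

lemma restr_preserves_Sigma: "preserves_Sigma n X \<beta> n XE \<beta>E (resE)"
  unfolding preserves_Sigma_def
proof
  fix w assume "w \<in> adjoint (Lspace n X \<beta>) (resE) ` canon n XE \<beta>E ` Sigma_set n XE"
  then obtain x where x: "x \<in> families n XE"
    and w: "w = adjoint (Lspace n X \<beta>) (resE) (canon n XE \<beta>E (tprod n XE x))"
    by (auto simp: Sigma_set_def)
  have "w = canon n X \<beta> (tprod n X x)"
  proof
    fix \<phi>
    show "w \<phi> = canon n X \<beta> (tprod n X x) \<phi>"
      using restr_in_Lspace(1)[of \<phi>] linearization_restr[OF _ tprod_in_tensors[OF x]] incl_tprod'[OF x]
      by (simp add: w adjoint_def canon_def in_Lspace_iff)
  qed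
  then show "w \<in> canon n X \<beta> ` Sigma_set n X" using families_sub[OF x] by (simp add: Sigma_set_def)
qed

text \<open>A form on the \<open>E i\<close> is determined by its values on the finitely many
  families \<open>K\<close> of spanning vectors. Evaluations at \<open>K\<close> are thus
  coordinates on the space of forms, and the \<open>\<Phi> k\<close> come from
  \<open>finite_functionals_reproduce\<close>.\<close>

lemma Lspace_restr_reproduce:
  obtains K \<Phi> where "finite K" "K \<subseteq> families n XE" "\<And>k. k \<in> K \<Longrightarrow> \<Phi> k \<in> car (LXE)"
    "\<And>\<phi>. \<phi> \<in> car (LXE) \<Longrightarrow> \<phi> = (\<Sum>k\<in>K. pscale (\<phi> k) (\<Phi> k))"
proof -
  note L = normed_Lspace[OF TE]
  have "\<exists>B. finite B \<and> E i = module.span (scl (X i)) B" if "i < n" for i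
    using E[OF that] by (simp add: fin_dim_subspace_def)
  then obtain B where B: "\<And>i. i < n \<Longrightarrow> finite (B i)" "\<And>i. i < n \<Longrightarrow> E i = module.span (scl (X i)) (B i)"
    by metis
  define K where "K = (\<Pi>\<^sub>E i\<in>{..<n}. B i)"
  have K: "finite K" using B(1) unfolding K_def by (intro finite_PiE) auto
  have "B i \<subseteq> E i" if "i < n" for i
    using B(2)[OF that] module.span_superset[of "scl (X i)"] normed_vector_space[OF X[OF that]]
    by (simp add: module_iff_vector_space)
  then have KE: "K \<subseteq> families n XE" by (auto simp: K_def families_def PiE_iff subset_iff)
  have "\<exists>\<Phi>. (\<forall>k\<in>K. \<Phi> k \<in> car (LXE)) \<and>
      (\<forall>\<phi>\<in>car (LXE). \<forall>j\<in>K. \<phi> j = (\<Sum>k\<in>K. \<phi> k * \<Phi> k j))"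
    using pscale.finite_functionals_reproduce[OF K, of "car (LXE)" "\<lambda>k \<phi>. \<phi> k"]
      normed_subspace_car[OF L] by (simp add: pscale_apply)
  then obtain \<Phi> where \<Phi>: "\<And>k. k \<in> K \<Longrightarrow> \<Phi> k \<in> car (LXE)"
    and rep: "\<And>\<phi> j. \<phi> \<in> car (LXE) \<Longrightarrow> j \<in> K \<Longrightarrow> \<phi> j = (\<Sum>k\<in>K. \<phi> k * \<Phi> k j)"
    by blast
  have "\<phi> = (\<Sum>k\<in>K. pscale (\<phi> k) (\<Phi> k))" if \<phi>: "\<phi> \<in> car (LXE)" for \<phi>
  proof -
    have s: "(\<Sum>k\<in>K. pscale (\<phi> k) (\<Phi> k)) \<in> car (LXE)"
      using \<Phi> car_scale[OF L] by (intro car_sum[OF L]) simp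
    have ap: "(\<Sum>k\<in>K. pscale (\<phi> k) (\<Phi> k)) j = (\<Sum>k\<in>K. \<phi> k * \<Phi> k j)" for j
      by (simp add: sum_apply pscale_apply)
    have d: "\<phi> - (\<Sum>k\<in>K. pscale (\<phi> k) (\<Phi> k)) \<in> mforms n XE"
      using car_diff[OF L \<phi> s] by (simp add: in_Lspace_iff)
    have "\<phi> - (\<Sum>k\<in>K. pscale (\<phi> k) (\<Phi> k)) = 0"
    proof (rule mforms_zero_if_zero_on_spanning[OF d E_props(3), of B])
      show "car (XE i) = module.span (scl (XE i)) (B i)" if "i < n" for i using B(2)[OF that] by simp
      fix j assume "j \<in> (\<Pi>\<^sub>E i\<in>{..<n}. B i)"
      then have "j \<in> K" by (simp add: K_def)
      then show "(\<phi> - (\<Sum>k\<in>K. pscale (\<phi> k) (\<Phi> k))) j = 0" using rep[OF \<phi>, of j] by (simp add: ap)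
    qed
    then show ?thesis by simp
  qed
  then show ?thesis using that K KE \<Phi> by blast
qed

end

section \<open>The dual of a finite dimensional space of functionals\<close>

lemma banach_isometric:
  assumes "normed W" "banach_space V" "isometric_iso W V J"
  shows "banach_space W"
  unfolding banach_space_def
proof (intro conjI allI impI assms(1))
  have J: "lin W V J" "J ` car W = car V" "\<And>x. x \<in> car W \<Longrightarrow> nrm V (J x) = nrm W x"
    using assms(3) by (auto simp: isometric_iso_def bij_betw_def)
  fix s :: "nat \<Rightarrow> _"
  assume "(\<forall>k. s k \<in> car W) \<and> (\<forall>e>0. \<exists>N. \<forall>j\<ge>N. \<forall>k\<ge>N. nrm W (s j - s k) < e)"
  then have s: "\<And>k. s k \<in> car W"
    and cau: "\<And>e. e > 0 \<Longrightarrow> \<exists>N. \<forall>j\<ge>N. \<forall>k\<ge>N. nrm W (s j - s k) < e" by auto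
  have d: "nrm V (J x - J y) = nrm W (x - y)" if "x \<in> car W" "y \<in> car W" for x y
    using J(3)[OF car_diff[OF assms(1) that]] lin_diff[OF J(1) assms(1) that] by simp
  have "\<forall>k. J (s k) \<in> car V" using lin_car[OF J(1) s] by blast
  moreover have "\<forall>e>0. \<exists>N. \<forall>j\<ge>N. \<forall>k\<ge>N. nrm V (J (s j) - J (s k)) < e"
    using cau by (simp add: d s)
  ultimately have "\<exists>l\<in>car V. (\<lambda>k. nrm V (J (s k) - l)) \<longlonglongrightarrow> 0"
    using assms(2)[unfolded banach_space_def, THEN conjunct2, rule_format, of "\<lambda>k. J (s k)"] by blast
  then obtain l' where l': "l' \<in> car V" "(\<lambda>k. nrm V (J (s k) - l')) \<longlonglongrightarrow> 0" by blast
  from l'(1) obtain l where "l \<in> car W" "l' = J l" unfolding J(2)[symmetric] by (rule imageE)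
  then have l: "l \<in> car W" "(\<lambda>k. nrm V (J (s k) - J l)) \<longlonglongrightarrow> 0" using l'(2) by simp_all
  then show "\<exists>l\<in>car W. (\<lambda>k. nrm W (s k - l)) \<longlonglongrightarrow> 0" by (auto simp: d s)
qed

locale dual_subspace =
  fixes Y :: "('k::real_or_complex, 'a::ab_group_add) nspace" and F :: "('a \<Rightarrow> 'k) set"
  assumes Y: "normed Y" and F: "fin_dim_subspace (dual Y) F"
begin

abbreviation "G \<equiv> (dual Y)\<lparr>car := F\<rparr>"

text \<open>Evaluation at y as an element of the dual of \<open>G\<close>; members of a dual are 0
  off the carrier, hence the cut-off at \<open>F\<close>.\<close>

definition "ev y = (\<lambda>f. if f \<in> F then f y else 0)"

lemma F_sub: "F \<subseteq> car (dual Y)" "pscale.subspace F" and G: "normed G"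
  using fin_dim_subspaceD[OF normed_dual[OF Y] F] by simp_all

lemma F_lin: "f \<in> F \<Longrightarrow> lin Y scalars f"
  using F_sub dual_lin by blast

lemma ev_in_dual: "y \<in> car Y \<Longrightarrow> ev y \<in> car (dual G)"
  and ev_norm_le: "y \<in> car Y \<Longrightarrow> nrm (dual G) (ev y) \<le> nrm Y y"
proof -
  assume y: "y \<in> car Y"
  have b: "norm (f y) \<le> nrm Y y * opnorm Y scalars f" if "f \<in> F" for f
    using dual_bound[OF _ Y y, of f] that F_sub by (auto simp: mult.commute)
  have "lin G scalars (\<lambda>f. f y)" by (simp add: lin_scalars_iff pscale_apply)
  then show "ev y \<in> car (dual G)"
    using dual_extendI[OF _ G, of "\<lambda>f. f y" "nrm Y y"] b by (simp add: ev_def)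
  show "nrm (dual G) (ev y) \<le> nrm Y y"
    using opnorm_le[OF G nrm_nonneg[OF Y y], of scalars "ev y"] b by (simp add: ev_def)
qed

lemma lin_ev: "lin Y (dual G) ev"
  unfolding lin_def
  using ev_in_dual lin_add[OF F_lin] lin_scale[OF F_lin] by (auto simp: ev_def fun_eq_iff pscale_apply)

lemma coordinates:
  obtains A v where "finite A" "F = pscale.span A" "\<And>k. k \<in> A \<Longrightarrow> v k \<in> car Y"
    "\<And>j x. j \<in> A \<Longrightarrow> x \<in> car Y \<Longrightarrow> j x = (\<Sum>k\<in>A. k x * j (v k))"
proof -
  obtain A where A: "finite A" "F = pscale.span A" using F by (auto simp: fin_dim_subspace_def)
  have AF: "k \<in> F" if "k \<in> A" for k using that A pscale.span_base by blast
  interpret V: vector_space "scl Y" by (rule normed_vector_space[OF Y])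
  have "\<exists>v. (\<forall>k\<in>A. v k \<in> car Y) \<and> (\<forall>x\<in>car Y. \<forall>j\<in>A. j x = (\<Sum>k\<in>A. k x * j (v k)))"
    using lin_add[OF F_lin[OF AF]] lin_scale[OF F_lin[OF AF]]
    by (intro V.finite_functionals_reproduce[OF A(1) normed_subspace_car[OF Y], of "\<lambda>f x. f x"]) simp_all
  then show ?thesis using that A by blast
qed

text \<open>With reproducing vectors v for functionals \<open>A\<close> that span \<open>F\<close>,
  the point y with coefficients \<eta> k along the v k has the values prescribed by \<eta>.\<close>

lemma ev_onto:
  assumes \<eta>: "\<eta> \<in> car (dual G)"
  obtains y where "y \<in> car Y" "ev y = \<eta>"
proof -
  interpret V: vector_space "scl Y" by (rule normed_vector_space[OF Y])
  obtain A v where A: "finite A" "F = pscale.span A" and v: "\<And>k. k \<in> A \<Longrightarrow> v k \<in> car Y"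
    and rep: "\<And>j x. j \<in> A \<Longrightarrow> x \<in> car Y \<Longrightarrow> j x = (\<Sum>k\<in>A. k x * j (v k))"
    using coordinates by blast
  have AF: "k \<in> F" if "k \<in> A" for k using that A pscale.span_base by blast
  define y where "y = (\<Sum>k\<in>A. scl Y (\<eta> k) (v k))"
  have y: "y \<in> car Y" unfolding y_def using v by (intro car_sum car_scale Y)
  have \<eta>l: "lin G scalars \<eta>" by (rule dual_lin[OF \<eta>])
  have on_A: "j y = \<eta> j" if j: "j \<in> A" for j
  proof -
    \<comment> \<open>The reproduction formula read as an identity between functionals; in this form
      \<eta> can be applied to it.\<close>
    have "j = (\<Sum>k\<in>A. pscale (j (v k)) k)"
    proof
      fix x
      have ap: "(\<Sum>k\<in>A. pscale (j (v k)) k) x = (\<Sum>k\<in>A. j (v k) * k x)"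
        by (simp add: sum_apply pscale_apply)
      show "j x = (\<Sum>k\<in>A. pscale (j (v k)) k) x"
      proof (cases "x \<in> car Y")
        case True
        then show ?thesis using rep[OF j True] by (simp add: ap mult.commute)
      next
        case False
        then have "k x = 0" if "k \<in> A" for k using AF[OF that] F_sub(1) by (auto simp: in_dual_iff)
        then have "(\<Sum>k\<in>A. j (v k) * k x) = 0" "j x = 0" using j by (auto intro: sum.neutral)
        then show ?thesis by (simp add: ap)
      qed
    qed
    then have "\<eta> j = \<eta> (\<Sum>k\<in>A. pscale (j (v k)) k)" by simp
    also have "\<dots> = (\<Sum>k\<in>A. \<eta> (pscale (j (v k)) k))"
      using AF pscale.subspace_scale[OF F_sub(2)] by (intro lin_sum[OF \<eta>l G]) simp
    also have "\<dots> = (\<Sum>k\<in>A. j (v k) * \<eta> k)"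
      using lin_scale[OF \<eta>l] AF by simp
    also have "\<dots> = j y"
      unfolding y_def using lin_sum[OF F_lin[OF AF[OF j]] Y, of A] v lin_scale[OF F_lin[OF AF[OF j]]]
      by (simp add: car_scale[OF Y] mult.commute)
    finally show ?thesis by simp
  qed
  have "f y = \<eta> f" if "f \<in> F" for f
  proof (rule lin_eq_on_span[OF G _ \<eta>l])
    show "lin G scalars (\<lambda>f. f y)" by (simp add: lin_scalars_iff pscale_apply)
    show "car G = module.span (scl G) A" "f \<in> car G" using A(2) that by simp_all
  qed (rule on_A)
  then have "ev y = \<eta>" using \<eta> by (auto simp: ev_def fun_eq_iff in_dual_iff)
  then show ?thesis using that y by blast
qed

text \<open>Without this the choice in \<open>dual_copy\<close> would be arbitrary. The copy lives
  on the range of a projection \<open>P\<close> of \<open>Y\<close> along the annihilator of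
  \<open>F\<close>: functionals in \<open>F\<close> do not distinguish x from \<open>P x\<close>,
  and on the range they separate points.\<close>

lemma dual_copy_exists: "\<exists>(W :: ('k, 'a) nspace) J. banach_space W \<and> isometric_iso W (dual G) J"
proof -
  interpret V: vector_space "scl Y" by (rule normed_vector_space[OF Y])
  obtain A v where A: "finite A" "F = pscale.span A" and v: "\<And>k. k \<in> A \<Longrightarrow> v k \<in> car Y"
    and rep: "\<And>j x. j \<in> A \<Longrightarrow> x \<in> car Y \<Longrightarrow> j x = (\<Sum>k\<in>A. k x * j (v k))"
    using coordinates by blast
  have AF: "k \<in> F" if "k \<in> A" for k using that A pscale.span_base by blast
  define P where "P x = (\<Sum>k\<in>A. scl Y (k x) (v k))" for x
  have P: "P x \<in> car Y" for x unfolding P_def using v by (intro car_sum car_scale Y)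
  have P_add: "P (x + y) = P x + P y" if "x \<in> car Y" "y \<in> car Y" for x y
  proof -
    have "k (x + y) = k x + k y" if "k \<in> A" for k
      using lin_add[OF F_lin[OF AF[OF that]] \<open>x \<in> car Y\<close> \<open>y \<in> car Y\<close>] .
    then have "P (x + y) = (\<Sum>k\<in>A. scl Y (k x + k y) (v k))" unfolding P_def by (intro sum.cong) auto
    then show ?thesis by (simp add: P_def V.scale_left_distrib sum.distrib)
  qed
  have P_scale: "P (scl Y c x) = scl Y c (P x)" if "x \<in> car Y" for c x
  proof -
    have "k (scl Y c x) = c * k x" if "k \<in> A" for k
      using lin_scale[OF F_lin[OF AF[OF that]] \<open>x \<in> car Y\<close>] by simp
    then have "P (scl Y c x) = (\<Sum>k\<in>A. scl Y (c * k x) (v k))" unfolding P_def by (intro sum.cong) auto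
    then show ?thesis by (simp add: P_def V.scale_sum_right)
  qed
  have jP: "j (P x) = j x" if "j \<in> A" "x \<in> car Y" for j x
    unfolding P_def using lin_sum[OF F_lin[OF AF[OF that(1)]] Y, of A] v lin_scale[OF F_lin[OF AF[OF that(1)]]]
    by (simp add: car_scale[OF Y] rep[OF that])
  have "f (P x) = f x" if "f \<in> F" "x \<in> car Y" for f x
  proof (rule lin_eq_on_span[OF G])
    show "lin G scalars (\<lambda>f. f (P x))" "lin G scalars (\<lambda>f. f x)" by (simp_all add: lin_scalars_iff pscale_apply)
    show "car G = module.span (scl G) A" "f \<in> car G" using A(2) that by simp_all
  qed (rule jP[OF _ that(2)])
  then have evP: "ev (P x) = ev x" if "x \<in> car Y" for x
    using that by (auto simp: ev_def fun_eq_iff)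
  \<comment> \<open>Taking the norm of the dual of \<open>G\<close> on a complement of the annihilator of \<open>F\<close> avoids identifying it with a quotient norm.\<close>
  define W :: "('k, 'a) nspace" where "W = \<lparr>car = P ` car Y, scl = scl Y, nrm = (\<lambda>w. nrm (dual G) (ev w))\<rparr>"
  have W_sub: "V.subspace (car W)"
  proof (rule V.subspaceI)
    have "P 0 = 0" using P_scale[OF car_0[OF Y], of 0] by simp
    then show "0 \<in> car W" using car_0[OF Y] by (auto simp: W_def image_iff intro!: bexI[of _ 0])
    show "x + y \<in> car W" if "x \<in> car W" "y \<in> car W" for x y
      using that car_add[OF Y] by (auto simp: W_def P_add[symmetric])
    show "scl Y c x \<in> car W" if "x \<in> car W" for c x
      using that car_scale[OF Y] by (auto simp: W_def P_scale[symmetric])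
  qed
  have WY: "w \<in> car Y" if "w \<in> car W" for w using that P by (auto simp: W_def)
  have lin: "lin W (dual G) ev"
    using lin_ev WY by (auto simp: lin_def W_def)
  have inj: "inj_on ev (car W)"
  proof (rule inj_onI)
    fix w w' assume "w \<in> car W" "w' \<in> car W" and e: "ev w = ev w'"
    then obtain x x' where x: "w = P x" "w' = P x'" "x \<in> car Y" "x' \<in> car Y" by (auto simp: W_def)
    have "k x = k x'" if k: "k \<in> A" for k
      using e jP[OF k] x AF[OF k] by (metis ev_def)
    then show "w = w'" unfolding x P_def by (intro sum.cong) auto
  qed
  have W: "normed W"
    using W_sub V.vector_space_axioms by (intro normed_pullback[OF _ _ normed_dual[OF G] lin inj]) (simp_all add: W_def)
  have "ev ` car W = car (dual G)"
  proof
    show "ev ` car W \<subseteq> car (dual G)" using WY ev_in_dual by auto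
    show "car (dual G) \<subseteq> ev ` car W"
    proof
      fix \<eta> assume "\<eta> \<in> car (dual G)"
      then obtain y where y: "y \<in> car Y" "ev y = \<eta>" by (rule ev_onto)
      then show "\<eta> \<in> ev ` car W" using evP[OF y(1)] by (auto simp: W_def image_iff intro!: bexI[of _ y])
    qed
  qed
  then have "isometric_iso W (dual G) ev"
    using lin inj by (simp add: isometric_iso_def bij_betw_def W_def)
  then show ?thesis using banach_isometric[OF W banach_dual[OF G]] by blast
qed

lemma dual_copy_props:
  assumes "dual_copy G = (W :: ('k, 'a) nspace, J)"
  shows "banach_space W" "isometric_iso W (dual G) J"
proof -
  have "\<exists>p. case p of (W :: ('k, 'a) nspace, J) \<Rightarrow> banach_space W \<and> isometric_iso W (dual G) J"
    using dual_copy_exists by auto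
  then have "case dual_copy G of (W :: ('k, 'a) nspace, J) \<Rightarrow> banach_space W \<and> isometric_iso W (dual G) J"
    unfolding dual_copy_def by (rule someI_ex)
  then show "banach_space W" "isometric_iso W (dual G) J" by (simp_all add: assms)
qed

text \<open>Evaluation followed by the inverse of \<open>J\<close>; this is the map \<open>C\<close>
  of the overview with values in the copy of the dual.\<close>

lemma dual_copy_map:
  assumes "dual_copy G = (W :: ('k, 'a) nspace, J)"
  obtains C where "bounded_by Y W C 1" "C ` car Y = car W" "\<And>y. y \<in> car Y \<Longrightarrow> J (C y) = ev y"
    "\<And>y. y \<in> car Y \<Longrightarrow> nrm W (C y) = nrm (dual G) (ev y)"
proof -
  have WJ: "banach_space W" "isometric_iso W (dual G) J" using dual_copy_props[OF assms] by simp_all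
  then have W: "normed W" and J: "lin W (dual G) J" "inj_on J (car W)" "J ` car W = car (dual G)"
    "\<And>x. x \<in> car W \<Longrightarrow> nrm (dual G) (J x) = nrm W x"
    by (auto simp: banach_space_def isometric_iso_def bij_betw_def)
  define C where "C y = inv_into (car W) J (ev y)" for y
  have C: "C y \<in> car W" "J (C y) = ev y" if "y \<in> car Y" for y
    using ev_in_dual[OF that] J(3) by (auto simp: C_def inv_into_into f_inv_into_f)
  have CI: "C y = w" if "y \<in> car Y" "w \<in> car W" "J w = ev y" for y w
    using inj_onD[OF J(2) _ C(1)[OF that(1)] that(2)] C(2)[OF that(1)] that(3) by simp
  have nC: "nrm W (C y) = nrm (dual G) (ev y)" if "y \<in> car Y" for y
    using J(4)[OF C(1)[OF that]] C(2)[OF that] by simp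
  have "lin Y W C"
    unfolding lin_def
  proof (intro conjI ballI allI)
    fix x y assume x: "x \<in> car Y" and y: "y \<in> car Y"
    show "C (x + y) = C x + C y"
      using lin_add[OF J(1) C(1)[OF x] C(1)[OF y]] lin_add[OF lin_ev x y] C[OF x] C[OF y]
      by (intro CI car_add Y W x y) simp_all
  next
    fix c x assume x: "x \<in> car Y"
    show "C (scl Y c x) = scl W c (C x)"
      using lin_scale[OF J(1) C(1)[OF x]] lin_scale[OF lin_ev x] C[OF x]
      by (intro CI car_scale Y W x) simp_all
  qed (rule C)
  then have "bounded_by Y W C 1" using nC ev_norm_le by (simp add: bounded_by_def)
  moreover have "C ` car Y = car W"
  proof
    show "C ` car Y \<subseteq> car W" using C by blast
    show "car W \<subseteq> C ` car Y"
    proof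
      fix w assume w: "w \<in> car W"
      then obtain y where "y \<in> car Y" "ev y = J w" using ev_onto[OF lin_car[OF J(1) w]] by blast
      then show "w \<in> C ` car Y" using CI[of y w] w by (metis image_eqI)
    qed
  qed
  ultimately show ?thesis using that C nC by blast
qed

end

section \<open>The pairing\<close>

lemma bilinear_linearization:
  "\<eta> \<in> car (dual G) \<Longrightarrow> bilinear_on (tensor_space n X \<beta>) G (\<lambda>z g. linearization n X \<phi> z * \<eta> g)"
  by (intro bilinear_on_mult lin_linearization dual_lin)

text \<open>The pairing nests one tensor evaluation inside another; the rules for the outer one
  require the inner one to be bilinear in the form and the vector.\<close>

lemma pairing_bilinear:
  assumes T: "normed (tensor_space n X \<beta>)" and G: "normed G" and J: "lin W (dual G) J"
    and u: "u \<in> tensors2 (tensor_space n X \<beta>) G"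
  shows "bilinear_on (Lspace n X \<beta>) W
    (\<lambda>\<phi> w. tapply (tensor_space n X \<beta>) G u (\<lambda>z g. linearization n X \<phi> z * J w g))"
proof (rule bilinear_onI)
  note b = bilinear_linearization[OF lin_car[OF J], of _ n X \<beta>]
  note add = tapply_add_right[OF T G u] and scale = tapply_scale_right[OF T G u]
  fix \<phi> w assume \<phi>: "\<phi> \<in> car (Lspace n X \<beta>)" and w: "w \<in> car W"
  have \<phi>m: "\<phi> \<in> mforms n X" using \<phi> by (simp add: in_Lspace_iff)
  let ?t = "tapply (tensor_space n X \<beta>) G u"
  show "?t (\<lambda>z g. linearization n X (\<phi> + \<phi>') z * J w g) =
    ?t (\<lambda>z g. linearization n X \<phi> z * J w g) + ?t (\<lambda>z g. linearization n X \<phi>' z * J w g)"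
    if "\<phi>' \<in> car (Lspace n X \<beta>)" for \<phi>'
    using add[OF b[OF w, of \<phi>] b[OF w, of \<phi>']] that \<phi>m
    by (simp add: linearization_linear in_Lspace_iff distrib_right)
  show "?t (\<lambda>z g. linearization n X (scl (Lspace n X \<beta>) c \<phi>) z * J w g) =
    c * ?t (\<lambda>z g. linearization n X \<phi> z * J w g)" for c
    using scale[OF b[OF w, of \<phi>], of c] \<phi>m by (simp add: linearization_linear pscale_apply mult.assoc)
  show "?t (\<lambda>z g. linearization n X \<phi> z * J (w + w') g) =
    ?t (\<lambda>z g. linearization n X \<phi> z * J w g) + ?t (\<lambda>z g. linearization n X \<phi> z * J w' g)"
    if "w' \<in> car W" for w'
    using add[OF b[OF w, of \<phi>] b[OF that, of \<phi>]] lin_add[OF J w that] by (simp add: distrib_left)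
  show "?t (\<lambda>z g. linearization n X \<phi> z * J (scl W c w) g) =
    c * ?t (\<lambda>z g. linearization n X \<phi> z * J w g)" for c
    using scale[OF b[OF w, of \<phi>], of c] lin_scale[OF J w, of c] by (simp add: pscale_apply mult.left_commute)
qed

lemma pairing_linear_right:
  shows "pairing n X \<beta> G W J u (v + v') = pairing n X \<beta> G W J u v + pairing n X \<beta> G W J u v'"
    and "pairing n X \<beta> G W J u (pscale c v) = c * pairing n X \<beta> G W J u v"
  by (simp_all add: pairing_def tapply_add_left tapply_pscale_left)

lemma pairing_linear_left:
  assumes T: "normed (tensor_space n X \<beta>)" and G: "normed G" and W: "normed W" and J: "lin W (dual G) J"
    and v: "v \<in> tensors2 (Lspace n X \<beta>) W" and u: "u \<in> tensors2 (tensor_space n X \<beta>) G"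
  shows "u' \<in> tensors2 (tensor_space n X \<beta>) G \<Longrightarrow>
      pairing n X \<beta> G W J (u + u') v = pairing n X \<beta> G W J u v + pairing n X \<beta> G W J u' v"
    and "pairing n X \<beta> G W J (pscale c u) v = c * pairing n X \<beta> G W J u v"
  unfolding pairing_def tapply_add_left tapply_pscale_left
  by (intro tapply_add_right tapply_scale_right normed_Lspace T G W v u pairing_bilinear J; assumption)+

lemma tensors2_0: "0 \<in> tensors2 V W"
  and tensors2_add: "u \<in> tensors2 V W \<Longrightarrow> v \<in> tensors2 V W \<Longrightarrow> u + v \<in> tensors2 V W"
  and tensors2_pscale: "u \<in> tensors2 V W \<Longrightarrow> pscale c u \<in> tensors2 V W"
  and tensors2_sum: "(\<And>i. i \<in> A \<Longrightarrow> h i \<in> tensors2 V W) \<Longrightarrow> sum h A \<in> tensors2 V W"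
  by (simp_all add: tensors2_def pscale.span_zero pscale.span_add pscale.span_scale pscale.span_sum)

lemma pairing_0_left:
  assumes T: "normed (tensor_space n X \<beta>)" and G: "normed G" and W: "normed W" and J: "lin W (dual G) J"
    and v: "v \<in> tensors2 (Lspace n X \<beta>) W"
  shows "pairing n X \<beta> G W J 0 v = 0"
  using pairing_linear_left(2)[OF assms tensors2_0, of 0] by simp

lemma pairing_sum_left:
  assumes T: "normed (tensor_space n X \<beta>)" and G: "normed G" and W: "normed W" and J: "lin W (dual G) J"
    and v: "v \<in> tensors2 (Lspace n X \<beta>) W" and h: "\<And>i. i \<in> A \<Longrightarrow> h i \<in> tensors2 (tensor_space n X \<beta>) G"
  shows "pairing n X \<beta> G W J (sum h A) v = (\<Sum>i\<in>A. pairing n X \<beta> G W J (h i) v)"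
  using h
proof (induction A rule: infinite_finite_induct)
  case (insert a A)
  have "pairing n X \<beta> G W J (h a + sum h A) v = pairing n X \<beta> G W J (h a) v + pairing n X \<beta> G W J (sum h A) v"
    using insert.prems by (intro pairing_linear_left[OF T G W J v] tensors2_sum) auto
  then show ?case using insert by (simp del: plus_fun_apply)
qed (simp_all add: pairing_0_left[OF T G W J v])

section \<open>Consequences of (D2) and (D3)\<close>

lemma sigma_tensor_normD:
  assumes "sigma_tensor_norm_on_duals \<nu>" "election n X Y \<beta>"
  shows "normed (nu_space \<nu> n X Y \<beta>)"
    and "p \<in> Sigma_set n X \<Longrightarrow> q \<in> Sigma_set n X \<Longrightarrow> f \<in> car (dual Y) \<Longrightarrow>
      bounded_by (nu_space \<nu> n X Y \<beta>) scalars
        (\<lambda>v. tapply (Lspace n X \<beta>) Y v (\<lambda>\<phi> y. (linearization n X \<phi> p - linearization n X \<phi> q) * f y))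
        (\<beta> (p - q) * nrm (dual Y) f)"
  using assms unfolding sigma_tensor_norm_on_duals_def by blast+

lemma sigma_tensor_norm_map_le:
  assumes \<nu>: "sigma_tensor_norm_on_duals \<nu>" and el: "election n X Y \<beta>" "election m Z W \<theta>"
    and B: "bounded_by (Lspace n X \<beta>) (Lspace m Z \<theta>) B 1" "preserves_Sigma n X \<beta> m Z \<theta> B"
    and C: "bounded_by Y W C 1" and v: "v \<in> tensors2 (Lspace n X \<beta>) Y"
  shows "\<nu> m Z W \<theta> (tmap (Lspace n X \<beta>) Y (Lspace m Z \<theta>) W B C v) \<le> \<nu> n X Y \<beta> v"
proof -
  let ?L = "Lspace n X \<beta>" and ?M = "Lspace m Z \<theta>"
  have L: "normed ?L" "normed ?M" and YW: "normed Y" "normed W"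
    using el normed_Lspace by (auto simp: election_def reasonable_crossnorm_def banach_space_def)
  have Bo: "bounded_op ?L ?M B" and Co: "bounded_op Y W C" using B C by (auto simp: bounded_op_def)
  have "bounded_by (nu_space \<nu> n X Y \<beta>) (nu_space \<nu> m Z W \<theta>) (tmap ?L Y ?M W B C) (opnorm ?L ?M B * opnorm Y W C)"
    using \<nu> el Bo B(2) Co unfolding sigma_tensor_norm_on_duals_def by blast
  then have "\<nu> m Z W \<theta> (tmap ?L Y ?M W B C v) \<le> (opnorm ?L ?M B * opnorm Y W C) * \<nu> n X Y \<beta> v"
    using v by (simp add: bounded_by_def)
  also have "\<dots> \<le> 1 * \<nu> n X Y \<beta> v"
  proof (rule mult_right_mono)
    have "opnorm ?L ?M B \<le> 1" "opnorm Y W C \<le> 1"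
      using B(1) C by (auto intro!: opnorm_le L YW simp: bounded_by_def simp del: Lspace_simps)
    moreover have "0 \<le> opnorm Y W C" by (rule opnorm_nonneg[OF YW Co])
    ultimately show "opnorm ?L ?M B * opnorm Y W C \<le> 1" using mult_mono[of "opnorm ?L ?M B" 1 "opnorm Y W C" 1] by simp
    show "0 \<le> \<nu> n X Y \<beta> v" using nrm_nonneg[OF sigma_tensor_normD(1)[OF \<nu> el(1)], of v] v by simp
  qed
  finally show ?thesis by simp
qed

text \<open>For elementary \<open>u\<close> this is (D2) with q = 0, and a general \<open>u\<close>
  is a finite sum. It makes \<open>alpha_fin\<close>, an operator norm of a pairing, a genuine
  supremum.\<close>

lemma pairing_bounded:
  assumes \<nu>: "sigma_tensor_norm_on_duals \<nu>" and el: "election n X W \<beta>"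
    and G: "normed G" and J: "bounded_op W (dual G) J" and u: "u \<in> tensors2 (tensor_space n X \<beta>) G"
  shows "bounded_op (nu_space \<nu> n X W \<beta>) scalars (pairing n X \<beta> G W J u)"
proof -
  let ?T = "tensor_space n X \<beta>" and ?L = "Lspace n X \<beta>"
  have n: "1 \<le> n" and X: "\<And>i. i < n \<Longrightarrow> normed (X i)" and T: "normed ?T" and W: "normed W"
    using el by (auto simp: election_def reasonable_crossnorm_def banach_space_def)
  note Jl = bounded_op_lin[OF J]
  have el_bound: "\<exists>C. \<forall>v\<in>tensors2 ?L W. norm (pairing n X \<beta> G W J (tprod2 ?T G (tprod n X x) g) v) \<le> C * \<nu> n X W \<beta> v"
    if x: "x \<in> families n X" and g: "g \<in> car G" for x g
  proof -
    \<comment> \<open>The functional on \<open>W\<close> induced by the factor \<open>g\<close> of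
      the elementary tensor; it takes the role of y^* in (D2).\<close>
    define f where "f = (\<lambda>w. if w \<in> car W then J w g else 0)"
    have "f \<in> car (dual W)"
      unfolding f_def
    proof (rule dual_extendI[OF _ W])
      show "lin W scalars (\<lambda>w. J w g)" using lin_add[OF Jl] lin_scale[OF Jl] by (simp add: lin_scalars_iff pscale_apply)
      fix w assume w: "w \<in> car W"
      have "norm (J w g) \<le> opnorm G scalars (J w) * nrm G g" by (rule dual_bound[OF lin_car[OF Jl w] G g])
      also have "\<dots> \<le> (opnorm W (dual G) J * nrm W w) * nrm G g"
        using opnorm_bound[OF W normed_dual[OF G] J w] by (intro mult_right_mono nrm_nonneg[OF G g]) simp
      finally show "norm (J w g) \<le> (opnorm W (dual G) J * nrm G g) * nrm W w" by (simp add: mult_ac)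
    qed
    then have "bounded_by (nu_space \<nu> n X W \<beta>) scalars
        (\<lambda>v. tapply ?L W v (\<lambda>\<phi> y. (linearization n X \<phi> (tprod n X x) - linearization n X \<phi> 0) * f y))
        (\<beta> (tprod n X x - 0) * nrm (dual W) f)"
      using x zero_in_Sigma_set[OF n X] by (intro sigma_tensor_normD(2)[OF \<nu> el]) (auto simp: Sigma_set_def)
    moreover have "tapply ?L W v (\<lambda>\<phi> y. (linearization n X \<phi> (tprod n X x) - linearization n X \<phi> 0) * f y) =
      pairing n X \<beta> G W J (tprod2 ?T G (tprod n X x) g) v" for v
      unfolding pairing_def
    proof (rule tapply_cong)
      fix \<phi> w assume w: "w \<in> car W"
      have "tapply ?T G (tprod2 ?T G (tprod n X x) g) (\<lambda>z g. linearization n X \<phi> z * J w g) =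
          linearization n X \<phi> (tprod n X x) * J w g"
        using tapply_tprod2_bilinear[OF bilinear_linearization[OF lin_car[OF Jl w], of n X \<beta> \<phi>] T G, of "tprod n X x" g]
          tprod_in_tensors[OF x] g by simp
      then show "(linearization n X \<phi> (tprod n X x) - linearization n X \<phi> 0) * f w =
          tapply ?T G (tprod2 ?T G (tprod n X x) g) (\<lambda>z g. linearization n X \<phi> z * J w g)"
        using w by (simp add: f_def linearization_def)
    qed
    ultimately show ?thesis by (auto simp: bounded_by_def)
  qed
  obtain m :: nat and x g where xg: "\<And>j. j < m \<Longrightarrow> x j \<in> families n X" "\<And>j. j < m \<Longrightarrow> g j \<in> car G"
    and u_eq: "u = (\<Sum>j<m. tprod2 ?T G (tprod n X (x j)) (g j))"
    using tensors2_tensor_space_eq_sums[OF T G u] by blast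
  have "\<exists>C. \<forall>v\<in>tensors2 ?L W. norm (pairing n X \<beta> G W J (tprod2 ?T G (tprod n X (x j)) (g j)) v) \<le> C * \<nu> n X W \<beta> v"
    if "j < m" for j using el_bound xg that by blast
  then obtain C where C: "\<And>j v. j < m \<Longrightarrow> v \<in> tensors2 ?L W \<Longrightarrow>
      norm (pairing n X \<beta> G W J (tprod2 ?T G (tprod n X (x j)) (g j)) v) \<le> C j * \<nu> n X W \<beta> v"
    by metis
  show ?thesis
  proof (rule bounded_opI)
    show "lin (nu_space \<nu> n X W \<beta>) scalars (pairing n X \<beta> G W J u)"
      by (simp add: lin_scalars_iff pairing_linear_right)
    fix v assume "v \<in> car (nu_space \<nu> n X W \<beta>)"
    then have v: "v \<in> tensors2 ?L W" by simp
    have "pairing n X \<beta> G W J u v = (\<Sum>j<m. pairing n X \<beta> G W J (tprod2 ?T G (tprod n X (x j)) (g j)) v)"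
      unfolding u_eq using xg tprod_in_tensors[of _ n X]
      by (intro pairing_sum_left[OF T G W Jl v] tprod2_in_tensors2) auto
    also have "norm \<dots> \<le> (\<Sum>j<m. C j * \<nu> n X W \<beta> v)"
      using C v by (intro sum_norm_le) auto
    finally have "norm (pairing n X \<beta> G W J u v) \<le> (\<Sum>j<m. C j * \<nu> n X W \<beta> v)" .
    then show "nrm scalars (pairing n X \<beta> G W J u v) \<le> (\<Sum>j<m. C j) * nrm (nu_space \<nu> n X W \<beta>) v"
      by (simp add: sum_distrib_right)
  qed
qed

section \<open>Isometric containment\<close>

lemma electionD:
  assumes "election n X Y \<beta>"
  shows "1 \<le> n" "\<And>i. i < n \<Longrightarrow> normed (X i)" "reasonable_crossnorm n X \<beta>"
    "normed (tensor_space n X \<beta>)" "normed (Lspace n X \<beta>)" "normed Y"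
  using assms normed_Lspace by (auto simp: election_def reasonable_crossnorm_def banach_space_def)

text \<open>The canonical map of \<open>Y\<close> into its bidual. Used as \<open>J\<close>, with
  \<open>G\<close> the dual of \<open>Y\<close> and \<open>W\<close> equal to \<open>Y\<close>, it
  turns \<open>pairing\<close> into the evaluation of the theorem, so that the global and the finite
  dimensional pairing are instances of one definition.\<close>

definition bidual_embedding :: "('k::real_or_complex, 'a::ab_group_add) nspace \<Rightarrow> 'a \<Rightarrow> ('a \<Rightarrow> 'k) \<Rightarrow> 'k" where
  "bidual_embedding Y y = (\<lambda>f. if f \<in> car (dual Y) then f y else 0)"

lemma lin_bidual_embedding:
  fixes Y :: "('k::real_or_complex, 'a::ab_group_add) nspace"
  assumes Y: "normed Y"
  shows "lin Y (dual (dual Y)) (bidual_embedding Y)"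
proof -
  have "bidual_embedding Y y \<in> car (dual (dual Y))" if y: "y \<in> car Y" for y
    unfolding bidual_embedding_def
  proof (rule dual_extendI[OF _ normed_dual[OF Y]])
    show "lin (dual Y) scalars (\<lambda>f. f y)" by (simp add: lin_scalars_iff pscale_apply)
    show "norm (f y) \<le> nrm Y y * nrm (dual Y) f" if "f \<in> car (dual Y)" for f
      using dual_bound[OF that Y y] by (simp add: mult.commute)
  qed
  then show ?thesis
    using lin_add[OF dual_lin] lin_scale[OF dual_lin]
    by (auto simp: lin_def bidual_embedding_def fun_eq_iff pscale_apply)
qed

text \<open>Allows (D3) to be used when only the second factor is mapped, namely from the copy of
  the dual to the quotient.\<close>

lemma preserves_Sigma_id: "preserves_Sigma n X \<beta> n X \<beta> (\<lambda>\<phi>. \<phi>)"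
proof -
  have "adjoint (Lspace n X \<beta>) (\<lambda>\<phi>. \<phi>) (canon n X \<beta> p) = canon n X \<beta> p" for p
    by (auto simp: adjoint_def canon_def fun_eq_iff)
  then show ?thesis by (auto simp: preserves_Sigma_def)
qed

lemma bounded_by_id: "bounded_by V V (\<lambda>x. x) 1"
  by (simp add: bounded_by_def lin_def)

locale restricted_election = tensor_restriction n X \<beta> E + dual_subspace Y F
  for n and X :: "nat \<Rightarrow> ('k::real_or_complex, 'a::ab_group_add) nspace" and \<beta> E
    and Y :: "('k, 'a) nspace" and F +
  fixes \<nu> :: "('k, 'a) assignment"
    and W :: "('k, 'a) nspace" and J :: "'a \<Rightarrow> ('a \<Rightarrow> 'k) \<Rightarrow> 'k"
  assumes \<nu>: "sigma_tensor_norm_on_duals \<nu>" and el: "election n X Y \<beta>"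
    and WJ: "dual_copy ((dual Y)\<lparr>car := F\<rparr>) = (W, J)"
begin

lemma W: "banach_space W" "normed W" and J_lin: "lin W (dual G) J"
  and J_inj: "inj_on J (car W)" and J_bounded: "bounded_op W (dual G) J"
proof -
  show "banach_space W" using dual_copy_props[OF WJ] by simp
  then show "normed W" by (simp add: banach_space_def)
  show l: "lin W (dual G) J" and "inj_on J (car W)"
    using dual_copy_props[OF WJ] by (auto simp: isometric_iso_def bij_betw_def)
  show "bounded_op W (dual G) J"
    using dual_copy_props(2)[OF WJ] by (intro bounded_opI[OF l, of 1]) (simp add: isometric_iso_def)
qed

lemma elW: "election n XE W \<beta>E"
  by (rule election_restr[OF W(1)])

abbreviation "pairX \<equiv> pairing n X \<beta> (dual Y) Y (bidual_embedding Y)"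
abbreviation "pairE \<equiv> pairing n XE \<beta>E G W J"
abbreviation "TX \<equiv> tensor_space n X \<beta>"
abbreviation "LX \<equiv> Lspace n X \<beta>"

abbreviation "inclG \<equiv> tmap TXE G TX (dual Y) (incE) id"

lemma bounded_restr: "bounded_by LX LXE (resE) 1"
  unfolding bounded_by_def using lin_restr restr_in_Lspace(2) by simp

text \<open>After \<open>tapply_tmap\<close> has moved all maps onto the forms, the integrands
  coincide: linearizing a restricted form is linearizing after inclusion, and \<open>J (C y)\<close>
  is evaluation at y on \<open>F\<close>.\<close>

lemma pairing_restr:
  assumes C: "lin Y W C" and JC: "\<And>y. y \<in> car Y \<Longrightarrow> J (C y) = ev y"
    and u: "u \<in> tensors2 TXE G"
  shows "pairX (inclG u) v =
    pairE u (tmap LX Y LXE W (resE) C v)"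
proof -
  have id: "lin G (dual Y) id" using F_sub by (auto simp: lin_def)
  have "pairE u (tmap LX Y LXE W (resE) C v) =
    tapply LX Y v (\<lambda>\<phi> y. tapply TXE G u (\<lambda>z g. linearization n XE (resE \<phi>) z * J (C y) g))"
    unfolding pairing_def
    by (rule tapply_tmap[OF normed_Lspace[OF TE] W(2) pairing_bilinear[OF TE G J_lin u] lin_restr C])
  also have "\<dots> = tapply LX Y v (\<lambda>\<phi> y. tapply TX (dual Y) (inclG u)
      (\<lambda>z g. linearization n X \<phi> z * bidual_embedding Y y g))"
  proof (rule tapply_cong)
    fix \<phi> y assume \<phi>: "\<phi> \<in> car LX" and y: "y \<in> car Y"
    have "tapply TX (dual Y) (inclG u)
        (\<lambda>z g. linearization n X \<phi> z * bidual_embedding Y y g) =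
      tapply TXE G u (\<lambda>z g. linearization n X \<phi> (incE z) * bidual_embedding Y y (id g))"
      by (rule tapply_tmap[OF T normed_dual[OF Y] bilinear_linearization lin_incl id])
         (rule lin_car[OF lin_bidual_embedding[OF Y] y])
    also have "\<dots> = tapply TXE G u (\<lambda>z g. linearization n XE (resE \<phi>) z * J (C y) g)"
    proof (rule tapply_cong)
      fix z g assume z: "z \<in> car TXE" and g: "g \<in> car G"
      have "bidual_embedding Y y g = J (C y) g"
        using g F_sub(1) JC[OF y] by (auto simp: bidual_embedding_def ev_def)
      then show "linearization n X \<phi> (incE z) * bidual_embedding Y y (id g) =
          linearization n XE (resE \<phi>) z * J (C y) g"
        using linearization_restr[of \<phi> z] z \<phi> by (simp add: in_Lspace_iff)
    qed
    finally show "tapply TXE G u (\<lambda>z g. linearization n XE (resE \<phi>) z * J (C y) g) =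
      tapply TX (dual Y) (inclG u)
        (\<lambda>z g. linearization n X \<phi> z * bidual_embedding Y y g)" by simp
  qed
  finally show ?thesis by (simp add: pairing_def)
qed

lemma alpha_fin_eq: "alpha_fin \<nu> n XE \<beta>E G u = opnorm (nu_space \<nu> n XE W \<beta>E) scalars (pairE u)"
  by (simp add: alpha_fin_def WJ)

lemma bounded_pairing:
  "u \<in> tensors2 TXE G \<Longrightarrow> bounded_op (nu_space \<nu> n XE W \<beta>E) scalars (pairE u)"
  by (rule pairing_bounded[OF \<nu> elW G J_bounded])

lemma alpha_fin_nonneg: "u \<in> tensors2 TXE G \<Longrightarrow> 0 \<le> alpha_fin \<nu> n XE \<beta>E G u"
  unfolding alpha_fin_eq
  by (intro opnorm_nonneg sigma_tensor_normD(1)[OF \<nu> elW] normed_scalars bounded_pairing)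

lemma norm_pairing_le_alpha_fin:
  assumes u: "u \<in> tensors2 TXE G" and v: "v \<in> tensors2 LX Y"
  shows "norm (pairX (inclG u) v)
    \<le> \<nu> n X Y \<beta> v * alpha_fin \<nu> n XE \<beta>E G u"
proof -
  obtain C where C: "bounded_by Y W C 1" "\<And>y. y \<in> car Y \<Longrightarrow> J (C y) = ev y"
    by (rule dual_copy_map[OF WJ]) (rule that, assumption+)
  have Cl: "lin Y W C" using C(1) by (simp add: bounded_by_def)
  define v' where "v' = tmap LX Y LXE W (resE) C v"
  have v': "v' \<in> tensors2 LXE W"
    unfolding v'_def by (rule tmap_in_tensors2[OF lin_restr Cl normed_Lspace[OF T] Y v])
  have "\<nu> n XE W \<beta>E v' \<le> \<nu> n X Y \<beta> v"
    unfolding v'_def by (rule sigma_tensor_norm_map_le[OF \<nu> el elW bounded_restr restr_preserves_Sigma C(1) v])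
  then have "alpha_fin \<nu> n XE \<beta>E G u * \<nu> n XE W \<beta>E v' \<le> alpha_fin \<nu> n XE \<beta>E G u * \<nu> n X Y \<beta> v"
    by (intro mult_left_mono alpha_fin_nonneg u)
  moreover have "norm (pairE u v') \<le> alpha_fin \<nu> n XE \<beta>E G u * \<nu> n XE W \<beta>E v'"
    using opnorm_bound[OF sigma_tensor_normD(1)[OF \<nu> elW] normed_scalars bounded_pairing[OF u], of v'] v'
    by (simp add: alpha_fin_eq)
  ultimately show ?thesis
    using pairing_restr[OF Cl C(2) u, of v] by (simp add: v'_def mult.commute)
qed

text \<open>Both factors have finite coordinates: \<phi> \<otimes> w is the sum over k and a of
  \<phi> k * J w a times \<open>\<Phi> k\<close> \<otimes> \<open>\<omega> a\<close>. A linear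
  functional is therefore fixed by its values on these finitely many tensors, and the coefficients
  \<phi> k * J w a are pairings with the tensors \<open>el2 k a\<close>.\<close>

lemma functional_eq_pairing:
  assumes \<xi>: "lin (nu_space \<nu> n XE W \<beta>E) scalars \<xi>"
  obtains u where "u \<in> tensors2 TXE G"
    "\<And>v. v \<in> tensors2 LXE W \<Longrightarrow> pairE u v = \<xi> v"
proof -
  let ?t = "tprod2 LXE W"
  interpret VW: vector_space "scl W" by (rule normed_vector_space[OF W(2)])
  note LE = normed_Lspace[OF TE] and N = sigma_tensor_normD(1)[OF \<nu> elW]
  obtain K \<Phi> where K: "finite K" "K \<subseteq> families n XE" and \<Phi>: "\<And>k. k \<in> K \<Longrightarrow> \<Phi> k \<in> car LXE"
    and repL: "\<And>\<phi>. \<phi> \<in> car LXE \<Longrightarrow> \<phi> = (\<Sum>k\<in>K. pscale (\<phi> k) (\<Phi> k))"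
    using Lspace_restr_reproduce by blast
  obtain A where A: "finite A" "F = pscale.span A" using F by (auto simp: fin_dim_subspace_def)
  have AF: "a \<in> F" if "a \<in> A" for a using that A pscale.span_base by blast
  have "\<exists>v. (\<forall>k\<in>A. v k \<in> car W) \<and> (\<forall>w\<in>car W. \<forall>a\<in>A. J w a = (\<Sum>k\<in>A. J w k * J (v k) a))"
    using lin_add[OF J_lin] lin_scale[OF J_lin]
    by (intro VW.finite_functionals_reproduce[OF A(1) normed_subspace_car[OF W(2)], of "\<lambda>a w. J w a"])
       (simp_all add: pscale_apply)
  then obtain \<omega> where \<omega>: "\<And>k. k \<in> A \<Longrightarrow> \<omega> k \<in> car W"
    and repJ: "\<And>w a. w \<in> car W \<Longrightarrow> a \<in> A \<Longrightarrow> J w a = (\<Sum>k\<in>A. J w k * J (\<omega> k) a)" by blast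
  \<comment> \<open>The reproduction formula determines \<open>J w\<close> only on \<open>A\<close>;
    linearity carries it to the span \<open>F\<close>, and injectivity of \<open>J\<close> brings it
    back to \<open>W\<close>.\<close>
  have repW: "w = (\<Sum>a\<in>A. scl W (J w a) (\<omega> a))" if w: "w \<in> car W" for w
  proof -
    define w' where "w' = (\<Sum>a\<in>A. scl W (J w a) (\<omega> a))"
    have w': "w' \<in> car W" unfolding w'_def using \<omega> by (intro car_sum car_scale W)
    have "J w' = (\<Sum>a\<in>A. J (scl W (J w a) (\<omega> a)))"
      unfolding w'_def using \<omega> by (intro lin_sum[OF J_lin W(2)] car_scale W)
    also have "\<dots> = (\<Sum>a\<in>A. pscale (J w a) (J (\<omega> a)))"
      using lin_scale[OF J_lin \<omega>] by (intro sum.cong) auto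
    finally have Jw': "J w' f = (\<Sum>a\<in>A. J w a * J (\<omega> a) f)" for f
      by (simp add: sum_apply pscale_apply)
    have lJ: "lin G scalars (J w)" "lin G scalars (J w')"
      using lin_car[OF J_lin w] lin_car[OF J_lin w'] dual_lin by blast+
    have "J w f = J w' f" if "f \<in> F" for f
    proof (rule lin_eq_on_span[OF G lJ])
      show "car G = module.span (scl G) A" "f \<in> car G" using A(2) that by simp_all
      show "J w a = J w' a" if "a \<in> A" for a using repJ[OF w that] Jw'[of a] by simp
    qed
    then have "J w f = J w' f" for f
      using lin_car[OF J_lin w] lin_car[OF J_lin w'] by (cases "f \<in> F") (auto simp: in_dual_iff)
    then have "J w = J w'" by blast
    then show ?thesis using inj_onD[OF J_inj _ w w'] by (simp add: w'_def)
  qed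
  define el2 where "el2 k a = tprod2 TXE G (tprod n XE k) a" for k a
  have el2: "el2 k a \<in> tensors2 TXE G" if "k \<in> K" "a \<in> A" for k a
    unfolding el2_def using that K(2) AF by (intro tprod2_in_tensors2) (auto simp: tprod_in_tensors)
  \<comment> \<open>The values of \<xi> on the coordinate tensors become the coefficients on the
    dual side.\<close>
  define u where "u = (\<Sum>k\<in>K. \<Sum>a\<in>A. pscale (\<xi> (?t (\<Phi> k) (\<omega> a))) (el2 k a))"
  have u: "u \<in> tensors2 TXE G" unfolding u_def using el2 by (intro tensors2_sum tensors2_pscale)
  have elem: "pairE u (?t \<phi> w) = \<xi> (?t \<phi> w)"
    if \<phi>: "\<phi> \<in> car LXE" and w: "w \<in> car W" for \<phi> w
  proof -
    have v: "?t \<phi> w \<in> tensors2 LXE W" by (rule tprod2_in_tensors2[OF \<phi> w])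
    note lin1 = pairing_linear_left(2)[OF TE G W(2) J_lin v] and sum1 = pairing_sum_left[OF TE G W(2) J_lin v]
    have pe: "pairE (el2 k a) (?t \<phi> w) = \<phi> k * J w a" if "k \<in> K" "a \<in> A" for k a
      unfolding el2_def using that K(2) AF \<phi> w
      by (intro pairing_tprod2 TE LE G W J_lin) auto
    have "pairE u (?t \<phi> w) =
      (\<Sum>k\<in>K. pairE (\<Sum>a\<in>A. pscale (\<xi> (?t (\<Phi> k) (\<omega> a))) (el2 k a)) (?t \<phi> w))"
      unfolding u_def using el2 by (intro sum1 tensors2_sum tensors2_pscale)
    also have "\<dots> = (\<Sum>k\<in>K. \<Sum>a\<in>A. pairE (pscale (\<xi> (?t (\<Phi> k) (\<omega> a))) (el2 k a)) (?t \<phi> w))"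
      using el2 by (intro sum.cong refl sum1 tensors2_pscale)
    also have "\<dots> = (\<Sum>k\<in>K. \<Sum>a\<in>A. \<xi> (?t (\<Phi> k) (\<omega> a)) * (\<phi> k * J w a))"
      using el2 pe by (intro sum.cong refl) (simp add: lin1)
    finally have 1: "pairE u (?t \<phi> w) =
      (\<Sum>k\<in>K. \<Sum>a\<in>A. \<xi> (?t (\<Phi> k) (\<omega> a)) * (\<phi> k * J w a))" .
    have "?t \<phi> w = ?t (\<Sum>k\<in>K. pscale (\<phi> k) (\<Phi> k)) w"
      using repL[OF \<phi>] by simp
    also have "\<dots> = (\<Sum>k\<in>K. ?t (pscale (\<phi> k) (\<Phi> k)) w)"
      using \<Phi> car_scale[OF LE] by (intro tprod2_sum_left[OF LE _ w]) simp
    also have "\<dots> = (\<Sum>k\<in>K. \<Sum>a\<in>A. pscale (\<phi> k * J w a) (?t (\<Phi> k) (\<omega> a)))"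
    proof (rule sum.cong[OF refl])
      fix k assume k: "k \<in> K"
      have "?t (\<Phi> k) w = ?t (\<Phi> k) (\<Sum>a\<in>A. scl W (J w a) (\<omega> a))"
        using repW[OF w] by simp
      also have "\<dots> = (\<Sum>a\<in>A. ?t (\<Phi> k) (scl W (J w a) (\<omega> a)))"
        using \<omega> by (intro tprod2_sum_right[OF W(2) _ \<Phi>[OF k]] car_scale W)
      also have "\<dots> = (\<Sum>a\<in>A. pscale (J w a) (?t (\<Phi> k) (\<omega> a)))"
        using \<omega> by (intro sum.cong refl tprod2_scale_right[OF \<Phi>[OF k]])
      finally have "?t (\<Phi> k) w = (\<Sum>a\<in>A. pscale (J w a) (?t (\<Phi> k) (\<omega> a)))" .
      then show "?t (pscale (\<phi> k) (\<Phi> k)) w =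
          (\<Sum>a\<in>A. pscale (\<phi> k * J w a) (?t (\<Phi> k) (\<omega> a)))"
        using tprod2_scale_left[OF \<Phi>[OF k] w, of "\<phi> k"] by (simp add: pscale.scale_sum_right)
    qed
    finally have 2: "?t \<phi> w = (\<Sum>k\<in>K. \<Sum>a\<in>A. pscale (\<phi> k * J w a) (?t (\<Phi> k) (\<omega> a)))" .
    have el3: "?t (\<Phi> k) (\<omega> a) \<in> tensors2 LXE W" if "k \<in> K" "a \<in> A" for k a
      using that \<Phi> \<omega> by (intro tprod2_in_tensors2)
    have "\<xi> (?t \<phi> w) =
      (\<Sum>k\<in>K. \<xi> (\<Sum>a\<in>A. pscale (\<phi> k * J w a) (?t (\<Phi> k) (\<omega> a))))"
      unfolding 2 using el3 by (intro lin_sum[OF \<xi> N]) (simp add: tensors2_sum tensors2_pscale)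
    also have "\<dots> = (\<Sum>k\<in>K. \<Sum>a\<in>A. \<xi> (pscale (\<phi> k * J w a) (?t (\<Phi> k) (\<omega> a))))"
      using el3 by (intro sum.cong refl lin_sum[OF \<xi> N]) (simp add: tensors2_pscale)
    also have "\<dots> = (\<Sum>k\<in>K. \<Sum>a\<in>A. (\<phi> k * J w a) * \<xi> (?t (\<Phi> k) (\<omega> a)))"
      using lin_scale[OF \<xi>] el3 by (intro sum.cong refl) simp
    finally show ?thesis unfolding 1 by (simp add: mult.commute)
  qed
  have "pairE u v = \<xi> v" if "v \<in> tensors2 LXE W" for v
  proof (rule lin_eq_on_span[OF N _ \<xi>])
    show "lin (nu_space \<nu> n XE W \<beta>E) scalars (pairE u)"
      by (simp add: lin_scalars_iff pairing_linear_right)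
    show "car (nu_space \<nu> n XE W \<beta>E) = module.span (scl (nu_space \<nu> n XE W \<beta>E))
        {?t \<phi> w | \<phi> w. \<phi> \<in> car LXE \<and> w \<in> car W}"
      by (simp add: tensors2_def)
  qed (use elem that in auto)
  then show ?thesis using that u by blast
qed

end

section \<open>The infimum that defines \<open>alpha\<close>, and the upper estimate\<close>

lemma restricted_election_exists:
  fixes \<nu> :: "('k::real_or_complex, 'a::ab_group_add) assignment"
    and X :: "nat \<Rightarrow> ('k, 'a) nspace" and Y :: "('k, 'a) nspace"
  assumes \<nu>: "sigma_tensor_norm_on_duals \<nu>" and el: "election n X Y \<beta>"
    and E: "\<forall>i<n. fin_dim_subspace (X i) (E i)" and F: "fin_dim_subspace (dual Y) F"
  obtains W J where "restricted_election n X \<beta> E Y F \<nu> W J"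
proof -
  obtain W :: "('k, 'a) nspace" and J where "dual_copy ((dual Y)\<lparr>car := F\<rparr>) = (W, J)" by fastforce
  then have "restricted_election n X \<beta> E Y F \<nu> W J"
    using electionD[OF el] assms by unfold_locales auto
  then show ?thesis using that by blast
qed

text \<open>The set whose infimum is \<open>alpha\<close>, named so that its nonemptiness and its
  lower bound can be stated separately.\<close>

definition alpha_values :: "('k::real_or_complex, 'a::ab_group_add) assignment \<Rightarrow> nat \<Rightarrow>
    (nat \<Rightarrow> ('k, 'a) nspace) \<Rightarrow> (('k, 'a) tensor \<Rightarrow> real) \<Rightarrow> ('k, 'g::ab_group_add) nspace \<Rightarrow>
    ('k, ('k, 'a) tensor, 'g) tensor2 \<Rightarrow> real set" where
  "alpha_values \<nu> n X \<beta> G u =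
     {alpha_fin \<nu> n (subs X E) (norm_restr n X E \<beta>) (G\<lparr>car := F\<rparr>) u' | E F u'.
          (\<forall>i<n. fin_dim_subspace (X i) (E i)) \<and> fin_dim_subspace G F \<and>
          u' \<in> tensors2 (tensor_space n (subs X E) (norm_restr n X E \<beta>)) (G\<lparr>car := F\<rparr>) \<and>
          tmap (tensor_space n (subs X E) (norm_restr n X E \<beta>)) (G\<lparr>car := F\<rparr>)
            (tensor_space n X \<beta>) G (incl n X E) id u' = u}"

lemma alpha_eq_Inf: "alpha \<nu> n X \<beta> G u = Inf (alpha_values \<nu> n X \<beta> G u)"
  by (simp add: alpha_def alpha_values_def)

lemma alpha_valuesE:
  fixes \<nu> :: "('k::real_or_complex, 'a::ab_group_add) assignment"
    and X :: "nat \<Rightarrow> ('k, 'a) nspace" and Y :: "('k, 'a) nspace"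
  assumes \<nu>: "sigma_tensor_norm_on_duals \<nu>" and el: "election n X Y \<beta>" and s: "s \<in> alpha_values \<nu> n X \<beta> (dual Y) u"
  obtains E F W J u' where "restricted_election n X \<beta> E Y F \<nu> W J"
    "u' \<in> tensors2 (tensor_space n (subs X E) (norm_restr n X E \<beta>)) ((dual Y)\<lparr>car := F\<rparr>)"
    "u = tmap (tensor_space n (subs X E) (norm_restr n X E \<beta>)) ((dual Y)\<lparr>car := F\<rparr>)
       (tensor_space n X \<beta>) (dual Y) (incl n X E) id u'"
    "s = alpha_fin \<nu> n (subs X E) (norm_restr n X E \<beta>) ((dual Y)\<lparr>car := F\<rparr>) u'"
proof -
  obtain E F u' where "\<forall>i<n. fin_dim_subspace (X i) (E i)" "fin_dim_subspace (dual Y) F"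
    and u': "u' \<in> tensors2 (tensor_space n (subs X E) (norm_restr n X E \<beta>)) ((dual Y)\<lparr>car := F\<rparr>)"
      "u = tmap (tensor_space n (subs X E) (norm_restr n X E \<beta>)) ((dual Y)\<lparr>car := F\<rparr>)
        (tensor_space n X \<beta>) (dual Y) (incl n X E) id u'"
      "s = alpha_fin \<nu> n (subs X E) (norm_restr n X E \<beta>) ((dual Y)\<lparr>car := F\<rparr>) u'"
    using s unfolding alpha_values_def by blast
  moreover from this(1,2) obtain W J where "restricted_election n X \<beta> E Y F \<nu> W J"
    by (rule restricted_election_exists[OF \<nu> el])
  ultimately show ?thesis using that by blast
qed

lemma alpha_bdd_below:
  fixes \<nu> :: "('k::real_or_complex, 'a::ab_group_add) assignment"
    and X :: "nat \<Rightarrow> ('k, 'a) nspace" and Y :: "('k, 'a) nspace"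
  assumes "sigma_tensor_norm_on_duals \<nu>" "election n X Y \<beta>"
  shows "bdd_below (alpha_values \<nu> n X \<beta> (dual Y) u)"
  by (rule bdd_belowI[of _ 0], erule alpha_valuesE[OF assms]) (simp add: restricted_election.alpha_fin_nonneg)

text \<open>The components of a single representation of \<open>u\<close> span finite dimensional
  subspaces that already contain it.\<close>

lemma alpha_values_nonempty:
  fixes \<nu> :: "('k::real_or_complex, 'a::ab_group_add) assignment"
    and X :: "nat \<Rightarrow> ('k, 'a) nspace" and Y :: "('k, 'a) nspace"
  assumes el: "election n X Y \<beta>" and u: "u \<in> tensors2 (tensor_space n X \<beta>) (dual Y)"
  shows "alpha_values \<nu> n X \<beta> (dual Y) u \<noteq> {}"
proof -
  note D = electionD[OF el]
  let ?T = "tensor_space n X \<beta>"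
  obtain m :: nat and x g where x: "\<And>j. j < m \<Longrightarrow> x j \<in> families n X" and g: "\<And>j. j < m \<Longrightarrow> g j \<in> car (dual Y)"
    and u_eq: "u = (\<Sum>j<m. tprod2 ?T (dual Y) (tprod n X (x j)) (g j))"
    using tensors2_tensor_space_eq_sums[OF D(4) normed_dual[OF D(6)] u] by blast
  define E where "E i = module.span (scl (X i)) ((\<lambda>j. x j i) ` {..<m})" for i
  define F where "F = pscale.span (g ` {..<m})"
  have E: "fin_dim_subspace (X i) (E i)" if "i < n" for i
    unfolding E_def using families_component[OF x that] by (intro fin_dim_subspaceI D(2) that) auto
  have F: "fin_dim_subspace (dual Y) F"
    unfolding F_def using fin_dim_subspaceI[OF normed_dual[OF D(6)], of "g ` {..<m}"] g by auto
  interpret tensor_restriction n X \<beta> E using D E by unfold_locales auto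
  interpret dual_subspace Y F using D F by unfold_locales auto
  have xE: "x j \<in> families n XE" if "j < m" for j
  proof -
    have "x j i \<in> E i" if "i < n" for i
      unfolding E_def using \<open>j < m\<close> normed_vector_space[OF X[OF that]]
      by (intro module.span_base) (auto simp: module_iff_vector_space)
    then show ?thesis using x[OF that] by (auto simp: families_def PiE_iff)
  qed
  have gF: "g j \<in> F" if "j < m" for j unfolding F_def using that by (intro pscale.span_base) auto
  let ?TE = "tensor_space n XE \<beta>E"
  define u' where "u' = (\<Sum>j<m. tprod2 ?TE G (tprod n XE (x j)) (g j))"
  have u': "u' \<in> tensors2 ?TE G"
    unfolding u'_def by (intro tensors2_sum tprod2_in_tensors2) (auto intro: tprod_in_tensors xE gF)
  have lin_id: "lin G (dual Y) id" using F_sub by (auto simp: lin_def)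
  have "tmap ?TE G ?T (dual Y) (incl n X E) id u' =
      (\<Sum>j<m. tmap ?TE G ?T (dual Y) (incl n X E) id (tprod2 ?TE G (tprod n XE (x j)) (g j)))"
    unfolding u'_def by (rule tmap_sum)
  also have "\<dots> = u"
    unfolding u_eq
  proof (rule sum.cong[OF refl])
    fix j assume "j \<in> {..<m}"
    then have j: "j < m" by simp
    show "tmap ?TE G ?T (dual Y) (incl n X E) id (tprod2 ?TE G (tprod n XE (x j)) (g j)) =
        tprod2 ?T (dual Y) (tprod n X (x j)) (g j)"
      using tmap_tprod2[OF lin_incl lin_id TE G, of "tprod n XE (x j)" "g j"] tprod_in_tensors[OF xE[OF j]] gF[OF j]
      by (simp add: incl_tprod'[OF xE[OF j]])
  qed
  finally show ?thesis using E F u' unfolding alpha_values_def by blast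
qed

lemma norm_pairing_le_alpha:
  fixes \<nu> :: "('k::real_or_complex, 'a::ab_group_add) assignment"
    and X :: "nat \<Rightarrow> ('k, 'a) nspace" and Y :: "('k, 'a) nspace"
  assumes \<nu>: "sigma_tensor_norm_on_duals \<nu>" and el: "election n X Y \<beta>"
    and v: "v \<in> tensors2 (Lspace n X \<beta>) Y" and u: "u \<in> tensors2 (tensor_space n X \<beta>) (dual Y)"
  shows "norm (pairing n X \<beta> (dual Y) Y (bidual_embedding Y) u v) \<le> \<nu> n X Y \<beta> v * alpha \<nu> n X \<beta> (dual Y) u"
proof -
  define S where "S = alpha_values \<nu> n X \<beta> (dual Y) u"
  let ?p = "norm (pairing n X \<beta> (dual Y) Y (bidual_embedding Y) u v)"
  have le: "?p \<le> \<nu> n X Y \<beta> v * s" if "s \<in> S" for s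
    using that unfolding S_def
    by (rule alpha_valuesE[OF \<nu> el]) (simp add: restricted_election.norm_pairing_le_alpha_fin v)
  have ne: "S \<noteq> {}" unfolding S_def by (rule alpha_values_nonempty[OF el u])
  have nn: "0 \<le> \<nu> n X Y \<beta> v" using nrm_nonneg[OF sigma_tensor_normD(1)[OF \<nu> el], of v] v by simp
  show ?thesis
  proof (cases "\<nu> n X Y \<beta> v = 0")
    \<comment> \<open>Division by the norm of \<open>v\<close> fails here, but then the estimate for
      any one member of \<open>S\<close> already makes the pairing vanish.\<close>
    case True
    obtain s where "s \<in> S" using ne by blast
    from le[OF this] show ?thesis by (simp add: True)
  next
    case False
    then have pos: "0 < \<nu> n X Y \<beta> v" using nn by simp
    have "?p / \<nu> n X Y \<beta> v \<le> Inf S"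
      using le pos by (intro cInf_greatest[OF ne]) (simp add: divide_le_eq mult.commute)
    then show ?thesis using pos unfolding alpha_eq_Inf S_def by (simp add: divide_le_eq mult.commute)
  qed
qed

text \<open>\<open>F\<close> is the annihilator of \<open>L\<close>, the copy of the dual of the
  quotient inside the dual of \<open>Y\<close>. It is finite dimensional because its members are
  determined on finitely many vectors that span \<open>Y\<close> together with \<open>L\<close>; its
  unit ball is large enough to norm the quotient.\<close>

lemma quotient_functionals:
  fixes Y :: "('k::real_or_complex, 'a::ab_group_add) nspace" and L
  defines "F \<equiv> {f \<in> car (dual Y). \<forall>l\<in>L. f l = 0}"
  assumes Y: "normed Y" and L: "closed_fin_codim_subspace Y L" and Q: "quotient_map Y L W Q"
  shows "fin_dim_subspace (dual Y) F"
    and "\<And>y. y \<in> car Y \<Longrightarrow> nrm W (Q y) \<le> opnorm ((dual Y)\<lparr>car := F\<rparr>) scalars (\<lambda>f. if f \<in> F then f y else 0)"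
proof -
  interpret V: vector_space "scl Y" by (rule normed_vector_space[OF Y])
  obtain B where B: "finite B" "car Y = V.span (L \<union> B)"
    using L by (auto simp: closed_fin_codim_subspace_def)
  have L0: "0 \<in> L" and LY: "L \<subseteq> car Y" using L V.subspace_0 by (auto simp: closed_fin_codim_subspace_def)
  have Fsub: "F \<subseteq> car (dual Y)" by (auto simp: F_def)
  note D = normed_dual[OF Y]
  have F: "pscale.subspace F"
  proof (rule pscale.subspaceI)
    show "0 \<in> F" using car_0[OF D] by (simp add: F_def)
    show "f + g \<in> F" if "f \<in> F" "g \<in> F" for f g using that car_add[OF D] by (simp add: F_def)
    show "pscale c f \<in> F" if "f \<in> F" for c f using that car_scale[OF D, of f c] by (simp add: F_def pscale_apply)
  qed
  \<comment> \<open>Evaluations at \<open>B\<close> serve as coordinates on \<open>F\<close>. The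
    formula holds on \<open>B\<close>, and trivially on \<open>L\<close>, hence on all of
    \<open>Y\<close>; so the \<open>v b\<close> span \<open>F\<close>.\<close>
  obtain v where v: "\<And>b. b \<in> B \<Longrightarrow> v b \<in> F"
    and rep: "\<And>f j. f \<in> F \<Longrightarrow> j \<in> B \<Longrightarrow> f j = (\<Sum>b\<in>B. f b * v b j)"
    using pscale.finite_functionals_reproduce[OF B(1) F, of "\<lambda>b f. f b"] by (auto simp: pscale_apply)
  have "f \<in> pscale.span (v ` B)" if f: "f \<in> F" for f
  proof -
    define h where "h = (\<Sum>b\<in>B. pscale (f b) (v b))"
    have hF: "h \<in> F" unfolding h_def using v F by (intro pscale.subspace_sum pscale.subspace_scale)
    have ap: "h x = (\<Sum>b\<in>B. f b * v b x)" for x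
      by (simp add: h_def sum_apply pscale_apply)
    have "f = h"
    proof
      fix x
      show "f x = h x"
      proof (cases "x \<in> car Y")
        case True
        show ?thesis
        proof (rule lin_eq_on_span[OF Y _ _ B(2) _ True])
          show "lin Y scalars f" "lin Y scalars h" using f hF Fsub dual_lin by blast+
          show "f y = h y" if "y \<in> L \<union> B" for y
          proof (cases "y \<in> B")
            case True
            then show ?thesis using rep[OF f True] by (simp add: ap)
          next
            case False
            then show ?thesis using that f hF by (auto simp: F_def)
          qed
        qed
      next
        case False
        moreover have "f \<in> car (dual Y)" "h \<in> car (dual Y)" using f hF Fsub by blast+
        ultimately show ?thesis by (simp add: in_dual_iff)
      qed
    qed
    then show ?thesis unfolding h_def by (metis (no_types, lifting) pscale.span_sum pscale.span_scale pscale.span_base imageI)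
  qed
  moreover have "pscale.span (v ` B) \<subseteq> F" using v F by (intro pscale.span_minimal) auto
  ultimately have "F = pscale.span (v ` B)" by blast
  then show FD: "fin_dim_subspace (dual Y) F" using B(1) Fsub by (auto simp: fin_dim_subspace_def)
  interpret dual_subspace Y F using Y FD by unfold_locales
  show "nrm W (Q y) \<le> opnorm ((dual Y)\<lparr>car := F\<rparr>) scalars (\<lambda>f. if f \<in> F then f y else 0)" if y: "y \<in> car Y" for y
  proof -
    have W: "normed W" and Ql: "lin Y W Q" and QL: "\<And>l. l \<in> L \<Longrightarrow> Q l = 0"
      using Q by (auto simp: quotient_map_def banach_space_def)
    have Qle: "nrm W (Q x) \<le> nrm Y x" if x: "x \<in> car Y" for x
    proof -
      have "nrm W (Q x) = Inf {nrm Y (x + l) | l. l \<in> L}" using Q x by (simp add: quotient_map_def)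
      also have "\<dots> \<le> nrm Y x"
      proof (rule cInf_lower)
        show "nrm Y x \<in> {nrm Y (x + l) | l. l \<in> L}" using L0 by force
        show "bdd_below {nrm Y (x + l) | l. l \<in> L}"
          using nrm_nonneg[OF Y car_add[OF Y x]] LY by (intro bdd_belowI[of _ 0]) auto
      qed
      finally show ?thesis .
    qed
    \<comment> \<open>A norming functional of \<open>Q y\<close>; composed with the contraction
      \<open>Q\<close> it annihilates \<open>L\<close> and has norm at most 1, so it is a test
      functional in \<open>F\<close>.\<close>
    obtain g where g: "lin W scalars g" "g (Q y) = of_real (nrm W (Q y))"
      "\<And>w. w \<in> car W \<Longrightarrow> norm (g w) \<le> nrm W w"
      using norming_functional[OF W lin_car[OF Ql y]] by blast
    define f where "f x = (if x \<in> car Y then g (Q x) else 0)" for x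
    have fb: "norm (g (Q x)) \<le> 1 * nrm Y x" if "x \<in> car Y" for x
      using g(3)[OF lin_car[OF Ql that]] Qle[OF that] by simp
    have "f \<in> car (dual Y)" unfolding f_def by (rule dual_extendI[OF lin_compose[OF Ql g(1)] Y fb])
    then have fF: "f \<in> F" using QL lin_0[OF g(1) W] by (auto simp: F_def f_def)
    have "opnorm Y scalars f \<le> 1" using fb by (intro opnorm_le[OF Y]) (auto simp: f_def)
    moreover have "norm (ev y f) \<le> opnorm G scalars (ev y) * nrm G f"
      using dual_bound[OF ev_in_dual[OF y] G, of f] fF by simp
    moreover have "0 \<le> opnorm G scalars (ev y)"
      using nrm_nonneg[OF normed_dual[OF G] ev_in_dual[OF y]] by simp
    ultimately have "norm (ev y f) \<le> opnorm G scalars (ev y) * 1"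
      using mult_left_mono[of "opnorm Y scalars f" 1 "opnorm G scalars (ev y)"] by simp
    moreover have "norm (ev y f) = nrm W (Q y)"
      using fF y g(2) nrm_nonneg[OF W lin_car[OF Ql y]] by (simp add: ev_def f_def)
    ultimately show ?thesis by (simp add: ev_def[abs_def])
  qed
qed

lemma quotient_norm_le_pairing:
  fixes \<nu> :: "('k::real_or_complex, 'a::ab_group_add) assignment" and X :: "nat \<Rightarrow> ('k, 'a) nspace"
    and Y V :: "('k, 'a) nspace"
  assumes \<nu>: "sigma_tensor_norm_on_duals \<nu>" and el: "election n X Y \<beta>"
    and E: "\<forall>i<n. fin_dim_subspace (X i) (E i)" and L: "closed_fin_codim_subspace Y L" and Q: "quotient_map Y L V Q"
    and v: "v \<in> tensors2 (Lspace n X \<beta>) Y"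
  obtains u where "u \<in> tensors2 (tensor_space n X \<beta>) (dual Y)" "alpha \<nu> n X \<beta> (dual Y) u \<le> 1"
    "\<nu> n (subs X E) V (norm_restr n X E \<beta>)
       (tmap (Lspace n X \<beta>) Y (Lspace n (subs X E) (norm_restr n X E \<beta>)) V (restr n X E) Q v)
     \<le> norm (pairing n X \<beta> (dual Y) Y (bidual_embedding Y) u v)"
proof -
  have Y: "normed Y" by (rule electionD(6)[OF el])
  have V: "banach_space V" "normed V" and Ql: "lin Y V Q"
    using Q by (auto simp: quotient_map_def banach_space_def)
  define F where "F = {f \<in> car (dual Y). \<forall>l\<in>L. f l = 0}"
  note qf = quotient_functionals[OF Y L Q, folded F_def]
  obtain W J where "restricted_election n X \<beta> E Y F \<nu> W J" by (rule restricted_election_exists[OF \<nu> el E qf(1)])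
  then interpret restricted_election n X \<beta> E Y F \<nu> W J .
  obtain C where C: "bounded_by Y W C 1" and C_onto: "C ` car Y = car W"
    and JC: "\<And>y. y \<in> car Y \<Longrightarrow> J (C y) = ev y"
    and C_norm: "\<And>y. y \<in> car Y \<Longrightarrow> nrm W (C y) = nrm (dual G) (ev y)"
    by (rule dual_copy_map[OF WJ]) (rule that, assumption+)
  have Cl: "lin Y W C" using C by (simp add: bounded_by_def)
  have QC: "nrm V (Q y) \<le> nrm W (C y)" if "y \<in> car Y" for y
    using qf(2)[OF that] C_norm[OF that] by (simp add: ev_def[abs_def])
  define s where "s w = (SOME y. y \<in> car Y \<and> C y = w)" for w
  have s: "s w \<in> car Y" "C (s w) = w" if "w \<in> car W" for w
  proof -
    have "w \<in> C ` car Y" using that C_onto by simp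
    then have "\<exists>y. y \<in> car Y \<and> C y = w" by auto
    from someI_ex[OF this] show "s w \<in> car Y" "C (s w) = w" by (simp_all add: s_def)
  qed
  define D where "D w = Q (s w)" for w
  have Q_eq: "Q y = Q y'" if "y \<in> car Y" "y' \<in> car Y" "C y = C y'" for y y'
  proof -
    have d: "y - y' \<in> car Y" by (rule car_diff[OF Y that(1,2)])
    have "nrm V (Q (y - y')) \<le> 0"
      using QC[OF d] lin_diff[OF Cl Y that(1,2)] that(3) nrm_0[OF W(2)] by simp
    then have "Q (y - y') = 0"
      using nrm_nonneg[OF V(2) lin_car[OF Ql d]] nrm_eq_0[OF V(2) lin_car[OF Ql d]] by simp
    then show ?thesis using lin_diff[OF Ql Y that(1,2)] by simp
  qed
  have DC: "D (C y) = Q y" if "y \<in> car Y" for y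
  proof -
    have c: "C y \<in> car W" by (rule lin_car[OF Cl that])
    show ?thesis unfolding D_def by (rule Q_eq[OF s(1)[OF c] that s(2)[OF c]])
  qed
  have Dl: "lin W V D"
    unfolding lin_def
  proof (intro conjI ballI allI)
    fix w assume w: "w \<in> car W"
    show "D w \<in> car V" unfolding D_def by (rule lin_car[OF Ql s(1)[OF w]])
    show "D (scl W c w) = scl V c (D w)" for c
      using DC[OF car_scale[OF Y s(1)[OF w], of c]] lin_scale[OF Cl s(1)[OF w], of c] lin_scale[OF Ql s(1)[OF w], of c] s(2)[OF w]
      by (simp add: D_def)
    fix w' assume w': "w' \<in> car W"
    show "D (w + w') = D w + D w'"
      using DC[OF car_add[OF Y s(1)[OF w] s(1)[OF w']]] lin_add[OF Cl s(1)[OF w] s(1)[OF w']]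
        lin_add[OF Ql s(1)[OF w] s(1)[OF w']] s(2)[OF w] s(2)[OF w']
      by (simp add: D_def)
  qed
  have D: "bounded_by W V D 1"
    unfolding bounded_by_def using Dl QC[OF s(1)] s(2) by (simp add: D_def)
  define v1 where "v1 = tmap LX Y LXE W (restr n X E) C v"
  have v1: "v1 \<in> tensors2 LXE W"
    unfolding v1_def by (rule tmap_in_tensors2[OF lin_restr Cl normed_Lspace[OF T] Y v])
  have id: "lin LXE LXE (\<lambda>\<phi>. \<phi>)" using bounded_by_id[of LXE] by (simp add: bounded_by_def)
  have "tmap LXE W LXE V (\<lambda>\<phi>. \<phi>) D v1 = tmap LX Y LXE V (restr n X E) (\<lambda>y. D (C y)) v"
    unfolding v1_def by (rule tmap_compose[OF normed_Lspace[OF TE] W(2) lin_restr Cl id Dl])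
  also have "\<dots> = tmap LX Y LXE V (restr n X E) Q v" by (rule tmap_cong) (simp_all add: DC)
  finally have v2: "tmap LX Y LXE V (restr n X E) Q v = tmap LXE W LXE V (\<lambda>\<phi>. \<phi>) D v1" by simp
  have le: "\<nu> n XE V \<beta>E (tmap LX Y LXE V (restr n X E) Q v) \<le> \<nu> n XE W \<beta>E v1"
    unfolding v2
    by (rule sigma_tensor_norm_map_le[OF \<nu> elW election_restr[OF V(1)] bounded_by_id preserves_Sigma_id D v1])
  note N = sigma_tensor_normD(1)[OF \<nu> elW]
  \<comment> \<open>The norming functional lives on the finite dimensional space containing
    \<open>v1\<close>, where every linear functional is the pairing with a tensor.\<close>
  obtain \<xi> where \<xi>: "lin (nu_space \<nu> n XE W \<beta>E) scalars \<xi>" "\<xi> v1 = of_real (\<nu> n XE W \<beta>E v1)"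
    and \<xi>_le: "\<And>w. w \<in> tensors2 LXE W \<Longrightarrow> norm (\<xi> w) \<le> \<nu> n XE W \<beta>E w"
    using norming_functional[OF N, of v1] v1 by auto
  obtain u' where u': "u' \<in> tensors2 TXE G" and pu': "\<And>w. w \<in> tensors2 LXE W \<Longrightarrow> pairing n XE \<beta>E G W J u' w = \<xi> w"
    by (rule functional_eq_pairing[OF \<xi>(1)]) (rule that, assumption+)
  define u where "u = tmap TXE G TX (dual Y) (incl n X E) id u'"
  have "lin G (dual Y) id" using F_sub by (auto simp: lin_def)
  then have "u \<in> tensors2 TX (dual Y)"
    unfolding u_def by (intro tmap_in_tensors2[OF lin_incl _ TE G u'])
  \<comment> \<open>\<open>u'\<close> is one competitor in the infimum, and its value there is the
    norm of \<xi>, at most 1.\<close>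
  moreover have "alpha \<nu> n X \<beta> (dual Y) u \<le> 1"
  proof -
    have "alpha \<nu> n X \<beta> (dual Y) u \<le> alpha_fin \<nu> n XE \<beta>E G u'"
      unfolding alpha_eq_Inf
    proof (rule cInf_lower[OF _ alpha_bdd_below[OF \<nu> el]])
      show "alpha_fin \<nu> n XE \<beta>E G u' \<in> alpha_values \<nu> n X \<beta> (dual Y) u"
        unfolding alpha_values_def using E qf(1) u' u_def by blast
    qed
    also have "\<dots> \<le> 1"
      unfolding alpha_fin_eq using \<xi>_le pu' by (intro opnorm_le[OF N]) simp_all
    finally show ?thesis .
  qed
  moreover have "\<nu> n XE W \<beta>E v1 = norm (pairing n X \<beta> (dual Y) Y (bidual_embedding Y) u v)"
    using pairing_restr[OF Cl JC u', of v] pu'[OF v1] \<xi>(2) nrm_nonneg[OF N, of v1] v1 by (simp add: u_def v1_def)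
  ultimately show ?thesis using that le by simp
qed

text \<open>The set in the definition of cofinite generation is nonempty, so its \<open>Sup\<close> is not a junk value.\<close>

lemma quotient_by_whole_space:
  fixes Y :: "('k::real_or_complex, 'a::ab_group_add) nspace"
  assumes Y: "normed Y"
  defines "Z \<equiv> \<lparr>car = {0}, scl = scl Y, nrm = (\<lambda>_. 0)\<rparr>"
  shows "closed_fin_codim_subspace Y (car Y)" "quotient_map Y (car Y) Z (\<lambda>_. 0 :: 'a)"
proof -
  interpret V: vector_space "scl Y" by (rule normed_vector_space[OF Y])
  have "V.span (car Y) = car Y" using normed_subspace_car[OF Y] by (simp add: V.span_eq_iff)
  then have "car Y = V.span (car Y \<union> {})" unfolding Un_empty_right by (rule sym)
  then show "closed_fin_codim_subspace Y (car Y)"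
    using normed_subspace_car[OF Y] unfolding closed_fin_codim_subspace_def by blast
  have Z: "normed Z" using V.vector_space_axioms by (auto simp: normed_def Z_def V.subspace_def)
  have "banach_space Z" by (rule fin_dim_banach[OF Z, of "{}"]) (simp_all add: Z_def)
  moreover have "Inf {nrm Y (x + l) | l. l \<in> car Y} = 0" if x: "x \<in> car Y" for x
  proof (rule antisym)
    have m: "0 \<in> {nrm Y (x + l) | l. l \<in> car Y}"
      using nrm_0[OF Y] car_neg[OF Y x] by (auto intro!: exI[of _ "- x"])
    have nn: "a \<ge> 0" if "a \<in> {nrm Y (x + l) | l. l \<in> car Y}" for a
      using that nrm_nonneg[OF Y car_add[OF Y x]] by auto
    show "Inf {nrm Y (x + l) | l. l \<in> car Y} \<le> 0" by (rule cInf_lower[OF m]) (rule bdd_belowI[OF nn])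
    show "0 \<le> Inf {nrm Y (x + l) | l. l \<in> car Y}" using m nn by (intro cInf_greatest) auto
  qed
  ultimately show "quotient_map Y (car Y) Z (\<lambda>_. 0)"
    using car_0[OF Y] by (auto simp: quotient_map_def lin_def Z_def)
qed

theorem theorem5p1:
  fixes \<nu> :: "('k::real_or_complex, 'a::ab_group_add) assignment"
    and n :: nat
    and X :: "nat \<Rightarrow> ('k, 'a) nspace"
    and Y :: "('k, 'a) nspace"
    and \<beta> :: "('k, 'a) tensor \<Rightarrow> real"
  assumes "sigma_tensor_norm_on_duals \<nu>"
    and "cofinitely_generated \<nu>"
    and "election n X Y \<beta>"
  shows "\<exists>T. lin (nu_space \<nu> n X Y \<beta>) (dual (alpha_space \<nu> n X \<beta> (dual Y))) T \<and>
    (\<forall>v\<in>car (nu_space \<nu> n X Y \<beta>).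
       nrm (dual (alpha_space \<nu> n X \<beta> (dual Y))) (T v) = \<nu> n X Y \<beta> v) \<and>
    (\<forall>\<phi>\<in>car (Lspace n X \<beta>). \<forall>y\<in>car Y. \<forall>x\<in>families n X. \<forall>f\<in>car (dual Y).
       T (tprod2 (Lspace n X \<beta>) Y \<phi> y)
         (tprod2 (tensor_space n X \<beta>) (dual Y) (tprod n X x) f) = \<phi> x * f y)"
proof -
  note \<nu> = assms(1) and el = assms(3)
  note X = electionD[OF el]
  let ?TX = "tensor_space n X \<beta>" and ?L = "Lspace n X \<beta>" and ?A = "alpha_space \<nu> n X \<beta> (dual Y)"
  note Y' = normed_dual[OF X(6)] and J = lin_bidual_embedding[OF X(6)]
  define p where "p = pairing n X \<beta> (dual Y) Y (bidual_embedding Y)"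
  \<comment> \<open>The cut-off off the tensor product makes \<open>T v\<close> an element of the
    dual, whose members vanish off the carrier.\<close>
  define T where "T v u = (if u \<in> tensors2 ?TX (dual Y) then p u v else 0)" for v u
  have nn: "0 \<le> \<nu> n X Y \<beta> v" if "v \<in> tensors2 ?L Y" for v
    using nrm_nonneg[OF sigma_tensor_normD(1)[OF \<nu> el], of v] that by simp
  have p_le: "norm (p u v) \<le> \<nu> n X Y \<beta> v * alpha \<nu> n X \<beta> (dual Y) u"
    if "v \<in> tensors2 ?L Y" "u \<in> tensors2 ?TX (dual Y)" for u v
    unfolding p_def by (rule norm_pairing_le_alpha[OF \<nu> el that])
  have T_bounded: "bounded_op ?A scalars (T v)" if v: "v \<in> tensors2 ?L Y" for v
  proof (rule bounded_opI)
    show "lin ?A scalars (T v)"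
      unfolding lin_scalars_iff alpha_space_simps
    proof (intro conjI ballI allI)
      fix u assume u: "u \<in> tensors2 ?TX (dual Y)"
      show "T v (pscale c u) = c * T v u" for c
        using u pairing_linear_left(2)[OF X(4) Y' X(6) J v u, of c] by (simp add: T_def p_def tensors2_pscale)
      fix u' assume u': "u' \<in> tensors2 ?TX (dual Y)"
      show "T v (u + u') = T v u + T v u'"
        using u u' pairing_linear_left(1)[OF X(4) Y' X(6) J v u u'] by (simp add: T_def p_def tensors2_add)
    qed
    show "nrm scalars (T v u) \<le> \<nu> n X Y \<beta> v * nrm ?A u" if "u \<in> car ?A" for u
      using p_le[OF v, of u] that by (simp add: T_def)
  qed
  have T_dual: "T v \<in> car (dual ?A)" if "v \<in> tensors2 ?L Y" for v
    using T_bounded[OF that] by (simp add: in_dual_iff T_def)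
  have "lin (nu_space \<nu> n X Y \<beta>) (dual ?A) T"
    using T_dual by (simp add: lin_def fun_eq_iff T_def p_def pairing_linear_right pscale_apply)
  moreover have "nrm (dual ?A) (T v) = \<nu> n X Y \<beta> v" if v: "v \<in> tensors2 ?L Y" for v
  proof (rule antisym)
    define S where "S = {norm (T v u) | u. u \<in> tensors2 ?TX (dual Y) \<and> alpha \<nu> n X \<beta> (dual Y) u \<le> 1}"
    have nrm_eq: "nrm (dual ?A) (T v) = Sup S" by (simp add: opnorm_def S_def)
    have S_le: "a \<le> \<nu> n X Y \<beta> v" if a: "a \<in> S" for a
    proof -
      obtain u where u: "a = norm (p u v)" "u \<in> tensors2 ?TX (dual Y)" "alpha \<nu> n X \<beta> (dual Y) u \<le> 1"
        using a by (auto simp: S_def T_def)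
      have "\<nu> n X Y \<beta> v * alpha \<nu> n X \<beta> (dual Y) u \<le> \<nu> n X Y \<beta> v * 1"
        using u(3) nn[OF v] by (intro mult_left_mono)
      then show ?thesis using p_le[OF v u(2)] u(1) by simp
    qed
    define R where "R = {\<nu> n (subs X E) W (norm_restr n X E \<beta>)
               (tmap (Lspace n X \<beta>) Y (Lspace n (subs X E) (norm_restr n X E \<beta>)) W
                  (restr n X E) Q v) | E L W Q.
             (\<forall>i<n. fin_dim_subspace (X i) (E i)) \<and> closed_fin_codim_subspace Y L \<and>
             quotient_map Y L W Q}"
    have R: "\<nu> n X Y \<beta> v = Sup R"
      using assms(2) el v unfolding cofinitely_generated_def R_def by simp
    have R_le: "\<exists>a\<in>S. r \<le> a" if rR: "r \<in> R" for r
    proof -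
      obtain E L W Q where r: "r = \<nu> n (subs X E) W (norm_restr n X E \<beta>)
               (tmap (Lspace n X \<beta>) Y (Lspace n (subs X E) (norm_restr n X E \<beta>)) W (restr n X E) Q v)"
        and EL: "\<forall>i<n. fin_dim_subspace (X i) (E i)" "closed_fin_codim_subspace Y L" "quotient_map Y L W Q"
        using rR unfolding R_def by blast
      obtain u where u: "u \<in> tensors2 ?TX (dual Y)" "alpha \<nu> n X \<beta> (dual Y) u \<le> 1" "r \<le> norm (p u v)"
        unfolding r p_def by (rule quotient_norm_le_pairing[OF \<nu> el EL v])
      then show ?thesis by (auto simp: S_def T_def intro!: bexI[of _ "norm (T v u)"])
    qed
    have R_ne: "R \<noteq> {}"
    proof -
      \<comment> \<open>Zero subspaces and the zero quotient supply a member of \<open>R\<close>.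
        Nonemptiness of \<open>R\<close> is required to compare the suprema, and through
        \<open>R_le\<close> it also yields nonemptiness of \<open>S\<close>.\<close>
      define E where "E i = module.span (scl (X i)) {}" for i
      have "\<forall>i<n. fin_dim_subspace (X i) (E i)"
        unfolding E_def using fin_dim_subspaceI[OF X(2), of _ "{}"] by simp
      moreover note quotient_by_whole_space[OF X(6)]
      ultimately have "\<nu> n (subs X E) \<lparr>car = {0}, scl = scl Y, nrm = (\<lambda>_. 0)\<rparr> (norm_restr n X E \<beta>)
          (tmap ?L Y (Lspace n (subs X E) (norm_restr n X E \<beta>)) \<lparr>car = {0}, scl = scl Y, nrm = (\<lambda>_. 0)\<rparr>
             (restr n X E) (\<lambda>_. 0) v) \<in> R"
        unfolding R_def by (intro CollectI exI conjI) (rule refl, assumption+)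
      then show ?thesis by blast
    qed
    have S_ne: "S \<noteq> {}" using R_ne R_le by blast
    show "nrm (dual ?A) (T v) \<le> \<nu> n X Y \<beta> v" unfolding nrm_eq by (rule cSup_least[OF S_ne S_le])
    show "\<nu> n X Y \<beta> v \<le> nrm (dual ?A) (T v)"
      unfolding nrm_eq R by (rule cSup_mono[OF R_ne _ R_le]) (rule bdd_aboveI[OF S_le])
  qed
  moreover have "T (tprod2 ?L Y \<phi> y) (tprod2 ?TX (dual Y) (tprod n X x) f) = \<phi> x * f y"
    if "\<phi> \<in> car ?L" "y \<in> car Y" "x \<in> families n X" "f \<in> car (dual Y)" for \<phi> y x f
    using pairing_tprod2[OF X(4,5) Y' X(6) J that(3,4,1,2)] that tprod_in_tensors[OF that(3)]
    by (simp add: T_def p_def tprod2_in_tensors2 bidual_embedding_def)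
  ultimately show ?thesis by (intro exI[of _ T]) simp
qed

end
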